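(* Let $k\in\mathbb{Z}_{\ge1}$, let $\lambda_1,\dots,\lambda_k\in\mathbb{C}^\times$ be distinct, let $n_1,\dots,n_k\in\mathbb{Z}_{\ge1}$, and for each $i$ let $\mu_i:\mathrm{Vir}^{(t-\lambda_i)^{n_i}}\to\mathbb{C}$ be a Lie algebra homomorphism. Define $f= \prod_{i=1}^k (t-\lambda_i)^{n_i}$ and $\mu=\sum_{i=1}^k \mu_i|_{\mathrm{Vir}^f}: \mathrm{Vir}^f\rightarrow \mathbb{C}$. Then $$\bigotimes_{i=1}^k V_{\mu_i}^{(t-\lambda_i)^{n_i}} \cong V^{f}_{\mu}$$ as $\mathrm{Vir}$-modules. Moreover, for any polynomial $f \in \mathbb{C}[t]$ with nonzero constant term and any Lie algebra homomorphism $\mu: \mathrm{Vir}^f \rightarrow \mathbb{C}$, the module $V^{f}_{\mu}$ has such a tensor product decomposition; and $V^{f}_{\mu}$ is simple if and only if $\mu$ has large degree.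
   Context: The Virasoro algebra $\mathrm{Vir}$ is the complex Lie algebra with basis $\{z\}\cup\{e_j \mid j\in\mathbb{Z}\}$ and bracket $[e_j,e_k]=(k-j)e_{j+k}+\delta_{k,-j}\frac{j^3-j}{12}z$, $[z,e_j]=0$. For a Laurent polynomial $g=\sum_j c_jt^j\in\mathbb{C}[t^{\pm}]$ put $e(g)=\sum_j c_je_j$. For $f\in\mathbb{C}[t]$ with nonzero constant term, $\mathrm{Vir}^f=\mathrm{span}_{\mathbb{C}}\{z,\ e(t^jf)\mid j\in\mathbb{Z}\}$, a Lie subalgebra of $\mathrm{Vir}$. For a Lie algebra homomorphism $\mu:\mathrm{Vir}^f\to\mathbb{C}$ ($\mathbb{C}$ abelian), $\mathbb{C}_\mu$ is the corresponding one-dimensional $\mathrm{Vir}^f$-module and $V^f_\mu=U(\mathrm{Vir})\otimes_{U(\mathrm{Vir}^f)}\mathbb{C}_\mu$. Every such $\mu$ satisfies $\mu(z)=0$, and for $g\in f\,\mathbb{C}[t^{\pm}]$ one writes $\mu(g)=\mu(e(g))$. Large degree: write $f=a\prod_{i=1}^k(t-\lambda_i)^{n_i}$ with $a\in\mathbb{C}^\times$ and distinct $\lambda_i\in\mathbb{C}^\times$. Every homomorphism $\mu:\mathrm{Vir}^f\to\mathbb{C}$ decomposes uniquely as $\mu=\sum_{i=1}^k\mu_i|_{\mathrm{Vir}^f}$ with homomorphisms $\mu_i:\mathrm{Vir}^{(t-\lambda_i)^{n_i}}\to\mathbb{C}$ given by $\mu_i(t^j(t-\lambda_i)^{n_i})=p_i(j)\lambda_i^j$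 ($j\in\mathbb{Z}$), $p_i$ a polynomial with $\deg p_i<n_i$. The homomorphism $\mu$ has large degree if $\deg(p_i)\ge n_i-2$ for each $1\le i\le k$. The zero polynomial has degree $-1$. If $f$ is constant then $k=0$, the empty tensor product is the trivial one-dimensional module, and the large degree condition is vacuous.
   Formalization: Large degree additionally requires every p_i to be nonzero: with deg 0 = −1 the simplicity criterion fails when n_i = 1 and p_i = 0 (e.g. f = t − λ, μ = 0, where the module has the trivial module as a proper quotient). *)

theory Defs
  imports
    Complex_Main
    "HOL-Library.Poly_Mapping"
    "HOL-Computational_Algebra.Polynomial"
    "HOL-Algebra.Module"
    "HOL-Algebra.QuotRing"
begin

section \<open>Free complex vector spaces\<close>

text \<open>The free complex vector space on a type of basis symbols is the type of finitely supported
  functions from that type to the complex numbers; \<open>Poly_Mapping.single b c\<close> is \<open>c\<close> times the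
  basis vector \<open>b\<close>.\<close>

definition smul :: "complex \<Rightarrow> ('b \<Rightarrow>\<^sub>0 complex) \<Rightarrow> ('b \<Rightarrow>\<^sub>0 complex)" where
  "smul c p = Poly_Mapping.map ((*) c) p"

abbreviation bv :: "'b \<Rightarrow> ('b \<Rightarrow>\<^sub>0 complex)" where
  "bv b \<equiv> Poly_Mapping.single b 1"

lemma lookup_smul [simp]: "Poly_Mapping.lookup (smul c p) b = c * Poly_Mapping.lookup p b"
  by (simp add: smul_def Poly_Mapping.map.rep_eq when_def)

interpretation pm: vector_space smul
  by unfold_locales (auto intro!: poly_mapping_eqI simp: lookup_add algebra_simps)

definition lin_ext :: "('b \<Rightarrow> ('d \<Rightarrow>\<^sub>0 complex)) \<Rightarrow> ('b \<Rightarrow>\<^sub>0 complex) \<Rightarrow> ('d \<Rightarrow>\<^sub>0 complex)" where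
  "lin_ext \<phi> p = (\<Sum>b\<in>Poly_Mapping.keys p. smul (Poly_Mapping.lookup p b) (\<phi> b))"


section \<open>The Virasoro algebra and its subalgebras\<close>

datatype vir_basis = Z | E int

type_synonym vir = "vir_basis \<Rightarrow>\<^sub>0 complex"

fun basis_bracket :: "vir_basis \<Rightarrow> vir_basis \<Rightarrow> vir" where
  "basis_bracket (E j) (E k) =
     Poly_Mapping.single (E (j + k)) (of_int (k - j)) +
     (if k = - j then Poly_Mapping.single Z (of_int (j ^ 3 - j) / 12) else 0)"
| "basis_bracket _ _ = 0"

definition bracket :: "vir \<Rightarrow> vir \<Rightarrow> vir" where
  "bracket x y = lin_ext (\<lambda>a. lin_ext (\<lambda>b. basis_bracket a b) y) x"

text \<open>The group ring of the integers, whose multiplication is convolution, is the ring of Laurent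
  polynomials.\<close>

type_synonym laurent = "int \<Rightarrow>\<^sub>0 complex"

definition laurent_of_poly :: "complex poly \<Rightarrow> laurent" where
  "laurent_of_poly f = (\<Sum>i\<le>degree f. Poly_Mapping.single (int i) (coeff f i))"

definition e_of :: "laurent \<Rightarrow> vir" where
  "e_of g = lin_ext (\<lambda>j. bv (E j)) g"

definition vir_gen :: "complex poly \<Rightarrow> int \<Rightarrow> vir" where
  "vir_gen f j = e_of (bv j * laurent_of_poly f)"

definition vir_sub :: "complex poly \<Rightarrow> vir set" where
  "vir_sub f = pm.span (insert (bv Z) (range (vir_gen f)))"

text \<open>A homomorphism from a Lie subalgebra \<open>L\<close> to the abelian Lie algebra of complex numbers is
  represented by a function on all of \<open>vir\<close> of which only the values on \<open>L\<close> matter; since the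
  target is abelian, it has to vanish on brackets.\<close>

definition lie_char :: "vir set \<Rightarrow> (vir \<Rightarrow> complex) \<Rightarrow> bool" where
  "lie_char L \<mu> \<longleftrightarrow>
     (\<forall>x\<in>L. \<forall>y\<in>L. \<mu> (x + y) = \<mu> x + \<mu> y) \<and>
     (\<forall>c. \<forall>x\<in>L. \<mu> (smul c x) = c * \<mu> x) \<and>
     (\<forall>x\<in>L. \<forall>y\<in>L. \<mu> (bracket x y) = 0)"


section \<open>Universal enveloping algebras\<close>

datatype 'a word = Word (letters: "'a list")

instantiation word :: (type) monoid_add
begin

definition zero_word :: "'a word" where "zero_word = Word []"

definition plus_word :: "'a word \<Rightarrow> 'a word \<Rightarrow> 'a word" where
  "plus_word u v = Word (letters u @ letters v)"

instance by standard (simp_all add: zero_word_def plus_word_def)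

end

text \<open>The monoid algebra of the free monoid is the free associative algebra.\<close>

type_synonym free_alg = "vir word \<Rightarrow>\<^sub>0 complex"

definition free_algebra :: "vir set \<Rightarrow> free_alg ring" where
  "free_algebra L = \<lparr>carrier = {p. \<forall>w\<in>Poly_Mapping.keys p. set (letters w) \<subseteq> L},
     mult = (*), one = 1, zero = 0, add = (+)\<rparr>"

abbreviation gen :: "vir \<Rightarrow> free_alg" where
  "gen x \<equiv> bv (Word [x])"

text \<open>The first two families of relations make the generators depend linearly on the elements of
  \<open>L\<close>, so that the quotient by them is the tensor algebra of \<open>L\<close>.\<close>

definition env_rels :: "vir set \<Rightarrow> free_alg set" where
  "env_rels L =
     {gen (x + y) - (gen x + gen y) | x y. x \<in> L \<and> y \<in> L} \<union>
     {gen (smul c x) - smul c (gen x) | c x. x \<in> L} \<union>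
     {gen x * gen y - gen y * gen x - gen (bracket x y) | x y. x \<in> L \<and> y \<in> L}"

definition env_ideal :: "vir set \<Rightarrow> free_alg set" where
  "env_ideal L = Idl\<^bsub>free_algebra L\<^esub> (env_rels L)"

definition env :: "vir set \<Rightarrow> free_alg set ring" where
  "env L = free_algebra L Quot env_ideal L"

definition env_class :: "vir set \<Rightarrow> free_alg \<Rightarrow> free_alg set" where
  "env_class L p = env_ideal L +>\<^bsub>free_algebra L\<^esub> p"

abbreviation U_vir :: "free_alg set ring" where
  "U_vir \<equiv> env UNIV"

definition env_scale :: "complex \<Rightarrow> free_alg set \<Rightarrow> free_alg set" where
  "env_scale c u = env_class UNIV (Poly_Mapping.single 0 c) \<otimes>\<^bsub>U_vir\<^esub> u"

text \<open>The homomorphism from \<open>U(L)\<close> to \<open>U(Vir)\<close> induced by the inclusion of \<open>L\<close>: it sends a coset of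
  \<open>env_ideal L\<close> to the coset of \<open>env_ideal UNIV\<close> containing it.\<close>

definition env_incl :: "free_alg set \<Rightarrow> free_alg set" where
  "env_incl a = env_ideal UNIV <+>\<^bsub>free_algebra UNIV\<^esub> a"

text \<open>The homomorphism from \<open>U(L)\<close> to the complex numbers extending \<open>\<mu>\<close>, through which \<open>U(L)\<close> acts
  on the one-dimensional module given by \<open>\<mu>\<close>.\<close>

definition free_eval :: "(vir \<Rightarrow> complex) \<Rightarrow> free_alg \<Rightarrow> complex" where
  "free_eval \<mu> p = (\<Sum>w\<in>Poly_Mapping.keys p. Poly_Mapping.lookup p w * prod_list (map \<mu> (letters w)))"

definition env_char :: "(vir \<Rightarrow> complex) \<Rightarrow> free_alg set \<Rightarrow> complex" where
  "env_char \<mu> a = the_elem (free_eval \<mu> ` a)"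


section \<open>Modules over the Virasoro algebra\<close>

definition complex_ring :: "complex ring" where
  "complex_ring = \<lparr>carrier = UNIV, mult = (*), one = 1, zero = 0, add = (+)\<rparr>"

text \<open>The fields \<open>mult\<close> and \<open>one\<close> inherited from \<^typ>\<open>('a, 'b) module\<close> are meaningless.\<close>

record 'v vir_mod = "(complex, 'v) module" +
  act :: "vir \<Rightarrow> 'v \<Rightarrow> 'v"

locale vir_module = module complex_ring V
  for V :: "'v vir_mod" (structure) +
  assumes act_closed: "v \<in> carrier V \<Longrightarrow> act V x v \<in> carrier V"
    and act_add_right:
      "\<lbrakk>v \<in> carrier V; w \<in> carrier V\<rbrakk> \<Longrightarrow> act V x (v \<oplus>\<^bsub>V\<^esub> w) = act V x v \<oplus>\<^bsub>V\<^esub> act V x w"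
    and act_scale_right: "v \<in> carrier V \<Longrightarrow> act V x (c \<odot>\<^bsub>V\<^esub> v) = c \<odot>\<^bsub>V\<^esub> act V x v"
    and act_add_left: "v \<in> carrier V \<Longrightarrow> act V (x + y) v = act V x v \<oplus>\<^bsub>V\<^esub> act V y v"
    and act_scale_left: "v \<in> carrier V \<Longrightarrow> act V (smul c x) v = c \<odot>\<^bsub>V\<^esub> act V x v"
    and act_bracket:
      "v \<in> carrier V \<Longrightarrow> act V (bracket x y) v = act V x (act V y v) \<ominus>\<^bsub>V\<^esub> act V y (act V x v)"

definition vir_iso :: "'v vir_mod \<Rightarrow> 'w vir_mod \<Rightarrow> bool" (infix \<open>\<cong>\<^sub>V\<close> 50) where
  "V \<cong>\<^sub>V W \<longleftrightarrow> vir_module V \<and> vir_module W \<and>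
     (\<exists>h. bij_betw h (carrier V) (carrier W) \<and>
       (\<forall>v\<in>carrier V. \<forall>w\<in>carrier V. h (v \<oplus>\<^bsub>V\<^esub> w) = h v \<oplus>\<^bsub>W\<^esub> h w) \<and>
       (\<forall>c. \<forall>v\<in>carrier V. h (c \<odot>\<^bsub>V\<^esub> v) = c \<odot>\<^bsub>W\<^esub> h v) \<and>
       (\<forall>x. \<forall>v\<in>carrier V. h (act V x v) = act W x (h v)))"

definition vir_submodule :: "'v set \<Rightarrow> 'v vir_mod \<Rightarrow> bool" where
  "vir_submodule W V \<longleftrightarrow> submodule W complex_ring V \<and> (\<forall>x. \<forall>w\<in>W. act V x w \<in> W)"

definition vir_simple :: "'v vir_mod \<Rightarrow> bool" where
  "vir_simple V \<longleftrightarrow> vir_module V \<and> carrier V \<noteq> {\<zero>\<^bsub>V\<^esub>} \<and>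
     (\<forall>W. vir_submodule W V \<longrightarrow> W = {\<zero>\<^bsub>V\<^esub>} \<or> W = carrier V)"

text \<open>The free vector space on the set \<open>B\<close> of symbols, with every element of \<open>vir\<close> acting by linear
  extension from the symbols.  This is not yet a module in the sense of \<open>vir_module\<close>; it only
  serves to be divided by the relations that define a tensor product.\<close>

definition free_mod :: "'b set \<Rightarrow> (vir \<Rightarrow> 'b \<Rightarrow> ('b \<Rightarrow>\<^sub>0 complex)) \<Rightarrow> ('b \<Rightarrow>\<^sub>0 complex) vir_mod" where
  "free_mod B \<phi> = \<lparr>carrier = {p. Poly_Mapping.keys p \<subseteq> B}, mult = undefined, one = undefined,
     zero = 0, add = (+), smult = smul, act = (\<lambda>x. lin_ext (\<phi> x))\<rparr>"

definition quot_mod :: "'v vir_mod \<Rightarrow> 'v set \<Rightarrow> 'v set vir_mod" where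
  "quot_mod M N = \<lparr>carrier = a_rcosets\<^bsub>M\<^esub> N, mult = undefined, one = undefined,
     zero = N, add = set_add M,
     smult = (\<lambda>c A. N <+>\<^bsub>M\<^esub> ((\<lambda>v. c \<odot>\<^bsub>M\<^esub> v) ` A)),
     act = (\<lambda>x A. N <+>\<^bsub>M\<^esub> (act M x ` A))\<rparr>"


section \<open>Induced modules and tensor products\<close>

text \<open>The tensor product of \<open>U(Vir)\<close> and the one-dimensional module given by \<open>\<mu>\<close> over \<open>U(Vir\<^sup>f)\<close>:
  the pair \<open>(u, c)\<close> stands for \<open>u \<otimes> c\<close>, and the last family of relations expresses
  \<open>u a \<otimes> c = u \<otimes> a c\<close> for \<open>a\<close> in \<open>U(Vir\<^sup>f)\<close>.\<close>

definition induced_rels ::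
    "complex poly \<Rightarrow> (vir \<Rightarrow> complex) \<Rightarrow> (free_alg set \<times> complex \<Rightarrow>\<^sub>0 complex) set" where
  "induced_rels f \<mu> =
     {bv (u \<oplus>\<^bsub>U_vir\<^esub> u', c) - (bv (u, c) + bv (u', c)) | u u' c.
        u \<in> carrier U_vir \<and> u' \<in> carrier U_vir} \<union>
     {bv (u, c + c') - (bv (u, c) + bv (u, c')) | u c c'. u \<in> carrier U_vir} \<union>
     {bv (env_scale d u, c) - smul d (bv (u, c)) | d u c. u \<in> carrier U_vir} \<union>
     {bv (u, d * c) - smul d (bv (u, c)) | d u c. u \<in> carrier U_vir} \<union>
     {bv (u \<otimes>\<^bsub>U_vir\<^esub> env_incl a, c) - bv (u, env_char \<mu> a * c) | u a c.
        u \<in> carrier U_vir \<and> a \<in> carrier (env (vir_sub f))}"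

definition induced ::
    "complex poly \<Rightarrow> (vir \<Rightarrow> complex) \<Rightarrow> (free_alg set \<times> complex \<Rightarrow>\<^sub>0 complex) set vir_mod" where
  "induced f \<mu> =
     quot_mod
       (free_mod (carrier U_vir \<times> UNIV)
         (\<lambda>x (u, c). bv (env_class UNIV (gen x) \<otimes>\<^bsub>U_vir\<^esub> u, c)))
       (pm.span (induced_rels f \<mu>))"

text \<open>The tensor product over the complex numbers of a finite family of modules: the extensional
  function \<open>t\<close> stands for the tensor product of the vectors \<open>t i\<close>.\<close>

definition tensor_rels :: "'i set \<Rightarrow> ('i \<Rightarrow> 'v vir_mod) \<Rightarrow> (('i \<Rightarrow> 'v) \<Rightarrow>\<^sub>0 complex) set" where
  "tensor_rels I M =
     {bv (t(i := v \<oplus>\<^bsub>M i\<^esub> w)) - (bv (t(i := v)) + bv (t(i := w))) | t i v w.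
        t \<in> (\<Pi>\<^sub>E i\<in>I. carrier (M i)) \<and> i \<in> I \<and> v \<in> carrier (M i) \<and> w \<in> carrier (M i)} \<union>
     {bv (t(i := c \<odot>\<^bsub>M i\<^esub> v)) - smul c (bv (t(i := v))) | t i c v.
        t \<in> (\<Pi>\<^sub>E i\<in>I. carrier (M i)) \<and> i \<in> I \<and> v \<in> carrier (M i)}"

definition tensor :: "'i set \<Rightarrow> ('i \<Rightarrow> 'v vir_mod) \<Rightarrow> (('i \<Rightarrow> 'v) \<Rightarrow>\<^sub>0 complex) set vir_mod" where
  "tensor I M =
     quot_mod
       (free_mod (\<Pi>\<^sub>E i\<in>I. carrier (M i))
         (\<lambda>x t. \<Sum>i\<in>I. bv (t(i := act (M i) x (t i)))))
       (pm.span (tensor_rels I M))"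


section \<open>Decomposition of homomorphisms and large degree\<close>

abbreviation linpow :: "complex \<Rightarrow> nat \<Rightarrow> complex poly" where
  "linpow l n \<equiv> [:- l, 1:] ^ n"

text \<open>Constant \<open>f\<close> corresponds to \<open>k = 0\<close>.\<close>

definition decomposition ::
    "complex poly \<Rightarrow> (vir \<Rightarrow> complex) \<Rightarrow> complex \<Rightarrow> nat \<Rightarrow> (nat \<Rightarrow> complex) \<Rightarrow> (nat \<Rightarrow> nat) \<Rightarrow>
     (nat \<Rightarrow> vir \<Rightarrow> complex) \<Rightarrow> bool" where
  "decomposition f \<mu> a k lam ns mus \<longleftrightarrow>
     a \<noteq> 0 \<and> inj_on lam {1..k} \<and> (\<forall>i\<in>{1..k}. lam i \<noteq> 0 \<and> ns i \<ge> 1) \<and>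
     f = Polynomial.smult a (\<Prod>i=1..k. linpow (lam i) (ns i)) \<and>
     (\<forall>i\<in>{1..k}. lie_char (vir_sub (linpow (lam i) (ns i))) (mus i)) \<and>
     (\<forall>x\<in>vir_sub f. \<mu> x = (\<Sum>i=1..k. mus i x))"

text \<open>The factorization of \<open>f\<close>, the \<open>mus\<close> and the polynomials \<open>ps\<close> are unique up to the order
  of the factors (and up to irrelevant values outside the index range and outside the subalgebras),
  so quantifying them existentially is no choice.

  The zero polynomial never counts as having degree at least \<open>ns i - 2\<close> (degree minus infinity).
  The convention that it has degree \<open>- 1\<close> differs from this only if \<open>ns i = 1\<close> and \<open>ps i = 0\<close>,
  and there it would make the simplicity criterion false: for \<open>f = t - l\<close> and \<open>\<mu> = 0\<close> the counit
  of \<open>U(Vir)\<close> induces a surjection from the infinite-dimensional induced module onto the trivial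
  module, so the induced module is not simple.\<close>

definition large_degree :: "complex poly \<Rightarrow> (vir \<Rightarrow> complex) \<Rightarrow> bool" where
  "large_degree f \<mu> \<longleftrightarrow>
     (\<exists>a k lam ns mus (ps :: nat \<Rightarrow> complex poly).
        decomposition f \<mu> a k lam ns mus \<and>
        (\<forall>i\<in>{1..k}.
           (\<forall>j. mus i (vir_gen (linpow (lam i) (ns i)) j) = poly (ps i) (of_int j) * lam i powi j) \<and>
           ps i \<noteq> 0 \<and> degree (ps i) < ns i \<and> int (degree (ps i)) \<ge> int (ns i) - 2))"

end

theory Submission
  imports Defs "HOL-Computational_Algebra.Fundamental_Theorem_Algebra" "HOL-Library.Multiset" "HOL-Library.Product_Plus"
begin

text \<open>As a module, \<open>V\<^sup>f\<close> is the free associative algebra on \<open>Vir\<close> divided by the left ideal \<open>J\<close> generated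
  by the relations of \<open>U(Vir)\<close> and the elements \<open>x - \<mu> x\<close> with \<open>x\<close> in \<open>Vir\<^sup>f\<close>. Every vector of it is killed by
  all \<open>e(g)\<close> with \<open>g\<close> vanishing to high order on the roots of \<open>f\<close>. Hence partial fractions split
  the action into commuting actions localized at the roots, and on the cyclic vector the action at the \<open>i\<close>-th
  root is governed by \<open>\<mu>\<^sub>i\<close>; this gives mutually inverse maps between \<open>V\<^sup>f\<close> and the tensor product.

  If \<open>\<mu>\<close> has large degree, the fields \<open>(t - \<lambda>)\<^sup>b d/dt\<close> with \<open>b \<ge> n\<close> lower the leading form of a vector with respect to
  a suitable weight, one root at a time, so that every nonzero submodule contains the cyclic vector.
  Otherwise \<open>\<mu>\<close> extends to the larger subalgebra in which the multiplicity of one root is lowered by one, and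
  the induced module of the extension is a proper quotient of \<open>V\<^sup>f\<close>.

  That this quotient is neither zero nor all of \<open>V\<^sup>f\<close> requires \<open>J\<close> not to be too large. Instead of the
  Poincare-Birkhoff-Witt theorem, this uses an explicit module: the dual of an algebra of polynomials
  on which vector fields act by derivations twisted by the cocycle of \<open>log (t\<^sub>1 - t\<^sub>2)\<close>. A suitable character of
  that algebra is an eigenvector of \<open>Vir\<^sup>f\<close> with eigenvalue \<open>\<mu>\<close>.\<close>

section \<open>Linear maps of free vector spaces\<close>

text \<open>The field \<open>(t - \<lambda>)^a d/dt\<close> with \<open>a < n\<close> has weight
  \<open>2 (n - a) - 1\<close>. If \<open>q\<close> is the largest index at which the character at
  the root does not vanish, large degree means that \<open>q\<close> is \<open>2 n - 1\<close> or,
  for n \<ge> 2, \<open>2 n - 2\<close>. On leading forms the field of index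
  \<open>q + 1 - a\<close>, minus its scalar, is then a nonzero multiple of the partial derivative
  in the variable of index \<open>a\<close>. The obstacle is \<open>n = 1\<close>: on powers of the
  single variable the factor is quadratic in the exponent and may vanish, and at that exponent the
  field of index 3 takes over. Coefficients of leading forms are vectors rather than scalars, since
  they carry what the other roots contribute; a form counts as nonzero if some coefficient lies
  outside \<open>J\<close>.

  In the dual module, derivations alone, or a twist by a coboundary, give eigenvalue 0 at a point
  fixed by \<open>Vir\<^sup>f\<close>. A nonzero \<mu> therefore has to come from a cocycle that is
  no coboundary. The further point detects that a field outside \<open>Vir\<^sup>f\<close> does not
  act by a scalar on the cyclic vector.\<close>

definition lin :: "(('b \<Rightarrow>\<^sub>0 complex) \<Rightarrow> ('d \<Rightarrow>\<^sub>0 complex)) \<Rightarrow> bool" where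
  "lin f \<longleftrightarrow> (\<forall>p q. f (p + q) = f p + f q) \<and> (\<forall>c p. f (smul c p) = smul c (f p))"

definition linc :: "(('b \<Rightarrow>\<^sub>0 complex) \<Rightarrow> complex) \<Rightarrow> bool" where
  "linc f \<longleftrightarrow> (\<forall>p q. f (p + q) = f p + f q) \<and> (\<forall>c p. f (smul c p) = c * f p)"

definition cext :: "('b \<Rightarrow> complex) \<Rightarrow> ('b \<Rightarrow>\<^sub>0 complex) \<Rightarrow> complex" where
  "cext \<phi> p = (\<Sum>b\<in>Poly_Mapping.keys p. Poly_Mapping.lookup p b * \<phi> b)"

lemma smul_eq_mult: "smul c p = Poly_Mapping.single 0 c * (p :: 'b::monoid_add \<Rightarrow>\<^sub>0 complex)"
proof (rule poly_mapping_eqI)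
  fix k
  have "Poly_Mapping.lookup (Poly_Mapping.single 0 c * p) k =
      (\<Sum>l. (c * (\<Sum>q. Poly_Mapping.lookup p q when k = l + q)) when l = 0)"
    unfolding lookup_mult by (rule Sum_any.cong) (auto simp: lookup_single when_def)
  also have "\<dots> = c * Poly_Mapping.lookup p k"
    by simp
  finally show "Poly_Mapping.lookup (smul c p) k = Poly_Mapping.lookup (Poly_Mapping.single 0 c * p) k"
    by simp
qed

lemma smul_single [simp]: "smul c (Poly_Mapping.single b d) = Poly_Mapping.single b (c * d)"
  by (rule poly_mapping_eqI) (simp add: lookup_single when_def)

lemma mult_smul_left [simp]: "smul c p * q = smul c (p * (q :: 'b::monoid_add \<Rightarrow>\<^sub>0 complex))"
  by (simp add: smul_eq_mult mult.assoc)

text \<open>Reduces a statement compatible with linear combinations to the symbols that occur in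
  \<open>p\<close>. The restriction to \<open>keys p\<close> makes it usable for elements supported
  in a given set.\<close>

lemma pm_induct [case_names zero add smul bv]:
  assumes "P 0" "\<And>p q. P p \<Longrightarrow> P q \<Longrightarrow> P (p + q)" "\<And>c p. P p \<Longrightarrow> P (smul c p)"
    "\<And>b. b \<in> Poly_Mapping.keys p \<Longrightarrow> P (bv b)"
  shows "P p"
proof -
  have eq: "p = (\<Sum>b\<in>Poly_Mapping.keys p. smul (Poly_Mapping.lookup p b) (bv b))"
    by (rule poly_mapping_eqI) (auto simp: lookup_sum lookup_single when_def in_keys_iff)
  have "P (\<Sum>b\<in>A. smul (Poly_Mapping.lookup p b) (bv b))" if "A \<subseteq> Poly_Mapping.keys p" "finite A" for A
    using that(2,1) by (induction A rule: finite_induct) (use assms in \<open>auto simp del: smul_single\<close>)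
  from this[of "Poly_Mapping.keys p"] show ?thesis using eq by simp
qed

lemma single_0_commute: "Poly_Mapping.single 0 c * p = p * Poly_Mapping.single 0 (c::complex)"
  for p :: "'b::monoid_add \<Rightarrow>\<^sub>0 complex"
proof (induction p rule: pm_induct)
  case (smul d p)
  have "Poly_Mapping.single 0 c * smul d p = smul d (Poly_Mapping.single 0 c * p)"
    by (simp add: smul_eq_mult mult_single mult.commute[of c d] flip: mult.assoc)
  then show ?case using smul by (simp add: smul_eq_mult mult.assoc)
qed (auto simp: distrib_left distrib_right mult_single)

lemma mult_smul_right [simp]: "p * smul c q = smul c (p * (q :: 'b::monoid_add \<Rightarrow>\<^sub>0 complex))"
  by (metis smul_eq_mult single_0_commute mult.assoc)

lemma lin_add: "lin f \<Longrightarrow> f (p + q) = f p + f q"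
  and lin_smul: "lin f \<Longrightarrow> f (smul c p) = smul c (f p)"
  by (auto simp: lin_def)

lemma lin_0: "lin f \<Longrightarrow> f 0 = 0"
  using lin_smul[of f 0 0] by simp

lemma lin_minus: "lin f \<Longrightarrow> f (- p) = - f p"
  using lin_smul[of f "-1" p] by simp

lemma lin_diff: "lin f \<Longrightarrow> f (p - q) = f p - f q"
  using lin_add[of f p "- q"] by (simp add: lin_minus)

lemma lin_sum: "lin f \<Longrightarrow> f (sum g A) = (\<Sum>a\<in>A. f (g a))"
  by (induction A rule: infinite_finite_induct) (auto simp: lin_0 lin_add)

lemma linc_add: "linc f \<Longrightarrow> f (p + q) = f p + f q"
  and linc_smul: "linc f \<Longrightarrow> f (smul c p) = c * f p"
  by (auto simp: linc_def)

lemma linc_0: "linc f \<Longrightarrow> f 0 = 0"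
  using linc_smul[of f 0 0] by simp

lemma linc_minus: "linc f \<Longrightarrow> f (- p) = - f p"
  using linc_smul[of f "-1" p] by simp

lemma linc_diff: "linc f \<Longrightarrow> f (p - q) = f p - f q"
  using linc_add[of f p "- q"] by (simp add: linc_minus)

lemma lin_comp: "lin f \<Longrightarrow> lin g \<Longrightarrow> lin (\<lambda>p. f (g p))"
  by (simp add: lin_def)

lemma linc_comp: "linc f \<Longrightarrow> lin g \<Longrightarrow> linc (\<lambda>p. f (g p))"
  by (simp add: lin_def linc_def)

lemma lin_plus: "lin f \<Longrightarrow> lin g \<Longrightarrow> lin (\<lambda>p. f p + g p)"
  by (simp add: lin_def algebra_simps)

lemma lin_subtract: "lin f \<Longrightarrow> lin g \<Longrightarrow> lin (\<lambda>p. f p - g p)"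
  by (simp add: lin_def algebra_simps pm.scale_right_diff_distrib)

lemma lin_uminus: "lin f \<Longrightarrow> lin (\<lambda>p. - f p)"
  by (simp add: lin_def)

lemma lin_scale: "lin f \<Longrightarrow> lin (\<lambda>p. smul c (f p))"
  by (simp add: lin_def algebra_simps)

lemma lin_setsum: "(\<And>a. a \<in> A \<Longrightarrow> lin (f a)) \<Longrightarrow> lin (\<lambda>p. \<Sum>a\<in>A. f a p)"
  by (simp add: lin_def sum.distrib pm.scale_sum_right)

lemma lin_zero: "lin (\<lambda>p. 0)"
  by (simp add: lin_def)

lemma lin_id: "lin (\<lambda>p. p)"
  by (simp add: lin_def)

lemma lin_mult_left: "lin ((*) (a :: 'b::monoid_add \<Rightarrow>\<^sub>0 complex))"
  by (simp add: lin_def distrib_left)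

lemma lin_mult_right: "lin (\<lambda>p. p * (a :: 'b::monoid_add \<Rightarrow>\<^sub>0 complex))"
  by (simp add: lin_def distrib_right)

lemma lin_ext_superset:
  assumes "finite A" "Poly_Mapping.keys p \<subseteq> A"
  shows "lin_ext \<phi> p = (\<Sum>b\<in>A. smul (Poly_Mapping.lookup p b) (\<phi> b))"
  unfolding lin_ext_def using assms
  by (intro sum.mono_neutral_left) (auto simp: in_keys_iff)

lemma cext_superset:
  assumes "finite A" "Poly_Mapping.keys p \<subseteq> A"
  shows "cext \<phi> p = (\<Sum>b\<in>A. Poly_Mapping.lookup p b * \<phi> b)"
  unfolding cext_def using assms
  by (intro sum.mono_neutral_left) (auto simp: in_keys_iff)

lemma keys_smul: "Poly_Mapping.keys (smul c p) \<subseteq> Poly_Mapping.keys p"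
  by (auto simp: in_keys_iff)

lemma lin_lin_ext: "lin (lin_ext \<phi>)"
proof -
  have "lin_ext \<phi> (p + q) = lin_ext \<phi> p + lin_ext \<phi> q" for p q
  proof -
    let ?A = "Poly_Mapping.keys p \<union> Poly_Mapping.keys q"
    have "lin_ext \<phi> (p + q) = (\<Sum>b\<in>?A. smul (Poly_Mapping.lookup (p + q) b) (\<phi> b))"
      by (rule lin_ext_superset) (auto simp: Poly_Mapping.keys_add)
    also have "\<dots> = (\<Sum>b\<in>?A. smul (Poly_Mapping.lookup p b) (\<phi> b)) +
        (\<Sum>b\<in>?A. smul (Poly_Mapping.lookup q b) (\<phi> b))"
      by (simp add: lookup_add pm.scale_left_distrib sum.distrib)
    also have "\<dots> = lin_ext \<phi> p + lin_ext \<phi> q"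
      by (simp add: lin_ext_superset[of ?A])
    finally show ?thesis .
  qed
  moreover have "lin_ext \<phi> (smul c p) = smul c (lin_ext \<phi> p)" for c p
    by (subst lin_ext_superset[OF _ keys_smul])
       (auto simp: lin_ext_def pm.scale_sum_right)
  ultimately show ?thesis by (simp add: lin_def)
qed

lemma linc_cext: "linc (cext \<phi>)"
proof -
  have "cext \<phi> (p + q) = cext \<phi> p + cext \<phi> q" for p q
  proof -
    let ?A = "Poly_Mapping.keys p \<union> Poly_Mapping.keys q"
    have "cext \<phi> (p + q) = (\<Sum>b\<in>?A. Poly_Mapping.lookup (p + q) b * \<phi> b)"
      by (rule cext_superset) (auto simp: Poly_Mapping.keys_add)
    also have "\<dots> = (\<Sum>b\<in>?A. Poly_Mapping.lookup p b * \<phi> b) +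
        (\<Sum>b\<in>?A. Poly_Mapping.lookup q b * \<phi> b)"
      by (simp add: lookup_add distrib_right sum.distrib)
    also have "\<dots> = cext \<phi> p + cext \<phi> q"
      by (simp add: cext_superset[of ?A])
    finally show ?thesis .
  qed
  moreover have "cext \<phi> (smul c p) = c * cext \<phi> p" for c p
    by (subst cext_superset[OF _ keys_smul])
       (auto simp: cext_def sum_distrib_left mult.assoc)
  ultimately show ?thesis by (simp add: linc_def)
qed

lemma lin_ext_single [simp]: "lin_ext \<phi> (Poly_Mapping.single b c) = smul c (\<phi> b)"
  by (simp add: lin_ext_def)

lemma cext_single [simp]: "cext \<phi> (Poly_Mapping.single b c) = c * \<phi> b"
  by (simp add: cext_def)

lemma lin_eqI:
  assumes "lin f" "lin g" "\<And>b. b \<in> Poly_Mapping.keys p \<Longrightarrow> f (bv b) = g (bv b)"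
  shows "f p = g p"
  by (induction p rule: pm_induct) (use assms in \<open>auto simp: lin_0 lin_add lin_smul\<close>)

lemma linc_eqI:
  assumes "linc f" "linc g" "\<And>b. b \<in> Poly_Mapping.keys p \<Longrightarrow> f (bv b) = g (bv b)"
  shows "f p = g p"
  by (induction p rule: pm_induct) (use assms in \<open>auto simp: linc_0 linc_add linc_smul\<close>)

lemma lin_mem_subspace:
  assumes "lin f" "pm.subspace S" "\<And>b. b \<in> Poly_Mapping.keys p \<Longrightarrow> f (bv b) \<in> S"
  shows "f p \<in> S"
  by (induction p rule: pm_induct)
     (use assms in \<open>auto simp: lin_0 lin_add lin_smul pm.subspace_0 pm.subspace_add pm.subspace_scale\<close>)

lemma subspace_vimage: "lin f \<Longrightarrow> pm.subspace S \<Longrightarrow> pm.subspace {p. f p \<in> S}"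
  by (auto simp: pm.subspace_def lin_0 lin_add lin_smul)

lemma lin_span_image:
  assumes "lin f" "pm.subspace S" "p \<in> pm.span A" "\<And>a. a \<in> A \<Longrightarrow> f a \<in> S"
  shows "f p \<in> S"
  using pm.span_minimal[OF _ subspace_vimage[OF assms(1,2)], of A] assms(3,4) by auto

lemma linc_span_zero:
  assumes "linc f" "p \<in> pm.span A" "\<And>a. a \<in> A \<Longrightarrow> f a = 0"
  shows "f p = 0"
proof -
  have "pm.subspace {p. f p = 0}"
    using assms(1) by (auto simp: pm.subspace_def linc_0 linc_add linc_smul)
  from pm.span_minimal[OF _ this, of A] assms(2,3) show ?thesis by auto
qed

lemma subspace_support: "pm.subspace {p :: 'b \<Rightarrow>\<^sub>0 complex. Poly_Mapping.keys p \<subseteq> B}"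
  unfolding pm.subspace_def
  by (auto dest!: subsetD[OF Poly_Mapping.keys_add] subsetD[OF keys_smul])


section \<open>Laurent polynomials and vector fields\<close>

text \<open>The Euler operator t d/dt.\<close>

definition D :: "laurent \<Rightarrow> laurent" where
  "D g = lin_ext (\<lambda>j. Poly_Mapping.single j (of_int j)) g"

text \<open>Under \<open>t\<^sup>j \<mapsto> E j\<close> the Laurent polynomial \<open>g\<close> is the vector field \<open>g t d/dt\<close>.\<close>

definition wbr :: "laurent \<Rightarrow> laurent \<Rightarrow> laurent" where
  "wbr g h = g * D h - D g * h"

text \<open>The projection of \<open>Vir\<close> onto the Witt algebra, with kernel spanned by the
  central element. Characters of \<open>Vir\<^sup>f\<close> vanish on that element, so the action on
  \<open>V\<^sup>f\<close> depends on \<open>v\<close> only through \<open>lg v\<close>.\<close>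

definition lg :: "vir \<Rightarrow> laurent" where
  "lg = lin_ext (\<lambda>b. case b of Z \<Rightarrow> 0 | E j \<Rightarrow> bv j)"

abbreviation LP :: "complex poly \<Rightarrow> laurent" where
  "LP \<equiv> laurent_of_poly"

lemma lin_D: "lin D"
  using lin_lin_ext by (simp add: D_def[abs_def])

lemma lin_lg: "lin lg"
  using lin_lin_ext by (simp add: lg_def)

lemma lin_e_of: "lin e_of"
  using lin_lin_ext by (simp add: e_of_def[abs_def])

lemma D_single [simp]: "D (Poly_Mapping.single j c) = Poly_Mapping.single j (c * of_int j)"
  by (simp add: D_def)

lemma D_mult: "D (g * h) = D g * h + g * D h"
proof -
  have 1: "D (bv i * h) = D (bv i) * h + bv i * D h" for i h
  proof (rule lin_eqI[where f = "\<lambda>h. D (bv i * h)"])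
    show "lin (\<lambda>h. D (bv i) * h + bv i * D h)"
      by (intro lin_plus lin_mult_left lin_comp[OF lin_mult_left lin_D])
    show "D (bv i * bv j) = D (bv i) * bv j + bv i * D (bv j)" for j
      by (simp add: mult_single flip: single_add)
  qed (intro lin_comp[OF lin_D] lin_mult_left)
  show ?thesis
    by (rule lin_eqI[where f = "\<lambda>g. D (g * h)"])
      (intro lin_comp[OF lin_D] lin_mult_right lin_plus lin_comp[OF lin_mult_right lin_D] 1)+
qed

lemma D_diff: "D (g - h) = D g - D h" and D_0: "D 0 = 0"
  using lin_diff[OF lin_D] lin_0[OF lin_D] by auto

lemma D_1: "D 1 = 0"
  by (simp flip: single_one)

lemma D_power_dvd: "h ^ n dvd D (h ^ Suc n)"
proof (induction n)
  case (Suc n)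
  have "D (h ^ Suc (Suc n)) = D h * h ^ Suc n + h * D (h ^ Suc n)"
    by (simp only: power_Suc[of h "Suc n"] D_mult)
  moreover have "h ^ Suc n dvd h * D (h ^ Suc n)"
    using mult_dvd_mono[OF dvd_refl[of h] Suc] by simp
  ultimately show ?case by (simp del: power_Suc)
qed auto

lemma D_dvd: "h ^ Suc n dvd g \<Longrightarrow> h ^ n dvd D g"
proof -
  assume "h ^ Suc n dvd g"
  then obtain q where "g = h ^ Suc n * q" by (rule dvdE)
  then have "D g = D (h ^ Suc n) * q + h ^ Suc n * D q" by (simp only: D_mult)
  moreover have "h ^ n dvd h ^ Suc n" by (rule le_imp_power_dvd) simp
  ultimately show ?thesis using D_power_dvd[of h n] by (metis dvd_add dvd_mult2)
qed

text \<open>A bracket costs at most one order of vanishing. This is why a field vanishing to high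
  order kills a given word applied to the cyclic vector.\<close>

lemma wbr_dvd_left: "h ^ Suc n dvd a \<Longrightarrow> h ^ n dvd wbr a b"
  using D_dvd[of h n a] power_le_dvd[of h "Suc n" a n] unfolding wbr_def
  by (intro dvd_diff dvd_mult2) simp_all

lemma wbr_dvd_right: "h ^ Suc n dvd b \<Longrightarrow> h ^ n dvd wbr a b"
  using D_dvd[of h n b] power_le_dvd[of h "Suc n" b n] unfolding wbr_def
  by (intro dvd_diff dvd_mult) simp_all

text \<open>The two terms with \<open>D h\<close> cancel. So brackets of elements of
  \<open>Vir\<^sup>f\<close> are multiples of \<open>f^2\<close> modulo the central element.\<close>

lemma wbr_mult_self: "wbr (h * a) (h * b) = h\<^sup>2 * wbr a b"
  by (simp add: wbr_def D_mult algebra_simps power2_eq_square)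

lemma lg_e_of [simp]: "lg (e_of g) = g"
  by (rule lin_eqI[where f = "\<lambda>g. lg (e_of g)"])
     (intro lin_comp[OF lin_lg lin_e_of] lin_id | simp add: lg_def e_of_def)+

lemma lg_Z [simp]: "lg (Poly_Mapping.single Z c) = 0"
  by (simp add: lg_def)

lemma vir_decomp: "v = e_of (lg v) + smul (Poly_Mapping.lookup v Z) (bv Z)"
proof -
  have *: "lin (\<lambda>v. smul (Poly_Mapping.lookup v Z) (bv Z))"
    by (simp add: lin_def lookup_add single_add)
  show ?thesis
  proof (rule lin_eqI[where f = "\<lambda>v. v"])
    show "lin (\<lambda>v. e_of (lg v) + smul (Poly_Mapping.lookup v Z) (bv Z))"
      by (intro lin_plus * lin_comp[OF lin_e_of lin_lg])
    show "bv b = e_of (lg (bv b)) + smul (Poly_Mapping.lookup (bv b) Z) (bv Z)" for b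
      by (cases b) (auto simp: lg_def e_of_def lin_0[OF lin_lin_ext] lookup_single)
  qed (rule lin_id)
qed

lemma lin_bracket_left: "lin (\<lambda>v. bracket v w)"
  unfolding bracket_def by (rule lin_lin_ext)

lemma lin_bracket_right: "lin (bracket v)"
  unfolding bracket_def lin_ext_def[of _ v]
  by (intro lin_setsum lin_scale lin_lin_ext)

lemma lin_wbr_left: "lin (\<lambda>v. wbr v w)"
  unfolding wbr_def by (intro lin_subtract lin_mult_right lin_comp[OF lin_mult_right lin_D])

lemma lin_wbr_right: "lin (wbr v)"
  unfolding wbr_def[abs_def] by (intro lin_subtract lin_mult_left lin_comp[OF lin_mult_left lin_D])

lemma lg_bracket: "lg (bracket v w) = wbr (lg v) (lg w)"
proof -
  have 0: "lg (bracket (bv a) (bv b)) = wbr (lg (bv a)) (lg (bv b))" for a b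
    by (cases a; cases b)
       (auto simp: bracket_def lg_def lin_add[OF lin_lin_ext] lin_0[OF lin_lin_ext] wbr_def D_0
          mult_single of_int_diff simp flip: single_diff)
  have 1: "lg (bracket (bv a) w) = wbr (lg (bv a)) (lg w)" for a w
    by (rule lin_eqI[where f = "\<lambda>w. lg (bracket (bv a) w)"])
       (auto intro!: lin_comp[OF lin_lg] lin_bracket_right lin_comp[OF lin_wbr_right lin_lg] simp: 0)
  show ?thesis
    by (rule lin_eqI[where f = "\<lambda>v. lg (bracket v w)"])
       (auto intro!: lin_comp[OF lin_lg] lin_bracket_left lin_comp[OF lin_wbr_left lin_lg] simp: 1)
qed

section \<open>Ordinary polynomials as Laurent polynomials\<close>

lemma lookup_LP: "Poly_Mapping.lookup (LP f) j = (if j \<ge> 0 then coeff f (nat j) else 0)"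
proof -
  have "Poly_Mapping.lookup (LP f) j = (\<Sum>i\<le>degree f. if int i = j then coeff f i else 0)"
    by (simp add: laurent_of_poly_def lookup_sum lookup_single when_def)
  also have "\<dots> = (if j \<ge> 0 then coeff f (nat j) else 0)"
  proof (cases "j \<ge> 0")
    case True
    then have "(\<Sum>i\<le>degree f. if int i = j then coeff f i else 0) =
        (\<Sum>i\<le>degree f. if i = nat j then coeff f i else 0)"
      by (intro sum.cong) auto
    then show ?thesis using True by (auto simp: coeff_eq_0)
  qed (auto intro!: sum.neutral)
  finally show ?thesis .
qed

lemma LP_add: "LP (f + g) = LP f + LP g" and LP_0: "LP 0 = 0"
  by (auto intro!: poly_mapping_eqI simp: lookup_LP lookup_add)

lemma LP_smult: "LP (Polynomial.smult c f) = smul c (LP f)"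
  by (auto intro!: poly_mapping_eqI simp: lookup_LP)

lemma lookup_bv_mult: "Poly_Mapping.lookup (bv i * g) (j::int) = Poly_Mapping.lookup g (j - i)"
proof -
  have "linc (\<lambda>g. Poly_Mapping.lookup (bv i * g) j)" "linc (\<lambda>g. Poly_Mapping.lookup g (j - i))"
    by (auto simp: linc_def lookup_add distrib_left)
  then show ?thesis
    by (rule linc_eqI) (auto simp: mult_single lookup_single when_def)
qed

lemma LP_pCons: "LP (pCons a f) = Poly_Mapping.single 0 a + bv 1 * LP f"
  by (rule poly_mapping_eqI)
     (auto simp: lookup_LP lookup_add lookup_bv_mult lookup_single when_def coeff_pCons nat_diff_distrib
       split: nat.splits)

lemma LP_mult: "LP (f * g) = LP f * LP g"
  by (induction f) (auto simp: LP_0 LP_add LP_smult LP_pCons smul_eq_mult algebra_simps)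

lemma LP_1: "LP 1 = 1"
  by (rule poly_mapping_eqI) (auto simp: lookup_LP lookup_one when_def one_pCons coeff_pCons split: nat.splits)

lemma LP_power: "LP (f ^ n) = LP f ^ n"
  by (induction n) (auto simp: LP_1 LP_mult)

lemma bv_power_int: "bv (j::int) * bv (- j) = (1 :: laurent)"
  by (simp add: mult_single flip: single_one)

lemma vir_gen_lg: "lg (vir_gen f j) = bv j * LP f"
  by (simp add: vir_gen_def)

lemma dvd_smul: "a dvd b \<Longrightarrow> a dvd smul c (b :: laurent)"
  by (simp add: smul_eq_mult dvd_mult)

text \<open>The products \<open>t^j f\<close> span all Laurent multiples of \<open>f\<close>, and
  the central element projects to 0. From here on membership in the subalgebra is a divisibility
  statement.\<close>

lemma vir_sub_iff: "v \<in> vir_sub f \<longleftrightarrow> LP f dvd lg v"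
proof
  assume "v \<in> vir_sub f"
  have "pm.subspace {v. LP f dvd lg v}"
    by (auto simp: pm.subspace_def lin_0[OF lin_lg] lin_add[OF lin_lg] lin_smul[OF lin_lg] dvd_smul)
  from pm.span_minimal[OF _ this, of "insert (bv Z) (range (vir_gen f))"] \<open>v \<in> vir_sub f\<close>
  show "LP f dvd lg v" by (auto simp: vir_sub_def vir_gen_lg image_subset_iff)
next
  assume "LP f dvd lg v"
  then obtain g where "lg v = LP f * g" by (rule dvdE)
  then have g: "lg v = g * LP f" by (simp only: mult.commute)
  have "e_of (g * LP f) \<in> vir_sub f"
    by (rule lin_mem_subspace[where f = "\<lambda>g. e_of (g * LP f)"])
       (auto intro!: lin_comp[OF lin_e_of lin_mult_right] pm.span_base simp: vir_sub_def vir_gen_def)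
  moreover have "bv Z \<in> vir_sub f" by (simp add: vir_sub_def pm.span_base)
  ultimately show "v \<in> vir_sub f"
    using vir_decomp[of v] g unfolding vir_sub_def
    by (metis pm.span_add pm.span_scale)
qed


section \<open>Modules presented as quotients of spaces of symbols\<close>

definition eqm :: "('b \<Rightarrow>\<^sub>0 complex) set \<Rightarrow> ('b \<Rightarrow>\<^sub>0 complex) \<Rightarrow> ('b \<Rightarrow>\<^sub>0 complex) \<Rightarrow> bool" where
  "eqm S p q \<longleftrightarrow> p - q \<in> S"

text \<open>The free algebra acts strictly through \<open>T\<close>, products going to compositions.
  Only the relations of \<open>U(Vir)\<close> are left to hold modulo a subspace.\<close>

definition op :: "(vir \<Rightarrow> ('b \<Rightarrow>\<^sub>0 complex) \<Rightarrow> ('b \<Rightarrow>\<^sub>0 complex)) \<Rightarrow> free_alg \<Rightarrow> ('b \<Rightarrow>\<^sub>0 complex) \<Rightarrow> ('b \<Rightarrow>\<^sub>0 complex)" where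
  "op T p x = lin_ext (\<lambda>w. foldr T (letters w) x) p"

text \<open>\<open>C / S\<close> is a module: only the action on \<open>C\<close> modulo \<open>S\<close> matters.\<close>

locale vmod =
  fixes C S :: "('b \<Rightarrow>\<^sub>0 complex) set" and T :: "vir \<Rightarrow> ('b \<Rightarrow>\<^sub>0 complex) \<Rightarrow> ('b \<Rightarrow>\<^sub>0 complex)"
  assumes sub_C: "pm.subspace C" and sub_S: "pm.subspace S" and S_C: "S \<subseteq> C"
    and T_C: "p \<in> C \<Longrightarrow> T v p \<in> C" and T_S: "p \<in> S \<Longrightarrow> T v p \<in> S" and T_lin: "lin (T v)"
    and T_plus: "p \<in> C \<Longrightarrow> eqm S (T (v + w) p) (T v p + T w p)"
    and T_scale: "p \<in> C \<Longrightarrow> eqm S (T (smul c v) p) (smul c (T v p))"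
    and T_bracket: "p \<in> C \<Longrightarrow> eqm S (T (bracket v w) p) (T v (T w p) - T w (T v p))"
begin

abbreviation eqS (infix \<open>\<approx>\<close> 50) where "p \<approx> q \<equiv> eqm S p q"

lemma eqS_refl [simp, intro]: "p \<approx> p"
  using pm.subspace_0[OF sub_S] by (simp add: eqm_def)

lemma eqS_sym: "p \<approx> q \<Longrightarrow> q \<approx> p"
  using pm.subspace_neg[OF sub_S, of "p - q"] by (simp add: eqm_def)

lemma eqS_trans [trans]: "p \<approx> q \<Longrightarrow> q \<approx> r \<Longrightarrow> p \<approx> r"
  using pm.subspace_add[OF sub_S, of "p - q" "q - r"] by (simp add: eqm_def)

lemma eqS_add: "p \<approx> q \<Longrightarrow> p' \<approx> q' \<Longrightarrow> p + p' \<approx> q + q'"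
  using pm.subspace_add[OF sub_S, of "p - q" "p' - q'"] by (simp add: eqm_def algebra_simps)

lemma eqS_diff: "p \<approx> q \<Longrightarrow> p' \<approx> q' \<Longrightarrow> p - p' \<approx> q - q'"
  using pm.subspace_diff[OF sub_S, of "p - q" "p' - q'"] by (simp add: eqm_def algebra_simps)

lemma eqS_smul: "p \<approx> q \<Longrightarrow> smul c p \<approx> smul c q"
  using pm.subspace_scale[OF sub_S, of "p - q" c] by (simp add: eqm_def pm.scale_right_diff_distrib)

lemma eqS_sum: "(\<And>a. a \<in> A \<Longrightarrow> g a \<approx> h a) \<Longrightarrow> sum g A \<approx> sum h A"
  by (induction A rule: infinite_finite_induct) (auto intro: eqS_add)

lemma eqS_T: "p \<approx> q \<Longrightarrow> T v p \<approx> T v q"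
  using T_S[of "p - q" v] by (simp add: eqm_def lin_diff[OF T_lin])

lemma eqS_0: "p \<approx> 0 \<longleftrightarrow> p \<in> S"
  by (simp add: eqm_def)

lemma eqS_mem: "p \<approx> q \<Longrightarrow> S \<subseteq> W \<Longrightarrow> pm.subspace W \<Longrightarrow> p \<in> W \<longleftrightarrow> q \<in> W"
  using pm.subspace_add[of W "p - q" q] pm.subspace_diff[of W p "p - q"] by (auto simp: eqm_def)

lemma eqS_S: "p \<approx> q \<Longrightarrow> p \<in> S \<longleftrightarrow> q \<in> S"
  using eqS_mem sub_S by blast

lemma T_minus: "p \<in> C \<Longrightarrow> T (v - w) p \<approx> T v p - T w p"
  using T_plus[of p v "smul (-1) w"] eqS_add[OF eqS_refl[of "T v p"] T_scale[of p "-1" w]]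
  by (auto intro: eqS_trans)

lemma foldr_C: "x \<in> C \<Longrightarrow> foldr T vs x \<in> C"
  and foldr_S: "x \<in> S \<Longrightarrow> foldr T vs x \<in> S"
  by (induction vs) (auto intro: T_C T_S)

lemma lin_foldr: "lin (foldr T vs)"
proof (induction vs)
  case (Cons v vs)
  then show ?case using lin_comp[OF T_lin[of v]] by (simp add: comp_def)
qed (simp add: lin_id id_def)

lemma lin_op: "lin (\<lambda>p. op T p x)"
  unfolding op_def by (rule lin_lin_ext)

lemma lin_op_right: "lin (op T p)"
  unfolding op_def[abs_def] lin_ext_def by (intro lin_setsum lin_scale lin_foldr)

lemma op_1 [simp]: "op T 1 x = x"
  by (simp add: op_def zero_word_def flip: single_one)

lemma op_word: "op T (bv u) x = foldr T (letters u) x"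
  by (simp add: op_def)

lemma op_word_mult: "op T (bv u * q) x = foldr T (letters u) (op T q x)"
proof (rule lin_eqI[where f = "\<lambda>q. op T (bv u * q) x"])
  show "lin (\<lambda>q. op T (bv u * q) x)" by (rule lin_comp[OF lin_op lin_mult_left])
  show "lin (\<lambda>q. foldr T (letters u) (op T q x))" by (rule lin_comp[OF lin_foldr lin_op])
qed (simp add: op_def mult_single plus_word_def)

lemma op_mult: "op T (p * q) x = op T p (op T q x)"
proof (rule lin_eqI[where f = "\<lambda>p. op T (p * q) x"])
  show "lin (\<lambda>p. op T (p * q) x)" by (rule lin_comp[OF lin_op lin_mult_right])
qed (auto simp: op_word_mult op_word lin_op)

lemma op_gen: "op T (gen v) x = T v x"
  by (simp add: op_word)

lemma op_C: "x \<in> C \<Longrightarrow> op T p x \<in> C"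
  by (rule lin_mem_subspace[OF lin_op sub_C]) (simp add: op_word foldr_C)

lemma op_S: "x \<in> S \<Longrightarrow> op T p x \<in> S"
  by (rule lin_mem_subspace[OF lin_op sub_S]) (simp add: op_word foldr_S)

lemma eqS_op: "x \<approx> y \<Longrightarrow> op T p x \<approx> op T p y"
  using op_S[of "x - y" p] by (simp add: eqm_def lin_diff[OF lin_op_right])

lemma op_env_rels: "x \<in> C \<Longrightarrow> r \<in> env_rels UNIV \<Longrightarrow> op T r x \<in> S"
  using T_plus[of x] T_scale[of x] T_bracket[of x]
    pm.subspace_neg[OF sub_S, of "T (bracket v w) x - (T v (T w x) - T w (T v x))" for v w]
  by (auto simp: env_rels_def lin_add[OF lin_op] lin_diff[OF lin_op] lin_smul[OF lin_op] op_mult op_gen eqm_def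
      simp del: smul_single)

end


section \<open>The induced module as a quotient of the free algebra\<close>

text \<open>The relations carry words on both sides, so they span the two-sided ideal defining
  \<open>U(Vir)\<close>. The second family is multiplied from the left only, because it describes
  the annihilator of one vector, the cyclic one.\<close>

definition J :: "complex poly \<Rightarrow> (vir \<Rightarrow> complex) \<Rightarrow> free_alg set" where
  "J f \<mu> = pm.span ({bv u * r * bv w | u r w. r \<in> env_rels UNIV} \<union>
     {bv u * (gen x - Poly_Mapping.single 0 (\<mu> x)) | u x. x \<in> vir_sub f})"

lemma subspace_J: "pm.subspace (J f \<mu>)"
  by (simp add: J_def)

lemma J_rel: "r \<in> env_rels UNIV \<Longrightarrow> q * r * p \<in> J f \<mu>"
proof (rule lin_mem_subspace[where f = "\<lambda>q. q * r * p", OF _ subspace_J])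
  show "lin (\<lambda>q. q * r * p)" by (simp add: mult.assoc lin_mult_right)
  fix b assume r: "r \<in> env_rels UNIV"
  show "bv b * r * p \<in> J f \<mu>"
    by (rule lin_mem_subspace[where f = "\<lambda>p. bv b * r * p", OF lin_mult_left subspace_J])
       (use r in \<open>auto simp: J_def intro!: pm.span_base\<close>)
qed

lemma J_char: "x \<in> vir_sub f \<Longrightarrow> q * (gen x - Poly_Mapping.single 0 (\<mu> x)) \<in> J f \<mu>"
  by (rule lin_mem_subspace[where f = "\<lambda>q. q * (gen x - Poly_Mapping.single 0 (\<mu> x))", OF lin_mult_right subspace_J])
     (auto simp: J_def intro!: pm.span_base)

lemma J_left: assumes "p \<in> J f \<mu>" shows "q * p \<in> J f \<mu>"
  by (rule lin_span_image[where f = "(*) q", OF lin_mult_left subspace_J assms[unfolded J_def]])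
     (auto simp flip: mult.assoc intro: J_rel J_char)

lemma vmod_J: "vmod UNIV (J f \<mu>) (\<lambda>v p. gen v * p)"
proof
  fix p :: free_alg and v w c
  have "gen (v + w) - (gen v + gen w) \<in> env_rels UNIV"
    "gen (smul c v) - smul c (gen v) \<in> env_rels UNIV"
    "gen v * gen w - gen w * gen v - gen (bracket v w) \<in> env_rels UNIV"
    unfolding env_rels_def by blast+
  note r = this[THEN J_rel[where q = 1 and p = p and f = f and \<mu> = \<mu>]]
  show "eqm (J f \<mu>) (gen (v + w) * p) (gen v * p + gen w * p)"
    "eqm (J f \<mu>) (gen (smul c v) * p) (smul c (gen v * p))"
    using r(1,2) by (simp_all add: eqm_def distrib_right left_diff_distrib del: smul_single)
  show "eqm (J f \<mu>) (gen (bracket v w) * p) (gen v * (gen w * p) - gen w * (gen v * p))"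
    using pm.subspace_neg[OF subspace_J r(3)] by (simp add: eqm_def left_diff_distrib mult.assoc)
qed (auto intro: subspace_J J_left lin_mult_left)

text \<open>The universal property of \<open>V\<^sup>f\<close>: a vector \<open>e\<close> on which
  \<open>Vir\<^sup>f\<close> acts by \<mu> gives a map from \<open>V\<^sup>f\<close> sending the
  class of \<open>p\<close> to that of \<open>op T p e\<close>.\<close>

lemma (in vmod) op_J:
  assumes e: "e \<in> C" "\<And>x. x \<in> vir_sub f \<Longrightarrow> T x e \<approx> smul (\<mu> x) e" and "p \<in> J f \<mu>"
  shows "op T p e \<in> S"
proof (rule lin_span_image[OF lin_op sub_S assms(3)[unfolded J_def]])
  fix a assume "a \<in> {bv u * r * bv w | u r w. r \<in> env_rels UNIV} \<union>
     {bv u * (gen x - Poly_Mapping.single 0 (\<mu> x)) | u x. x \<in> vir_sub f}"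
  then show "op T a e \<in> S"
  proof (elim UnE CollectE exE conjE)
    fix u r w assume "a = bv u * r * bv w" "r \<in> env_rels UNIV"
    then show ?thesis by (simp add: op_mult op_S op_env_rels op_C e)
  next
    fix u x assume a: "a = bv u * (gen x - Poly_Mapping.single 0 (\<mu> x))" "x \<in> vir_sub f"
    have "op T (Poly_Mapping.single 0 (\<mu> x)) e = smul (\<mu> x) e"
      using lin_smul[OF lin_op, of "\<mu> x" 1 e] by (simp add: smul_eq_mult[of "\<mu> x" 1])
    then show ?thesis using e(2)[OF a(2)]
      by (simp add: a op_mult op_S lin_diff[OF lin_op] op_gen eqm_def)
  qed
qed


section \<open>Presentations\<close>

text \<open>Here \<open>\<pi>\<close> identifies \<open>M\<close> with \<open>C / S\<close>.
  Computing with representatives and \<open>eqm S\<close> keeps coset arithmetic out of the later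
  arguments.\<close>

definition presents :: "'v vir_mod \<Rightarrow> ('b \<Rightarrow>\<^sub>0 complex) set \<Rightarrow> ('b \<Rightarrow>\<^sub>0 complex) set \<Rightarrow>
    (vir \<Rightarrow> ('b \<Rightarrow>\<^sub>0 complex) \<Rightarrow> ('b \<Rightarrow>\<^sub>0 complex)) \<Rightarrow> (('b \<Rightarrow>\<^sub>0 complex) \<Rightarrow> 'v) \<Rightarrow> bool" where
  "presents M C S T \<pi> \<longleftrightarrow> \<pi> ` C = carrier M \<and> \<zero>\<^bsub>M\<^esub> = \<pi> 0 \<and>
     (\<forall>p\<in>C. \<forall>q\<in>C. \<pi> p = \<pi> q \<longleftrightarrow> eqm S p q) \<and>
     (\<forall>p\<in>C. \<forall>q\<in>C. \<pi> (p + q) = \<pi> p \<oplus>\<^bsub>M\<^esub> \<pi> q) \<and>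
     (\<forall>c. \<forall>p\<in>C. \<pi> (smul c p) = c \<odot>\<^bsub>M\<^esub> \<pi> p) \<and>
     (\<forall>v. \<forall>p\<in>C. \<pi> (T v p) = act M v (\<pi> p))"

context vmod
begin

lemma C_0: "0 \<in> C" and C_add: "p \<in> C \<Longrightarrow> q \<in> C \<Longrightarrow> p + q \<in> C"
  and C_smul: "p \<in> C \<Longrightarrow> smul c p \<in> C" and C_neg: "p \<in> C \<Longrightarrow> - p \<in> C"
  and C_diff: "p \<in> C \<Longrightarrow> q \<in> C \<Longrightarrow> p - q \<in> C"
  using sub_C by (auto intro: pm.subspace_0 pm.subspace_add pm.subspace_scale pm.subspace_neg pm.subspace_diff)

context
  fixes M :: "'v vir_mod" and \<pi>
  assumes pres: "presents M C S T \<pi>"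
begin

lemma carrier_pres: "carrier M = \<pi> ` C"
  and zero_pres: "\<zero>\<^bsub>M\<^esub> = \<pi> 0"
  and pres_eq: "p \<in> C \<Longrightarrow> q \<in> C \<Longrightarrow> \<pi> p = \<pi> q \<longleftrightarrow> p \<approx> q"
  and pres_add: "p \<in> C \<Longrightarrow> q \<in> C \<Longrightarrow> \<pi> p \<oplus>\<^bsub>M\<^esub> \<pi> q = \<pi> (p + q)"
  and pres_smul: "p \<in> C \<Longrightarrow> c \<odot>\<^bsub>M\<^esub> \<pi> p = \<pi> (smul c p)"
  and pres_act: "p \<in> C \<Longrightarrow> act M v (\<pi> p) = \<pi> (T v p)"
  using pres by (auto simp: presents_def)

lemma cring_complex: "cring complex_ring"
proof (rule cringI)
  show "abelian_group complex_ring"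
    by (rule abelian_groupI) (auto simp: complex_ring_def intro: exI[of _ "- x" for x])
  show "Group.comm_monoid complex_ring"
    by (rule Group.comm_monoidI) (auto simp: complex_ring_def)
qed (auto simp: complex_ring_def algebra_simps)

lemma abelian_group_pres: "abelian_group M"
proof (rule abelian_groupI)
  fix x assume "x \<in> carrier M"
  then obtain p where "x = \<pi> p" "p \<in> C" by (auto simp: carrier_pres)
  then show "\<exists>y\<in>carrier M. y \<oplus>\<^bsub>M\<^esub> x = \<zero>\<^bsub>M\<^esub>"
    by (intro bexI[of _ "\<pi> (- p)"]) (auto simp: carrier_pres zero_pres pres_add C_neg)
qed (auto simp: carrier_pres zero_pres pres_add C_add C_0 algebra_simps)

lemma module_pres: "module complex_ring M"
  by (rule moduleI[OF cring_complex abelian_group_pres])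
     (auto simp: carrier_pres pres_add pres_smul C_smul complex_ring_def C_add algebra_simps)

lemma a_inv_pres: assumes "q \<in> C" shows "\<ominus>\<^bsub>M\<^esub> \<pi> q = \<pi> (- q)"
proof -
  interpret abelian_group M by (rule abelian_group_pres)
  show ?thesis
    by (rule minus_equality) (auto simp: pres_add zero_pres carrier_pres assms C_neg)
qed

lemma a_minus_pres: "p \<in> C \<Longrightarrow> q \<in> C \<Longrightarrow> \<pi> p \<ominus>\<^bsub>M\<^esub> \<pi> q = \<pi> (p - q)"
  by (simp add: a_minus_def pres_add a_inv_pres C_neg)

lemma vir_module_pres: "vir_module M"
proof (intro vir_module.intro module_pres vir_module_axioms.intro)
  fix u w x y c assume "u \<in> carrier M" "w \<in> carrier M"
  then obtain p q where pq: "u = \<pi> p" "w = \<pi> q" "p \<in> C" "q \<in> C" by (auto simp: carrier_pres)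
  show "act M x u \<in> carrier M" using pq by (simp add: carrier_pres pres_act T_C)
  show "act M x (u \<oplus>\<^bsub>M\<^esub> w) = act M x u \<oplus>\<^bsub>M\<^esub> act M x w"
    using pq by (simp add: pres_act pres_add T_C C_add lin_add[OF T_lin])
  show "act M x (c \<odot>\<^bsub>M\<^esub> u) = c \<odot>\<^bsub>M\<^esub> act M x u"
    using pq by (simp add: pres_act pres_smul T_C C_smul lin_smul[OF T_lin])
  show "act M (x + y) u = act M x u \<oplus>\<^bsub>M\<^esub> act M y u"
    using pq by (simp add: pres_act pres_add T_C C_add pres_eq T_plus)
  show "act M (smul c x) u = c \<odot>\<^bsub>M\<^esub> act M x u"
    using pq by (simp add: pres_act pres_smul T_C C_smul pres_eq T_scale)
  show "act M (bracket x y) u = act M x (act M y u) \<ominus>\<^bsub>M\<^esub> act M y (act M x u)"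
    using pq by (simp add: pres_act a_minus_pres T_C C_diff pres_eq T_bracket)
qed

lemma submodule_pres:
  "vir_submodule W M \<longleftrightarrow> (\<exists>W'. W = \<pi> ` W' \<and> pm.subspace W' \<and> S \<subseteq> W' \<and> W' \<subseteq> C \<and> (\<forall>v. \<forall>p\<in>W'. T v p \<in> W'))"
    (is "?L \<longleftrightarrow> ?R")
proof
  interpret module complex_ring M by (rule module_pres)
  assume L: ?L
  then have sub: "submodule W complex_ring M" and act: "\<And>x w. w \<in> W \<Longrightarrow> act M x w \<in> W"
    by (auto simp: vir_submodule_def)
  note W = submoduleE[OF sub]
  have WC: "W \<subseteq> carrier M" using W(1) .
  let ?W = "{p \<in> C. \<pi> p \<in> W}"
  obtain w0 where w0: "w0 \<in> W" using W(2) by auto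
  have z: "\<pi> 0 \<in> W"
  proof -
    obtain p where p: "w0 = \<pi> p" "p \<in> C" using w0 WC by (auto simp: carrier_pres)
    have "0 \<odot>\<^bsub>M\<^esub> w0 \<in> W" using W(4)[of 0 w0] w0 by (simp add: complex_ring_def)
    then show ?thesis using p by (simp add: pres_smul)
  qed
  have 1: "W = \<pi> ` ?W" using WC by (auto simp: carrier_pres)
  have 2: "pm.subspace ?W"
    unfolding pm.subspace_def
    using z W(4,5) by (auto simp: C_0 C_add C_smul complex_ring_def simp flip: pres_add pres_smul)
  have 3: "S \<subseteq> ?W"
  proof
    fix s assume "s \<in> S"
    then have "\<pi> s = \<pi> 0" using S_C C_0 by (auto simp: pres_eq eqS_0)
    then show "s \<in> ?W" using z \<open>s \<in> S\<close> S_C by auto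
  qed
  have "\<forall>v. \<forall>p\<in>?W. T v p \<in> ?W" using act by (auto simp: T_C simp flip: pres_act)
  with 1 2 3 show ?R by (intro exI[of _ ?W]) auto
next
  interpret module complex_ring M by (rule module_pres)
  assume ?R
  then obtain W' where W: "W = \<pi> ` W'" "pm.subspace W'" "S \<subseteq> W'" "W' \<subseteq> C" "\<forall>v. \<forall>p\<in>W'. T v p \<in> W'" by blast
  have "submodule W complex_ring M"
  proof (rule submoduleI)
    show "\<zero>\<^bsub>M\<^esub> \<in> W" using W by (auto simp: zero_pres pm.subspace_0)
    fix a assume "a \<in> W"
    then obtain p where p: "a = \<pi> p" "p \<in> W'" using W by auto
    moreover have "\<pi> (- p) \<in> W" using p W pm.subspace_neg[of W' p] by auto
    ultimately show "\<ominus>\<^bsub>M\<^esub> a \<in> W" using W by (auto simp: a_inv_pres)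
  qed (use W in \<open>auto simp: carrier_pres pres_add pres_smul pm.subspace_add pm.subspace_scale subset_iff\<close>)
  then show ?L using W by (auto simp: vir_submodule_def pres_act subset_iff)
qed

lemma simple_pres:
  "vir_simple M \<longleftrightarrow> S \<noteq> C \<and>
     (\<forall>W. pm.subspace W \<and> S \<subseteq> W \<and> W \<subseteq> C \<and> (\<forall>v. \<forall>p\<in>W. T v p \<in> W) \<longrightarrow> W = S \<or> W = C)"
    (is "_ \<longleftrightarrow> _ \<and> ?R")
proof -
  have im: "\<pi> ` W = \<pi> ` W' \<longleftrightarrow> W = W'"
    if "pm.subspace W" "S \<subseteq> W" "W \<subseteq> C" "pm.subspace W'" "S \<subseteq> W'" "W' \<subseteq> C" for W W'
  proof
    assume eq: "\<pi> ` W = \<pi> ` W'"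
    have *: "W1 \<subseteq> W2" if "\<pi> ` W1 = \<pi> ` W2" "pm.subspace W2" "S \<subseteq> W2" "W2 \<subseteq> C" "W1 \<subseteq> C" for W1 W2
    proof
      fix p assume "p \<in> W1"
      then obtain q where "q \<in> W2" "\<pi> p = \<pi> q" using \<open>\<pi> ` W1 = \<pi> ` W2\<close> by blast
      moreover from this have "p \<approx> q" using that \<open>p \<in> W1\<close> by (subst pres_eq[symmetric]) auto
      ultimately show "p \<in> W2" using eqS_mem[of p q W2] that by auto
    qed
    show "W = W'" using *[OF eq] *[OF eq[symmetric]] that by auto
  qed simp
  have S0: "\<pi> ` S = {\<zero>\<^bsub>M\<^esub>}"
  proof -
    have "\<pi> s = \<pi> 0" if "s \<in> S" for s using that S_C C_0 by (auto simp: pres_eq eqS_0)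
    then have "\<pi> ` S \<subseteq> {\<pi> 0}" by blast
    moreover have "\<pi> 0 \<in> \<pi> ` S" using pm.subspace_0[OF sub_S] by (rule imageI)
    ultimately show ?thesis unfolding zero_pres by (intro subset_antisym) auto
  qed
  have "carrier M = {\<zero>\<^bsub>M\<^esub>} \<longleftrightarrow> S = C"
    using im[OF sub_C S_C order_refl sub_S order_refl S_C] by (auto simp: S0 carrier_pres)
  moreover have "(\<forall>W. vir_submodule W M \<longrightarrow> W = {\<zero>\<^bsub>M\<^esub>} \<or> W = carrier M) \<longleftrightarrow> ?R"
  proof (intro iffI allI impI)
    fix W assume *: "\<forall>W. vir_submodule W M \<longrightarrow> W = {\<zero>\<^bsub>M\<^esub>} \<or> W = carrier M"
      and "pm.subspace W \<and> S \<subseteq> W \<and> W \<subseteq> C \<and> (\<forall>v. \<forall>p\<in>W. T v p \<in> W)"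
    then have W: "pm.subspace W" "S \<subseteq> W" "W \<subseteq> C" "\<forall>v. \<forall>p\<in>W. T v p \<in> W" by auto
    then have "vir_submodule (\<pi> ` W) M" unfolding submodule_pres by blast
    with * have "\<pi> ` W = \<pi> ` S \<or> \<pi> ` W = \<pi> ` C" by (simp add: S0 carrier_pres)
    then show "W = S \<or> W = C"
      using im[OF W(1-3) sub_C S_C order_refl] im[OF W(1-3) sub_S order_refl S_C] by (simp only:)
  next
    fix W assume *: ?R and "vir_submodule W M"
    then obtain W' where "W = \<pi> ` W'" "W' = S \<or> W' = C" unfolding submodule_pres by blast
    then show "W = {\<zero>\<^bsub>M\<^esub>} \<or> W = carrier M" by (metis S0 carrier_pres)
  qed
  ultimately show ?thesis using vir_module_pres by (auto simp: vir_simple_def)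
qed

text \<open>Linearity of \<open>h\<close> is required only modulo \<open>S\<close>, because the map
  used for the induced module sends \<open>p\<close> to the single symbol
  \<open>bv (cl p, 1)\<close> and is not linear before relations are divided out.\<close>

lemma presents_comp:
  fixes C' S' :: "('d \<Rightarrow>\<^sub>0 complex) set"
  assumes "0 \<in> C'" and h: "\<And>p. p \<in> C' \<Longrightarrow> h p \<in> C"
    and inj: "\<And>p. p \<in> C' \<Longrightarrow> h p \<in> S \<longleftrightarrow> p \<in> S'" and surj: "\<And>q. q \<in> C \<Longrightarrow> \<exists>p\<in>C'. q \<approx> h p"
    and sub: "pm.subspace C'" and T': "\<And>v p. p \<in> C' \<Longrightarrow> T' v p \<in> C'"
    and add: "\<And>p q. p \<in> C' \<Longrightarrow> q \<in> C' \<Longrightarrow> h (p + q) \<approx> h p + h q"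
    and smul: "\<And>c p. p \<in> C' \<Longrightarrow> h (smul c p) \<approx> smul c (h p)"
    and equiv: "\<And>v p. p \<in> C' \<Longrightarrow> h (T' v p) \<approx> T v (h p)"
  shows "presents M C' S' T' (\<lambda>p. \<pi> (h p))"
proof -
  have mem: "p + q \<in> C'" "smul c p \<in> C'" "p - q \<in> C'" if "p \<in> C'" "q \<in> C'" for p q c
    using that sub by (auto intro: pm.subspace_add pm.subspace_scale pm.subspace_diff)
  have h0: "h 0 \<approx> 0" using smul[OF assms(1), of 0] by simp
  have hd: "h (p - q) \<approx> h p - h q" if "p \<in> C'" "q \<in> C'" for p q
  proof -
    have "h (p - q) \<approx> h p + h (smul (-1) q)" using add[of p "smul (-1) q"] mem(2)[of q q "-1"] that by simp
    also have "\<dots> \<approx> h p + smul (-1) (h q)" by (intro eqS_add eqS_refl smul that)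
    finally show ?thesis by simp
  qed
  have "\<pi> (h p) = \<pi> (h q) \<longleftrightarrow> eqm S' p q" if "p \<in> C'" "q \<in> C'" for p q
  proof -
    have "\<pi> (h p) = \<pi> (h q) \<longleftrightarrow> h p - h q \<in> S" using that by (simp add: pres_eq h eqm_def)
    also have "\<dots> \<longleftrightarrow> h (p - q) \<in> S" using eqS_S[OF hd[OF that]] by simp
    also have "\<dots> \<longleftrightarrow> eqm S' p q" using inj mem that by (simp add: eqm_def)
    finally show ?thesis .
  qed
  moreover have "(\<lambda>p. \<pi> (h p)) ` C' = carrier M"
  proof -
    have "\<exists>p\<in>C'. \<pi> q = \<pi> (h p)" if "q \<in> C" for q using surj[OF that] that by (auto simp: pres_eq h)
    then show ?thesis by (auto simp: carrier_pres h)
  qed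
  ultimately show ?thesis
    unfolding presents_def
    using assms(1) h0 add smul equiv
    by (auto simp: zero_pres pres_eq pres_add pres_smul pres_act h mem T' C_0 C_add C_smul T_C dest: eqS_sym)
qed

end

text \<open>Equality under \<open>\<pi>\<close> and equality under \<open>\<rho>\<close> are the
  same congruence, so \<open>\<rho>\<close> composed with any choice of preimages under
  \<open>\<pi>\<close> is well defined and bijective.\<close>

lemma presents_iso:
  assumes "presents M C S T \<pi>" "presents N C S T \<rho>"
  shows "M \<cong>\<^sub>V N"
proof -
  define h where "h u = \<rho> (inv_into C \<pi> u)" for u
  have h: "h (\<pi> p) = \<rho> p" if "p \<in> C" for p
  proof -
    have "inv_into C \<pi> (\<pi> p) \<in> C" "\<pi> (inv_into C \<pi> (\<pi> p)) = \<pi> p"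
      using that by (auto intro: inv_into_into f_inv_into_f)
    then show ?thesis using that by (simp add: h_def pres_eq[OF assms(1)] pres_eq[OF assms(2)])
  qed
  have "bij_betw h (carrier M) (carrier N)"
    unfolding bij_betw_def inj_on_def carrier_pres[OF assms(1)] carrier_pres[OF assms(2)]
    by (auto simp: h pres_eq[OF assms(1)] pres_eq[OF assms(2)] image_image)
  then show ?thesis unfolding vir_iso_def
    by (intro conjI vir_module_pres[OF assms(1)] vir_module_pres[OF assms(2)] exI[of _ h])
       (auto simp: carrier_pres[OF assms(1)] pres_add[OF assms(1)] pres_smul[OF assms(1)] pres_act[OF assms(1)]
          pres_add[OF assms(2)] pres_smul[OF assms(2)] pres_act[OF assms(2)] h C_add C_smul T_C)
qed

end

lemma quot_presents:
  fixes B :: "'b set" and \<phi> :: "vir \<Rightarrow> 'b \<Rightarrow> 'b \<Rightarrow>\<^sub>0 complex"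
  assumes S: "pm.subspace S" "S \<subseteq> {p. Poly_Mapping.keys p \<subseteq> B}"
    and T: "\<And>v p. p \<in> S \<Longrightarrow> lin_ext (\<phi> v) p \<in> S"
  shows "presents (quot_mod (free_mod B \<phi>) S) {p. Poly_Mapping.keys p \<subseteq> B} S (\<lambda>v. lin_ext (\<phi> v))
    (\<lambda>p. (\<lambda>s. s + p) ` S)" (is "presents ?M ?C S ?T ?\<pi>")
proof -
  have coset: "?\<pi> p = ?\<pi> q \<longleftrightarrow> eqm S p q" for p q
  proof
    assume "?\<pi> p = ?\<pi> q"
    moreover have "p \<in> ?\<pi> p" using pm.subspace_0[OF S(1)] by (auto intro!: image_eqI[of _ _ 0])
    ultimately show "eqm S p q" by (auto simp: eqm_def)
  next
    assume *: "eqm S p q"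
    have "?\<pi> a \<subseteq> ?\<pi> b" if "a - b \<in> S" for a b
    proof
      fix x assume "x \<in> ?\<pi> a"
      then obtain s where "x = (s + (a - b)) + b" "s \<in> S" by auto
      then show "x \<in> ?\<pi> b" using pm.subspace_add[OF S(1) _ that] by blast
    qed
    from this[of p q] this[of q p] * pm.subspace_neg[OF S(1), of "p - q"]
    show "?\<pi> p = ?\<pi> q" by (auto simp: eqm_def)
  qed
  have im: "(\<Union>h\<in>S. \<Union>k\<in>g ` ?\<pi> p. {h + k}) = ?\<pi> (g p)"
    if g: "lin g" "\<And>s. s \<in> S \<Longrightarrow> g s \<in> S" for g p
  proof (intro Set.set_eqI iffI)
    fix x assume "x \<in> (\<Union>h\<in>S. \<Union>k\<in>g ` ?\<pi> p. {h + k})"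
    then obtain h s where "h \<in> S" "s \<in> S" "x = (h + g s) + g p"
      by (auto simp: lin_add[OF g(1)] add.assoc)
    then show "x \<in> ?\<pi> (g p)" using g(2) pm.subspace_add[OF S(1)] by blast
  next
    fix x assume "x \<in> ?\<pi> (g p)"
    then obtain s where "s \<in> S" "x = s + g (0 + p)" by auto
    then show "x \<in> (\<Union>h\<in>S. \<Union>k\<in>g ` ?\<pi> p. {h + k})" using pm.subspace_0[OF S(1)] by blast
  qed
  have "a_rcosets\<^bsub>free_mod B \<phi>\<^esub> S = ?\<pi> ` ?C"
    by (auto simp: A_RCOSETS_def' a_r_coset_def' free_mod_def)
  moreover have "?\<pi> (p + q) = ?\<pi> p <+>\<^bsub>free_mod B \<phi>\<^esub> ?\<pi> q" for p q
  proof (intro Set.set_eqI iffI)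
    fix x assume "x \<in> ?\<pi> (p + q)"
    then obtain s where "s \<in> S" "x = (s + p) + (0 + q)" by (auto simp: add.assoc)
    moreover have "\<exists>a\<in>S. \<exists>b\<in>S. s = a + b"
      using pm.subspace_0[OF S(1)] \<open>s \<in> S\<close> by (intro bexI[of _ 0] bexI[of _ s]) simp_all
    ultimately show "x \<in> ?\<pi> p <+>\<^bsub>free_mod B \<phi>\<^esub> ?\<pi> q"
      by (auto simp: set_add_def' free_mod_def)
  next
    fix x assume "x \<in> ?\<pi> p <+>\<^bsub>free_mod B \<phi>\<^esub> ?\<pi> q"
    then obtain s s' where "s \<in> S" "s' \<in> S" "x = (s + p) + (s' + q)"
      by (auto simp: set_add_def' free_mod_def)
    then have "x = (s + s') + (p + q)" "s + s' \<in> S" using pm.subspace_add[OF S(1)] by (auto simp: algebra_simps)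
    then show "x \<in> ?\<pi> (p + q)" by blast
  qed
  ultimately show ?thesis
    unfolding presents_def quot_mod_def
    using coset im[of "smul _"] im[of "lin_ext _"] pm.subspace_scale[OF S(1)] T
    by (auto simp: set_add_def' free_mod_def lin_lin_ext lin_scale[OF lin_id])
qed

text \<open>The common normal form of the induced module and of the tensor product. Isomorphism and
  simplicity are both read off from it.\<close>

definition is_quot :: "complex poly \<Rightarrow> (vir \<Rightarrow> complex) \<Rightarrow> 'v vir_mod \<Rightarrow> bool" where
  "is_quot f \<mu> M \<longleftrightarrow> (\<exists>\<pi>. presents M UNIV (J f \<mu>) (\<lambda>v p. gen v * p) \<pi>)"

lemma is_quot_iso: "is_quot f \<mu> M \<Longrightarrow> is_quot f \<mu> N \<Longrightarrow> M \<cong>\<^sub>V N"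
  unfolding is_quot_def using vmod.presents_iso[OF vmod_J] by blast


section \<open>The induced module\<close>

lemma carrier_free_algebra: "p \<in> carrier (free_algebra L) \<longleftrightarrow> (\<forall>w\<in>Poly_Mapping.keys p. set (letters w) \<subseteq> L)"
  by (simp add: free_algebra_def)

lemma free_algebra_simps [simp]:
  "mult (free_algebra L) = (*)" "one (free_algebra L) = 1" "zero (free_algebra L) = 0" "add (free_algebra L) = (+)"
  "carrier (free_algebra UNIV) = UNIV"
  by (auto simp: free_algebra_def)

lemma free_algebra_add: "p \<in> carrier (free_algebra L) \<Longrightarrow> q \<in> carrier (free_algebra L) \<Longrightarrow> p + q \<in> carrier (free_algebra L)"
  by (auto simp: carrier_free_algebra dest!: subsetD[OF Poly_Mapping.keys_add])

lemma free_algebra_smul: "p \<in> carrier (free_algebra L) \<Longrightarrow> smul c p \<in> carrier (free_algebra L)"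
  by (auto simp: carrier_free_algebra dest!: subsetD[OF keys_smul])

lemma free_algebra_neg: "p \<in> carrier (free_algebra L) \<Longrightarrow> - p \<in> carrier (free_algebra L)"
  by (simp add: carrier_free_algebra)

lemma free_algebra_diff: "p \<in> carrier (free_algebra L) \<Longrightarrow> q \<in> carrier (free_algebra L) \<Longrightarrow> p - q \<in> carrier (free_algebra L)"
  using free_algebra_add[OF _ free_algebra_neg, of p L q] by simp

lemma free_algebra_mult:
  assumes "p \<in> carrier (free_algebra L)" "q \<in> carrier (free_algebra L)"
  shows "p * q \<in> carrier (free_algebra L)"
  unfolding carrier_free_algebra
proof
  fix w assume "w \<in> Poly_Mapping.keys (p * q)"
  then obtain u v where "u \<in> Poly_Mapping.keys p" "v \<in> Poly_Mapping.keys q" "w = u + v"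
    using keys_mult[of p q] by blast
  then show "set (letters w) \<subseteq> L" using assms by (auto simp: carrier_free_algebra plus_word_def)
qed

lemma free_algebra_0_1: "0 \<in> carrier (free_algebra L)" "1 \<in> carrier (free_algebra L)"
  by (auto simp: carrier_free_algebra zero_word_def)

lemma free_algebra_gen: "x \<in> L \<Longrightarrow> gen x \<in> carrier (free_algebra L)"
  by (simp add: carrier_free_algebra)

lemmas free_algebra_closed = free_algebra_add free_algebra_smul free_algebra_diff free_algebra_mult
  free_algebra_gen free_algebra_0_1

lemma ring_free_algebra: "ring (free_algebra L)"
proof (rule ringI)
  show "abelian_group (free_algebra L)"
  proof (rule abelian_groupI)
    fix x assume "x \<in> carrier (free_algebra L)"
    then show "\<exists>y\<in>carrier (free_algebra L). y \<oplus>\<^bsub>free_algebra L\<^esub> x = \<zero>\<^bsub>free_algebra L\<^esub>"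
      by (intro bexI[of _ "- x"]) (simp_all add: free_algebra_neg)
  qed (simp_all add: free_algebra_closed algebra_simps)
  show "Group.monoid (free_algebra L)"
    by (rule Group.monoidI) (simp_all add: free_algebra_closed mult.assoc)
qed (simp_all add: algebra_simps)

lemma ideal_free_algebraI:
  assumes "I \<subseteq> carrier (free_algebra L)" "pm.subspace I"
    "\<And>a x. a \<in> I \<Longrightarrow> x \<in> carrier (free_algebra L) \<Longrightarrow> x * a \<in> I"
    "\<And>a x. a \<in> I \<Longrightarrow> x \<in> carrier (free_algebra L) \<Longrightarrow> a * x \<in> I"
  shows "ideal I (free_algebra L)"
proof (rule idealI[OF ring_free_algebra])
  interpret ring "free_algebra L" by (rule ring_free_algebra)
  have inv: "\<ominus>\<^bsub>free_algebra L\<^esub> a = - a" if "a \<in> carrier (free_algebra L)" for a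
    by (rule minus_equality) (use that in \<open>auto simp: carrier_free_algebra\<close>)
  show "subgroup I (add_monoid (free_algebra L))"
  proof (rule subgroup.intro)
    fix x assume "x \<in> I"
    then show "inv\<^bsub>add_monoid (free_algebra L)\<^esub> x \<in> I"
      unfolding a_inv_def[symmetric] using inv[of x] assms(1) pm.subspace_neg[OF assms(2), of x]
      by (simp add: subset_iff)
  qed (use assms(1,2) in \<open>auto simp: pm.subspace_add pm.subspace_0\<close>)
qed (use assms in auto)

lemma ideal_env_ideal: "ideal (env_ideal UNIV) (free_algebra UNIV)"
  and env_rels_env_ideal: "env_rels UNIV \<subseteq> env_ideal UNIV"
  unfolding env_ideal_def
  by (rule ring.genideal_ideal[OF ring_free_algebra] ring.genideal_self[OF ring_free_algebra]; simp)+

lemma env_ideal_mult: "p \<in> env_ideal UNIV \<Longrightarrow> q * p * r \<in> env_ideal UNIV"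
  using ideal.I_l_closed[OF ideal_env_ideal] ideal.I_r_closed[OF ideal_env_ideal] by simp

lemma subspace_env_ideal: "pm.subspace (env_ideal UNIV)"
proof -
  note sub = ideal.axioms(1)[OF ideal_env_ideal]
  have "smul c p \<in> env_ideal UNIV" if "p \<in> env_ideal UNIV" for c p
    using env_ideal_mult[OF that, of "Poly_Mapping.single 0 c" 1] by (simp add: smul_eq_mult)
  then show ?thesis
    using additive_subgroup.zero_closed[OF sub] additive_subgroup.a_closed[OF sub]
    by (auto simp: pm.subspace_def)
qed

text \<open>The elements \<open>p\<close> with \<open>p * q\<close> in \<open>J f \<mu>\<close> for
  all \<open>q\<close> form a two-sided ideal, and it contains the relations.\<close>

lemma env_ideal_subset_J: "env_ideal UNIV \<subseteq> J f \<mu>"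
proof -
  have "ideal {p. \<forall>q. p * q \<in> J f \<mu>} (free_algebra UNIV)"
    by (rule ideal_free_algebraI)
       (auto simp: pm.subspace_def distrib_right pm.subspace_0[OF subspace_J] pm.subspace_add[OF subspace_J]
          pm.subspace_scale[OF subspace_J] mult.assoc J_left simp flip: mult_smul_right)
  then have "env_ideal UNIV \<subseteq> {p. \<forall>q. p * q \<in> J f \<mu>}"
    unfolding env_ideal_def
    by (rule ring.genideal_minimal[OF ring_free_algebra])
       (use J_rel[where q = 1] in auto)
  then have "p * 1 \<in> J f \<mu>" if "p \<in> env_ideal UNIV" for p
    using that by blast
  then show ?thesis by auto
qed

section \<open>Extension of a character to the enveloping algebra\<close>

lemma linc_free_eval: "linc (free_eval \<mu>)"
  using linc_cext unfolding free_eval_def[abs_def] cext_def[abs_def] .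

lemma free_eval_word: "free_eval \<mu> (bv w) = prod_list (map \<mu> (letters w))"
  by (simp add: free_eval_def)

lemma free_eval_mult: "free_eval \<mu> (p * q) = free_eval \<mu> p * free_eval \<mu> q"
proof -
  have l: "linc (\<lambda>q. c * free_eval \<mu> q)" "linc (\<lambda>q. free_eval \<mu> q * c)" for c
    using linc_free_eval by (auto simp: linc_def algebra_simps)
  have "free_eval \<mu> (bv u * q) = free_eval \<mu> (bv u) * free_eval \<mu> q" for u q
    by (rule linc_eqI[where f = "\<lambda>q. free_eval \<mu> (bv u * q)", OF linc_comp[OF linc_free_eval lin_mult_left] l(1)])
       (simp add: mult_single free_eval_word plus_word_def)
  then show ?thesis
    by (rule linc_eqI[where f = "\<lambda>p. free_eval \<mu> (p * q)", OF linc_comp[OF linc_free_eval lin_mult_right] l(2)])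
qed

lemma bracket_vir_sub: "v \<in> vir_sub f \<Longrightarrow> w \<in> vir_sub f \<Longrightarrow> bracket v w \<in> vir_sub f"
  by (auto simp: vir_sub_iff lg_bracket wbr_mult_self power2_eq_square elim!: dvdE)

lemma subspace_vir_sub: "pm.subspace (vir_sub f)"
  by (simp add: vir_sub_def)

text \<open>Containment in the first set makes \<open>env_incl\<close> well defined on cosets;
  containment in the second makes \<open>env_char\<close> well defined.\<close>

lemma env_ideal_vir_sub:
  assumes "lie_char (vir_sub f) \<mu>"
  shows "env_ideal (vir_sub f) \<subseteq> env_ideal UNIV \<inter> {p. free_eval \<mu> p = 0}"
proof -
  let ?I = "{p \<in> carrier (free_algebra (vir_sub f)). p \<in> env_ideal UNIV \<and> free_eval \<mu> p = 0}"
  interpret ring "free_algebra (vir_sub f)" by (rule ring_free_algebra)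
  note l = linc_add[OF linc_free_eval] linc_diff[OF linc_free_eval] linc_smul[OF linc_free_eval] linc_0[OF linc_free_eval]
  have m: "p * q \<in> env_ideal UNIV" "q * p \<in> env_ideal UNIV" if "p \<in> env_ideal UNIV" for p q
    using env_ideal_mult[OF that, of 1 q] env_ideal_mult[OF that, of q 1] by auto
  have "ideal ?I (free_algebra (vir_sub f))"
  proof (rule ideal_free_algebraI)
    show "pm.subspace ?I"
      using subspace_env_ideal unfolding pm.subspace_def by (simp add: l free_algebra_closed)
  qed (simp_all add: m free_eval_mult free_algebra_closed)
  moreover have "env_rels (vir_sub f) \<subseteq> ?I"
  proof
    fix r assume r: "r \<in> env_rels (vir_sub f)"
    moreover have "env_rels (vir_sub f) \<subseteq> env_rels UNIV"
      unfolding env_rels_def by (intro Un_mono subsetI; elim CollectE exE conjE; blast)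
    ultimately have U: "r \<in> env_ideal UNIV" using env_rels_env_ideal by (meson subsetD)
    note a = pm.subspace_add[OF subspace_vir_sub] pm.subspace_scale[OF subspace_vir_sub] bracket_vir_sub
    have "r \<in> carrier (free_algebra (vir_sub f))"
      using r unfolding env_rels_def
      by (elim UnE CollectE exE conjE) (simp_all add: free_algebra_closed a del: smul_single)
    moreover have "free_eval \<mu> r = 0"
      using r assms unfolding env_rels_def lie_char_def
      by (auto simp: l free_eval_mult free_eval_word simp del: smul_single)
    ultimately show "r \<in> ?I" using U by simp
  qed
  ultimately have "env_ideal (vir_sub f) \<subseteq> ?I"
    unfolding env_ideal_def[of "vir_sub f"] by (rule genideal_minimal)
  then show ?thesis by auto
qed

lemma zero_env_ideal: "0 \<in> env_ideal L"
  unfolding env_ideal_def genideal_def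
  using additive_subgroup.zero_closed[OF ideal.axioms(1)] by fastforce

section \<open>Arithmetic of classes in \<open>U(Vir)\<close>\<close>

abbreviation cl :: "free_alg \<Rightarrow> free_alg set" where
  "cl \<equiv> env_class UNIV"

lemma carrier_U_vir: "carrier U_vir = range cl"
  by (auto simp: env_def FactRing_def A_RCOSETS_def' env_class_def)

lemma cl_mult: "cl p \<otimes>\<^bsub>U_vir\<^esub> cl q = cl (p * q)"
  using ideal.rcoset_mult_add[OF ideal_env_ideal, of p q] by (simp add: env_def FactRing_def env_class_def)

lemma cl_add: "cl p \<oplus>\<^bsub>U_vir\<^esub> cl q = cl (p + q)"
proof -
  interpret ideal "env_ideal UNIV" "free_algebra UNIV" by (rule ideal_env_ideal)
  show ?thesis using a_rcos_sum[of p q] by (simp add: env_def FactRing_def env_class_def)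
qed

lemma cl_scale: "env_scale c (cl p) = cl (smul c p)"
  by (simp add: env_scale_def cl_mult smul_eq_mult)

lemma cl_eq_set: "env_class L p = (\<lambda>i. i + p) ` env_ideal L"
  by (auto simp: env_class_def a_r_coset_def')

lemma cl_eq_iff: "cl p = cl q \<longleftrightarrow> p - q \<in> env_ideal UNIV"
proof
  assume "cl p = cl q"
  moreover have "p \<in> cl p" unfolding cl_eq_set using zero_env_ideal by (auto intro!: image_eqI[of _ _ 0])
  ultimately show "p - q \<in> env_ideal UNIV" by (auto simp: cl_eq_set)
next
  assume pq: "p - q \<in> env_ideal UNIV"
  have "cl a \<subseteq> cl b" if "a - b \<in> env_ideal UNIV" for a b
  proof
    fix x assume "x \<in> cl a"
    then obtain i where "x = (i + (a - b)) + b" "i \<in> env_ideal UNIV" by (auto simp: cl_eq_set)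
    then show "x \<in> cl b" using pm.subspace_add[OF subspace_env_ideal _ that] unfolding cl_eq_set by blast
  qed
  from this[OF pq] this[of q p] pm.subspace_neg[OF subspace_env_ideal pq] show "cl p = cl q" by auto
qed

lemma env_incl_char:
  assumes "lie_char (vir_sub f) \<mu>" "a \<in> carrier (env (vir_sub f))"
  obtains p where "p \<in> carrier (free_algebra (vir_sub f))" "env_incl a = cl p" "env_char \<mu> a = free_eval \<mu> p"
proof -
  obtain p where p: "p \<in> carrier (free_algebra (vir_sub f))" "a = env_class (vir_sub f) p"
    using assms(2) by (auto simp: env_def FactRing_def A_RCOSETS_def' env_class_def)
  note I = env_ideal_vir_sub[OF assms(1)]
  have "env_incl a = cl p"
  proof (rule subset_antisym)
    show "env_incl a \<subseteq> cl p"
    proof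
      fix x assume "x \<in> env_incl a"
      then obtain i j where "i \<in> env_ideal UNIV" "j \<in> env_ideal (vir_sub f)" "x = i + (j + p)"
        by (auto simp: env_incl_def set_add_def' p(2) cl_eq_set)
      then have "x = (i + j) + p" "i + j \<in> env_ideal UNIV"
        using I pm.subspace_add[OF subspace_env_ideal] by (auto simp: add.assoc)
      then show "x \<in> cl p" unfolding cl_eq_set by blast
    qed
    show "cl p \<subseteq> env_incl a"
    proof
      fix x assume "x \<in> cl p"
      then obtain i where "i \<in> env_ideal UNIV" "x = i + (0 + p)" by (auto simp: cl_eq_set)
      moreover have "\<exists>x\<in>env_ideal UNIV. \<exists>y\<in>env_ideal (vir_sub f). i = x + y"
        using zero_env_ideal \<open>i \<in> env_ideal UNIV\<close> by (intro bexI[of _ i] bexI[of _ 0]) simp_all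
      ultimately show "x \<in> env_incl a" unfolding env_incl_def set_add_def' p(2) cl_eq_set by auto
    qed
  qed
  moreover have "free_eval \<mu> ` a = {free_eval \<mu> p}"
    using I zero_env_ideal[of "vir_sub f"]
    by (auto simp: p(2) cl_eq_set linc_add[OF linc_free_eval] image_iff)
  ultimately show ?thesis using that[OF p(1)] by (simp add: env_char_def)
qed

text \<open>Induction on the word: the tail is replaced by its scalar, which is a left multiple of
  an element of the left ideal, and then the first letter is replaced by its value.\<close>

lemma J_free_eval:
  assumes "p \<in> carrier (free_algebra (vir_sub f))"
  shows "p - Poly_Mapping.single 0 (free_eval \<mu> p) \<in> J f \<mu>"
proof -
  have l: "lin (\<lambda>p. p - Poly_Mapping.single 0 (free_eval \<mu> p))"
    using linc_free_eval[of \<mu>]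
    by (auto simp: lin_def linc_def single_add pm.scale_right_diff_distrib)
  have "bv (Word ls) - Poly_Mapping.single 0 (prod_list (map \<mu> ls)) \<in> J f \<mu>" if "set ls \<subseteq> vir_sub f" for ls
    using that
  proof (induction ls)
    case Nil
    then show ?case by (simp add: zero_word_def[symmetric] pm.subspace_0[OF subspace_J])
  next
    case (Cons x ls)
    let ?m = "prod_list (map \<mu> ls)"
    have "gen x * (bv (Word ls) - Poly_Mapping.single 0 ?m) +
        smul ?m (1 * (gen x - Poly_Mapping.single 0 (\<mu> x))) \<in> J f \<mu>"
      using Cons by (intro pm.subspace_add[OF subspace_J] J_left pm.subspace_scale[OF subspace_J] J_char) auto
    moreover have "gen x * (bv (Word ls) - Poly_Mapping.single 0 ?m) +
        smul ?m (1 * (gen x - Poly_Mapping.single 0 (\<mu> x))) =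
        bv (Word (x # ls)) - Poly_Mapping.single 0 (\<mu> x * ?m)"
      by (simp add: right_diff_distrib mult_single plus_word_def zero_word_def pm.scale_right_diff_distrib mult.commute)
    ultimately show ?case by simp
  qed
  note words = this
  show ?thesis
  proof (rule lin_mem_subspace[where f = "\<lambda>p. p - Poly_Mapping.single 0 (free_eval \<mu> p)", OF l subspace_J])
    fix b assume "b \<in> Poly_Mapping.keys p"
    then show "bv b - Poly_Mapping.single 0 (free_eval \<mu> (bv b)) \<in> J f \<mu>"
      using words[of "letters b"] assms by (simp add: free_eval_word carrier_free_algebra)
  qed
qed

text \<open>The isomorphism sends \<open>p\<close> to \<open>p \<otimes> 1\<close>. It is onto
  because scalars can be moved to the left factor. Its kernel is found with a map back on symbols,
  sending \<open>u \<otimes> c\<close> to \<open>c\<close> times a representative of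
  \<open>u\<close>.\<close>

lemma is_quot_induced:
  assumes mu: "lie_char (vir_sub f) \<mu>"
  shows "is_quot f \<mu> (induced f \<mu>)"
proof -
  define B :: "(free_alg set \<times> complex) set" where "B = carrier U_vir \<times> UNIV"
  define \<phi> where "\<phi> = (\<lambda>x (u, c). bv (cl (gen x) \<otimes>\<^bsub>U_vir\<^esub> u, c) :: (free_alg set \<times> complex) \<Rightarrow>\<^sub>0 complex)"
  define R where "R = induced_rels f \<mu>"
  let ?S = "pm.span R" and ?C = "{p :: _ \<Rightarrow>\<^sub>0 complex. Poly_Mapping.keys p \<subseteq> B}"
  have sS: "pm.subspace ?S" by simp
  have \<phi>: "\<phi> x (cl p, c) = bv (cl (gen x * p), c)" for x p c
    by (simp add: \<phi>_def cl_mult)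
  have B: "(u, c) \<in> B \<longleftrightarrow> u \<in> range cl" for u c by (simp add: B_def carrier_U_vir)
  have cU: "cl p \<in> carrier U_vir" for p by (simp add: carrier_U_vir)
  have r1: "bv (cl (p + q), c) - (bv (cl p, c) + bv (cl q, c)) \<in> R" for p q c
    unfolding R_def induced_rels_def cl_add[symmetric] using cU by blast
  have r2: "bv (cl p, c + c') - (bv (cl p, c) + bv (cl p, c')) \<in> R" for p c c'
    unfolding R_def induced_rels_def using cU by blast
  have r3: "bv (cl (smul d p), c) - smul d (bv (cl p, c)) \<in> R" for p c d
    unfolding R_def induced_rels_def cl_scale[symmetric] using cU by blast
  have r4: "bv (cl p, d * c) - smul d (bv (cl p, c)) \<in> R" for p c d
    unfolding R_def induced_rels_def using cU by blast
  have r5: "bv (cl (q * p), c) - bv (cl q, free_eval \<mu> p * c) \<in> R"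
    if "p \<in> carrier (free_algebra (vir_sub f))" for p q c
  proof -
    let ?a = "env_class (vir_sub f) p"
    have a: "?a \<in> carrier (env (vir_sub f))"
      using that by (auto simp: env_def FactRing_def A_RCOSETS_def' env_class_def)
    have "cl q \<otimes>\<^bsub>U_vir\<^esub> env_incl ?a = cl (q * p)" "env_char \<mu> ?a = free_eval \<mu> p"
    proof -
      note I = env_ideal_vir_sub[OF mu]
      obtain p' where p': "env_incl ?a = cl p'" "env_char \<mu> ?a = free_eval \<mu> p'"
        using env_incl_char[OF mu a] by blast
      have "p \<in> ?a" unfolding cl_eq_set using zero_env_ideal by (auto intro!: image_eqI[of _ _ 0])
      then have "\<exists>x\<in>env_ideal UNIV. \<exists>y\<in>?a. p = x + y"
        using zero_env_ideal by (intro bexI[of _ 0] bexI[of _ p]) simp_all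
      then have "p \<in> env_incl ?a" by (auto simp: env_incl_def set_add_def')
      then have *: "p - p' \<in> env_ideal UNIV" unfolding p'(1) by (auto simp: cl_eq_set)
      then have "cl p' = cl p" by (simp add: cl_eq_iff[of p p', symmetric])
      then show "cl q \<otimes>\<^bsub>U_vir\<^esub> env_incl ?a = cl (q * p)" by (simp add: p' cl_mult)
      have "free_eval \<mu> ` ?a = {free_eval \<mu> p}"
        using I zero_env_ideal[of "vir_sub f"]
        by (auto simp: cl_eq_set linc_add[OF linc_free_eval] image_iff)
      then show "env_char \<mu> ?a = free_eval \<mu> p" by (simp add: env_char_def)
    qed
    moreover have "bv (cl q \<otimes>\<^bsub>U_vir\<^esub> env_incl ?a, c) - bv (cl q, env_char \<mu> ?a * c) \<in> R"
      unfolding R_def induced_rels_def using a cU by blast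
    ultimately show ?thesis by simp
  qed
  have cases: "thesis" if "r \<in> R"
    "\<And>p q c. r = bv (cl (p + q), c) - (bv (cl p, c) + bv (cl q, c)) \<Longrightarrow> thesis"
    "\<And>p c c'. r = bv (cl p, c + c') - (bv (cl p, c) + bv (cl p, c')) \<Longrightarrow> thesis"
    "\<And>p c d. r = bv (cl (smul d p), c) - smul d (bv (cl p, c)) \<Longrightarrow> thesis"
    "\<And>p c d. r = bv (cl p, d * c) - smul d (bv (cl p, c)) \<Longrightarrow> thesis"
    "\<And>p q c. r = bv (cl (q * p), c) - bv (cl q, free_eval \<mu> p * c) \<Longrightarrow>
       p \<in> carrier (free_algebra (vir_sub f)) \<Longrightarrow> thesis" for r thesis
    using that(1) unfolding R_def induced_rels_def carrier_U_vir
  proof (elim UnE CollectE exE conjE imageE rangeE)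
    fix u a c y assume r: "r = bv (u \<otimes>\<^bsub>U_vir\<^esub> env_incl a, c) - bv (u, env_char \<mu> a * c)"
      and "a \<in> carrier (env (vir_sub f))" "u = cl y"
    then obtain p where "p \<in> carrier (free_algebra (vir_sub f))" "env_incl a = cl p" "env_char \<mu> a = free_eval \<mu> p"
      using env_incl_char[OF mu] by blast
    with r \<open>u = cl y\<close> show thesis by (intro that(6)[of y p c]) (simp_all add: cl_mult)
  qed (use that(2-5) in \<open>auto simp: cl_add cl_scale\<close>)
  have SC: "?S \<subseteq> ?C"
  proof (rule pm.span_minimal[OF _ subspace_support], rule subsetI)
    have mem: "bv (cl p, c) \<in> ?C" for p c by (auto simp: B)
    note C = mem pm.subspace_add[OF subspace_support[of B]] pm.subspace_diff[OF subspace_support[of B]]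
      pm.subspace_scale[OF subspace_support[of B]]
    fix r assume "r \<in> R"
    then show "r \<in> ?C" by (rule cases; (simp only:); intro C)
  qed
  have TS: "lin_ext (\<phi> v) p \<in> ?S" if "p \<in> ?S" for v p
  proof (rule lin_span_image[OF lin_lin_ext sS that])
    fix r assume "r \<in> R"
    then have "lin_ext (\<phi> v) r \<in> R"
    proof (rule cases)
      fix p q c assume "r = bv (cl (p + q), c) - (bv (cl p, c) + bv (cl q, c))"
      then show ?thesis using r1[of "gen v * p" "gen v * q" c]
        by (simp add: lin_diff[OF lin_lin_ext] lin_add[OF lin_lin_ext] \<phi> distrib_left)
    next
      fix p c c' assume "r = bv (cl p, c + c') - (bv (cl p, c) + bv (cl p, c'))"
      then show ?thesis using r2[of "gen v * p" c c']
        by (simp add: lin_diff[OF lin_lin_ext] lin_add[OF lin_lin_ext] \<phi>)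
    next
      fix p c d assume "r = bv (cl (smul d p), c) - smul d (bv (cl p, c))"
      then show ?thesis using r3[of d "gen v * p" c]
        by (simp add: lin_diff[OF lin_lin_ext] lin_smul[OF lin_lin_ext] \<phi> del: smul_single)
    next
      fix p c d assume "r = bv (cl p, d * c) - smul d (bv (cl p, c))"
      then show ?thesis using r4[of "gen v * p" d c]
        by (simp add: lin_diff[OF lin_lin_ext] lin_smul[OF lin_lin_ext] \<phi> del: smul_single)
    next
      fix p q c assume "r = bv (cl (q * p), c) - bv (cl q, free_eval \<mu> p * c)"
        "p \<in> carrier (free_algebra (vir_sub f))"
      then show ?thesis using r5[of p "gen v * q" c]
        by (simp add: lin_diff[OF lin_lin_ext] \<phi> mult.assoc)
    qed
    then show "lin_ext (\<phi> v) r \<in> ?S" by (rule pm.span_base)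
  qed
  have TC: "lin_ext (\<phi> v) p \<in> ?C" if "p \<in> ?C" for v p
  proof (rule lin_mem_subspace[OF lin_lin_ext subspace_support])
    fix b assume "b \<in> Poly_Mapping.keys p"
    with that have "b \<in> B" by auto
    then obtain q c where "b = (cl q, c)" by (cases b) (auto simp: B)
    then show "lin_ext (\<phi> v) (bv b) \<in> ?C" by (simp add: \<phi> B)
  qed
  define h :: "free_alg \<Rightarrow> _" where "h p = bv (cl p, 1::complex)" for p
  have surj: "\<exists>q. p - h q \<in> ?S" if "p \<in> ?C" for p
  proof -
    have k: "Poly_Mapping.keys p \<subseteq> B" using that by simp
    show ?thesis
    proof (induction p rule: pm_induct)
      case zero
      have "h 0 \<in> ?S" using pm.span_base[OF r4[of 0 0 1]] r3[of 0 0 1] by (auto simp: h_def intro: pm.span_base)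
      then show ?case by (intro exI[of _ 0]) (simp add: pm.span_neg)
    next
      case (add p q)
      then obtain a b where "p - h a \<in> ?S" "q - h b \<in> ?S" by auto
      note pm.span_add[OF pm.span_add[OF this] pm.span_neg[OF pm.span_base[OF r1[of a b 1]]]]
      then show ?case by (intro exI[of _ "a + b"]) (simp add: h_def algebra_simps)
    next
      case (smul c p)
      then obtain a where "p - h a \<in> ?S" by auto
      note pm.span_add[OF pm.span_scale[OF this, of c] pm.span_neg[OF pm.span_base[OF r3[of c a 1]]]]
      then show ?case by (intro exI[of _ "smul c a"]) (simp add: h_def pm.scale_right_diff_distrib)
    next
      case (bv b)
      then have "b \<in> B" using k by auto
      then obtain a c where b: "b = (cl a, c)" by (cases b) (auto simp: B)
      note pm.span_add[OF pm.span_base[OF r4[of a c 1]] pm.span_neg[OF pm.span_base[OF r3[of c a 1]]]]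
      then show ?case by (intro exI[of _ "smul c a"]) (simp add: h_def b)
    qed
  qed
  \<comment> \<open>The map back depends on chosen representatives, but only up to
    \<open>env_ideal UNIV\<close>, hence up to \<open>J f \<mu>\<close>.\<close>
  define rep where "rep u = (SOME p. cl p = u)" for u
  have rep: "rep (cl p) - p \<in> env_ideal UNIV" for p
    unfolding cl_eq_iff[symmetric] rep_def by (rule someI) simp
  define hh where "hh = lin_ext (\<lambda>(u, c). smul c (rep u))"
  have hh: "hh (bv (cl p, c)) - smul c p \<in> J f \<mu>" for p c
    using pm.subspace_scale[OF subspace_J[of f \<mu>], of "rep (cl p) - p" c] env_ideal_subset_J rep
    by (auto simp: hh_def pm.scale_right_diff_distrib)
  have lhh: "lin hh" unfolding hh_def by (rule lin_lin_ext)
  have hhR: "hh r \<in> J f \<mu>" if "r \<in> R" for r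
  proof -
    interpret vmod UNIV "J f \<mu>" "\<lambda>v p. gen v * p" by (rule vmod_J)
    have hh': "eqm (J f \<mu>) (hh (bv (cl p, c))) (smul c p)" for p c using hh by (simp add: eqm_def)
    note e = eqS_diff eqS_add eqS_smul hh'
    have "eqm (J f \<mu>) (hh r) (0)"
      using that
    proof (rule cases)
      fix p q c assume "r = bv (cl (p + q), c) - (bv (cl p, c) + bv (cl q, c))"
      then have "eqm (J f \<mu>) (hh r) (smul c (p + q) - (smul c p + smul c q))"
        by (simp only: lin_diff[OF lhh] lin_add[OF lhh]) (intro e)
      then show ?thesis by (simp add: pm.scale_right_distrib)
    next
      fix p c c' assume "r = bv (cl p, c + c') - (bv (cl p, c) + bv (cl p, c'))"
      then have "eqm (J f \<mu>) (hh r) (smul (c + c') p - (smul c p + smul c' p))"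
        by (simp only: lin_diff[OF lhh] lin_add[OF lhh]) (intro e)
      then show ?thesis by (simp add: pm.scale_left_distrib)
    next
      fix p c d assume "r = bv (cl (smul d p), c) - smul d (bv (cl p, c))"
      then have "eqm (J f \<mu>) (hh r) (smul c (smul d p) - smul d (smul c p))"
        by (simp only: lin_diff[OF lhh] lin_smul[OF lhh]) (intro e)
      then show ?thesis by (simp add: mult.commute)
    next
      fix p c d assume "r = bv (cl p, d * c) - smul d (bv (cl p, c))"
      then have "eqm (J f \<mu>) (hh r) (smul (d * c) p - smul d (smul c p))"
        by (simp only: lin_diff[OF lhh] lin_smul[OF lhh]) (intro e)
      then show ?thesis by simp
    next
      fix p q c assume r: "r = bv (cl (q * p), c) - bv (cl q, free_eval \<mu> p * c)"
        "p \<in> carrier (free_algebra (vir_sub f))"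
      then have "eqm (J f \<mu>) (hh r) (smul c (q * p) - smul (free_eval \<mu> p * c) q)"
        by (simp only: lin_diff[OF lhh]) (intro e)
      moreover have "smul c (q * (p - Poly_Mapping.single 0 (free_eval \<mu> p))) \<in> J f \<mu>"
        by (intro pm.subspace_scale[OF subspace_J] J_left J_free_eval r)
      moreover have "smul c (q * (p - Poly_Mapping.single 0 (free_eval \<mu> p))) =
          smul c (q * p) - smul (free_eval \<mu> p * c) q"
        by (simp add: right_diff_distrib pm.scale_right_diff_distrib mult.commute flip: single_0_commute smul_eq_mult)
      ultimately have "eqm (J f \<mu>) (smul c (q * p) - smul (free_eval \<mu> p * c) q) 0"
        by (simp add: eqm_def)
      with \<open>eqm (J f \<mu>) (hh r) _\<close> show ?thesis by (rule eqS_trans)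
    qed
    then show ?thesis by (simp add: eqS_0)
  qed
  have inj: "h p \<in> ?S \<longleftrightarrow> p \<in> J f \<mu>" for p
  proof
    assume "h p \<in> ?S"
    then have "hh (h p) \<in> J f \<mu>" by (rule lin_span_image[OF lhh subspace_J _ hhR])
    from pm.subspace_diff[OF subspace_J this hh[of p 1]] show "p \<in> J f \<mu>" by (simp add: h_def)
  next
    have sub: "pm.subspace {p. h p \<in> ?S}"
      unfolding pm.subspace_def
    proof (intro conjI allI ballI; clarsimp)
      have "h 0 \<in> ?S" using r3[of 0 0 1] by (auto simp: h_def intro: pm.span_base)
      then show "h 0 \<in> ?S" .
      show "h (p + q) \<in> ?S" if "h p \<in> ?S" "h q \<in> ?S" for p q
        using pm.span_add[OF pm.span_base[OF r1[of p q 1]] pm.span_add[OF that]] by (simp add: h_def)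
      show "h (smul c p) \<in> ?S" if "h p \<in> ?S" for p c
        using pm.span_add[OF pm.span_base[OF r3[of c p 1]] pm.span_scale[OF that, of c]] by (simp add: h_def)
    qed
    have gens: "{bv u * r * bv w | u r w. r \<in> env_rels UNIV} \<union>
      {bv u * (gen x - Poly_Mapping.single 0 (\<mu> x)) | u x. x \<in> vir_sub f} \<subseteq> {p. h p \<in> ?S}"
    proof (intro Un_least subsetI; clarsimp)
      fix u w r assume "r \<in> env_rels UNIV"
      then have "bv u * r * bv w \<in> env_ideal UNIV" using env_rels_env_ideal env_ideal_mult by blast
      then have "cl (bv u * r * bv w) = cl 0" by (simp add: cl_eq_iff)
      then have "h (bv u * r * bv w) = h 0" by (simp add: h_def)
      also have "h 0 \<in> ?S" using r3[of 0 0 1] by (auto simp: h_def intro: pm.span_base)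
      finally show "h (bv u * r * bv w) \<in> ?S" .
    next
      fix u x assume x: "x \<in> vir_sub f"
      have gx: "gen x \<in> carrier (free_algebra (vir_sub f))" using x by (rule free_algebra_gen)
      let ?p = "bv u * gen x" and ?q = "smul (- \<mu> x) (bv u)"
      \<comment> \<open>Four relations that telescope: additivity on the left, moving
        \<open>x\<close> across the tensor sign, and extracting the scalars \<open>- \<mu> x\<close>
        on the left and \<open>\<mu> x\<close> on the right. Their sum is
        \<open>h (?p + ?q)\<close>.\<close>
      have "(h (?p + ?q) - (h ?p + h ?q)) + (h ?p - bv (cl (bv u), \<mu> x * 1)) +
          (h ?q - smul (- \<mu> x) (h (bv u))) + (bv (cl (bv u), \<mu> x * 1) - smul (\<mu> x) (h (bv u))) \<in> ?S"
        using r1[of ?p ?q 1] r5[OF gx, of "bv u" 1] r3[of "- \<mu> x" "bv u" 1] r4[of "bv u" "\<mu> x" 1]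
        unfolding h_def free_eval_word by (intro pm.span_add pm.span_base) simp_all
      moreover have "?p + ?q = bv u * (gen x - Poly_Mapping.single 0 (\<mu> x))"
        by (simp add: right_diff_distrib single_uminus flip: single_0_commute smul_eq_mult)
      ultimately show "h (bv u * (gen x - Poly_Mapping.single 0 (\<mu> x))) \<in> ?S" by simp
    qed
    show "h p \<in> ?S" if "p \<in> J f \<mu>"
      using that pm.span_minimal[OF gens sub] by (auto simp: J_def)
  qed
  have C: "vmod ?C ?S (\<lambda>v. lin_ext (\<phi> v))"
  proof -
    interpret Jm: vmod UNIV "J f \<mu>" "\<lambda>v p. gen v * p" by (rule vmod_J)
    have hl: "h (p + q) - (h p + h q) \<in> ?S" "h (smul c p) - smul c (h p) \<in> ?S" for p q c
      using r1[of p q 1] r3[of c p 1] by (auto simp: h_def intro: pm.span_base)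
    have Th: "lin_ext (\<phi> v) (h p) = h (gen v * p)" for v p by (simp add: h_def \<phi>)
    \<comment> \<open>Every element is congruent to some \<open>h q\<close>, so a linear map
      preserving the relations needs testing only on these, where the identity is inherited from the
      free algebra modulo \<open>J f \<mu>\<close>.\<close>
    have red: "g p \<in> ?S" if "lin g" "\<And>p. p \<in> ?S \<Longrightarrow> g p \<in> ?S" "\<And>q. g (h q) \<in> ?S" "p \<in> ?C" for g p
    proof -
      obtain q where "p - h q \<in> ?S" using surj[OF \<open>p \<in> ?C\<close>] by blast
      from pm.span_add[OF that(2)[OF this] that(3)[of q]] show ?thesis by (simp add: lin_diff[OF that(1)])
    qed
    have hd: "h (a - b) - (h a - h b) \<in> ?S" for a b
      using pm.span_add[OF hl(1)[of a "smul (-1) b"] hl(2)[of "-1" b]] by (simp add: algebra_simps)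
    have eq: "h a - h b \<in> ?S" if "a - b \<in> J f \<mu>" for a b
      using pm.span_diff[of "h (a - b)" R, OF _ hd[of a b]] inj[of "a - b"] that by (simp add: algebra_simps)
    note L = lin_subtract lin_plus lin_scale lin_lin_ext lin_comp[OF lin_lin_ext lin_lin_ext]
    show ?thesis
    proof
      fix p and v w :: vir and c assume p: "p \<in> ?C"
      show "eqm ?S (lin_ext (\<phi> (v + w)) p) (lin_ext (\<phi> v) p + lin_ext (\<phi> w) p)"
        unfolding eqm_def
      proof (rule red[of "\<lambda>p. lin_ext (\<phi> (v + w)) p - (lin_ext (\<phi> v) p + lin_ext (\<phi> w) p)", OF _ _ _ p])
        fix q
        from pm.span_add[OF eq[OF Jm.T_plus[of q v w, unfolded eqm_def, simplified]] hl(1)[of "gen v * q" "gen w * q"]]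
        show "lin_ext (\<phi> (v + w)) (h q) - (lin_ext (\<phi> v) (h q) + lin_ext (\<phi> w) (h q)) \<in> ?S"
          unfolding Th by (simp add: algebra_simps)
      qed (auto intro!: L pm.span_diff pm.span_add TS)
      show "eqm ?S (lin_ext (\<phi> (smul c v)) p) (smul c (lin_ext (\<phi> v) p))"
        unfolding eqm_def
      proof (rule red[of "\<lambda>p. lin_ext (\<phi> (smul c v)) p - smul c (lin_ext (\<phi> v) p)", OF _ _ _ p])
        fix q
        from pm.span_add[OF eq[OF Jm.T_scale[of q c v, unfolded eqm_def, simplified]] hl(2)[of c "gen v * q"]]
        show "lin_ext (\<phi> (smul c v)) (h q) - smul c (lin_ext (\<phi> v) (h q)) \<in> ?S"
          unfolding Th by (simp add: algebra_simps)
      qed (auto intro!: L pm.span_diff pm.span_scale TS)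
      show "eqm ?S (lin_ext (\<phi> (bracket v w)) p) (lin_ext (\<phi> v) (lin_ext (\<phi> w) p) - lin_ext (\<phi> w) (lin_ext (\<phi> v) p))"
        unfolding eqm_def
      proof (rule red[of "\<lambda>p. lin_ext (\<phi> (bracket v w)) p - (lin_ext (\<phi> v) (lin_ext (\<phi> w) p) - lin_ext (\<phi> w) (lin_ext (\<phi> v) p))", OF _ _ _ p])
        fix q
        from pm.span_add[OF eq[OF Jm.T_bracket[of q v w, unfolded eqm_def, simplified]] hd[of "gen v * (gen w * q)" "gen w * (gen v * q)"]]
        show "lin_ext (\<phi> (bracket v w)) (h q) - (lin_ext (\<phi> v) (lin_ext (\<phi> w) (h q)) - lin_ext (\<phi> w) (lin_ext (\<phi> v) (h q))) \<in> ?S"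
          unfolding Th by (simp add: algebra_simps)
      qed (auto intro!: L pm.span_diff TS)
    qed (use SC TC TS subspace_support in \<open>auto intro: lin_lin_ext\<close>)
  qed
  have "presents (quot_mod (free_mod B \<phi>) ?S) ?C ?S (\<lambda>v. lin_ext (\<phi> v)) (\<lambda>p. (\<lambda>s. s + p) ` ?S)"
    by (rule quot_presents[OF sS SC TS])
  from vmod.presents_comp[OF C this, where C' = UNIV and S' = "J f \<mu>" and h = h and T' = "\<lambda>v p. gen v * p"]
  have "presents (quot_mod (free_mod B \<phi>) ?S) UNIV (J f \<mu>) (\<lambda>v p. gen v * p) (\<lambda>p. (\<lambda>s. s + h p) ` ?S)"
    using surj inj r1[THEN pm.span_base] r3[THEN pm.span_base]
    by (simp add: eqm_def h_def \<phi> B pm.span_zero del: smul_single)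
  moreover have "induced f \<mu> = quot_mod (free_mod B \<phi>) ?S"
    by (simp add: induced_def B_def \<phi>_def R_def)
  ultimately show ?thesis unfolding is_quot_def by auto
qed


lemma smul_inverse: "c \<noteq> 0 \<Longrightarrow> smul (inverse c) (smul c p) = p"
  by simp

section \<open>Expansion at a point\<close>

abbreviation lpt :: "complex \<Rightarrow> laurent" where
  "lpt l \<equiv> LP [:- l, 1:]"

text \<open>Under \<open>e_of\<close> this is the vector field \<open>(t - l)\<^sup>a d/dt\<close>.\<close>

definition vf :: "complex \<Rightarrow> nat \<Rightarrow> vir" where
  "vf l a = e_of (bv (- 1) * lpt l ^ a)"

lemma lpt_eq: "lpt l = bv 1 - Poly_Mapping.single 0 l"
  by (simp add: LP_pCons LP_0 LP_1[unfolded one_pCons] single_uminus flip: single_one)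

lemma D_lpt: "D (lpt l) = bv 1"
  by (simp add: lpt_eq D_diff)

lemma D_lpt_power: "D (lpt l ^ a) = Poly_Mapping.single 1 (of_nat a) * lpt l ^ (a - 1)"
proof (induction a)
  case (Suc a)
  have "lpt l * (Poly_Mapping.single 1 (of_nat a) * lpt l ^ (a - 1)) = Poly_Mapping.single 1 (of_nat a) * lpt l ^ a"
    by (cases a) (simp_all add: ac_simps)
  then have "D (lpt l ^ Suc a) = (bv 1 + Poly_Mapping.single 1 (of_nat a)) * lpt l ^ a"
    by (simp only: power_Suc D_mult D_lpt Suc distrib_right)
  then show ?case by (simp flip: single_add)
qed (simp add: D_1)

text \<open>The Witt relation in the basis adapted to the point \<open>l\<close>. Truncated
  subtraction is harmless: it takes effect only where the coefficient in front is zero.\<close>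

lemma wbr_vf: "wbr (lg (vf l a)) (lg (vf l b)) = smul (of_nat b - of_nat a) (lg (vf l (a + b - 1)))"
proof -
  let ?X = "lpt l" and ?u = "bv (- 1) :: laurent"
  have D: "D (?u * ?X ^ a) = Poly_Mapping.single 0 (of_nat a) * ?X ^ (a - 1) - ?u * ?X ^ a" for a
    by (simp add: D_mult D_lpt_power mult_single single_uminus flip: mult.assoc)
  have P: "Poly_Mapping.single 0 (of_nat b) * (?X ^ (b - 1) * ?X ^ a) = Poly_Mapping.single 0 (of_nat b) * ?X ^ (a + b - 1)" for a b
    by (cases b) (simp_all add: ac_simps flip: power_add)
  have "wbr (?u * ?X ^ a) (?u * ?X ^ b) =
      ?u * (Poly_Mapping.single 0 (of_nat b) * (?X ^ (b - 1) * ?X ^ a)) -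
      ?u * (Poly_Mapping.single 0 (of_nat a) * (?X ^ (a - 1) * ?X ^ b))"
    by (simp add: wbr_def D algebra_simps)
  also have "\<dots> = (Poly_Mapping.single 0 (of_nat b) - Poly_Mapping.single 0 (of_nat a)) * (?u * ?X ^ (a + b - 1))"
    unfolding P by (simp add: algebra_simps)
  finally show ?thesis by (simp add: vf_def smul_eq_mult single_diff)
qed

lemma lpt_dvd_bv:
  assumes "l \<noteq> 0"
  shows "lpt l dvd bv j - Poly_Mapping.single 0 (l powi j)"
proof -
  have nat: "lpt l dvd bv (int k) - Poly_Mapping.single 0 (l ^ k)" for k
  proof (induction k)
    case (Suc k)
    have "bv (int (Suc k)) - Poly_Mapping.single 0 (l ^ Suc k) =
        bv 1 * (bv (int k) - Poly_Mapping.single 0 (l ^ k)) + Poly_Mapping.single 0 (l ^ k) * lpt l"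
      by (simp add: lpt_eq algebra_simps mult_single)
    then show ?case using Suc by (metis dvd_add dvd_mult dvd_triv_right)
  qed simp
  show ?thesis
  proof (cases "j \<ge> 0")
    case True
    then show ?thesis using nat[of "nat j"] by (simp add: power_int_def)
  next
    case False
    define k where "k = nat (- j)"
    have k: "j = - int k" using False by (simp add: k_def)
    have "bv j - Poly_Mapping.single 0 (l powi j) =
        Poly_Mapping.single j (- inverse (l ^ k)) * (bv (int k) - Poly_Mapping.single 0 (l ^ k))"
      using assms by (simp add: k algebra_simps mult_single power_int_minus single_uminus)
    then show ?thesis using nat[of k] by (metis dvd_mult)
  qed
qed

lemma lpt_dvd_expand:
  assumes "l \<noteq> 0"
  shows "\<exists>c. lpt l dvd g - smul c (bv (- 1))"
proof (induction g rule: pm_induct)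
  case (bv j)
  have "bv j - smul (l powi (j + 1)) (bv (- 1)) = bv (- 1) * (bv (j + 1) - Poly_Mapping.single 0 (l powi (j + 1)))"
    by (simp add: right_diff_distrib mult_single)
  then show ?case using lpt_dvd_bv[OF assms, of "j + 1"] by (metis dvd_mult)
next
  case (add p q)
  then obtain c d where "lpt l dvd p - smul c (bv (- 1))" "lpt l dvd q - smul d (bv (- 1))" by blast
  from dvd_add[OF this] show ?case
    by (intro exI[of _ "c + d"]) (simp add: pm.scale_left_distrib algebra_simps single_add)
next
  case (smul c p)
  then obtain d where "lpt l dvd p - smul d (bv (- 1))" by blast
  from dvd_smul[OF this, of c] show ?case
    by (intro exI[of _ "c * d"]) (simp add: pm.scale_right_diff_distrib)
qed (auto intro: exI[of _ 0])

text \<open>Repeated division by \<open>t - l\<close>. Since fields vanishing to high order act by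
  zero on a given word, every element of \<open>Vir\<close> acts there like a finite combination of
  the fields \<open>vf l b\<close>.\<close>

lemma taylor:
  assumes "l \<noteq> 0"
  shows "\<exists>\<alpha>. lpt l ^ N dvd lg v - (\<Sum>b<N. smul (\<alpha> b) (lg (vf l b)))"
proof (induction N)
  case (Suc N)
  then obtain \<alpha> r where \<alpha>: "lg v - (\<Sum>b<N. smul (\<alpha> b) (lg (vf l b))) = lpt l ^ N * r" by (auto elim: dvdE)
  obtain c s where c: "r - smul c (bv (- 1)) = lpt l * s" using lpt_dvd_expand[OF assms, of r] by (auto elim: dvdE)
  have "lg v - (\<Sum>b<Suc N. smul ((\<alpha>(N := c)) b) (lg (vf l b))) = lpt l ^ N * (r - smul c (bv (- 1)))"
    by (simp add: right_diff_distrib vf_def mult.commute[of "bv (- 1)"] diff_diff_eq2 flip: \<alpha> del: smul_single)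
  then have "lg v - (\<Sum>b<Suc N. smul ((\<alpha>(N := c)) b) (lg (vf l b))) = lpt l ^ Suc N * s"
    by (simp only: c power_Suc2 mult.assoc)
  then have "lpt l ^ Suc N dvd lg v - (\<Sum>b<Suc N. smul ((\<alpha>(N := c)) b) (lg (vf l b)))"
    by (rule dvdI)
  then show ?case by blast
qed simp


section \<open>Modules concentrated at one point\<close>

text \<open>\<open>E\<close> consists of vectors on which the stabilizer of the point acts by the character \<open>\<mu>\<close>.\<close>

locale point_vmod = vmod C S T for C S :: "('b \<Rightarrow>\<^sub>0 complex) set" and T +
  fixes E :: "('b \<Rightarrow>\<^sub>0 complex) set" and l :: complex and n :: nat and \<mu> :: "vir \<Rightarrow> complex" and q :: nat
  assumes l0: "l \<noteq> 0" and n1: "n \<ge> 1"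
    and T_lg0: "lg v = 0 \<Longrightarrow> p \<in> C \<Longrightarrow> T v p \<in> S"
    and sub_E: "pm.subspace E" and E_C: "E \<subseteq> C"
    and E_char: "e \<in> E \<Longrightarrow> lpt l ^ n dvd lg v \<Longrightarrow> eqm S (T v e) (smul (\<mu> v) e)"
    and \<mu>_vanish: "lpt l ^ (2 * n) dvd lg v \<Longrightarrow> \<mu> v = 0"
    and q_cases: "q = 2 * n - 1 \<or> (q = 2 * n - 2 \<and> n \<ge> 2)"
    and \<mu>_q: "\<mu> (vf l q) \<noteq> 0" and \<mu>_above: "b > q \<Longrightarrow> \<mu> (vf l b) = 0"
begin

section \<open>Words in the fields at the point\<close>

definition d :: "nat \<Rightarrow> ('b \<Rightarrow>\<^sub>0 complex) \<Rightarrow> ('b \<Rightarrow>\<^sub>0 complex)" where "d a = T (vf l a)"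
definition m :: "nat \<Rightarrow> complex" where "m b = \<mu> (vf l b)"
definition wd :: "nat list \<Rightarrow> ('b \<Rightarrow>\<^sub>0 complex) \<Rightarrow> ('b \<Rightarrow>\<^sub>0 complex)" where "wd ls e = foldr d ls e"

lemma wd_simps [simp]: "wd [] e = e" "wd (a # ls) e = d a (wd ls e)"
  by (simp_all add: wd_def)

lemma T_lg: assumes "lg v = lg w" "p \<in> C" shows "T v p \<approx> T w p"
proof -
  have "T (v - w) p \<approx> 0" using T_lg0[of "v - w" p] assms by (simp add: lin_diff[OF lin_lg] eqS_0)
  then show ?thesis using T_minus[OF assms(2), of v w]
    by (metis eqS_0 eqS_S eqm_def)
qed

lemma lin_d: "lin (d a)" and d_C: "p \<in> C \<Longrightarrow> d a p \<in> C" and d_S: "p \<in> S \<Longrightarrow> d a p \<in> S"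
  and eqS_d: "p \<approx> r \<Longrightarrow> d a p \<approx> d a r"
  by (auto simp: d_def T_lin T_C T_S eqS_T)

lemma lin_wd: "lin (wd ls)"
proof (induction ls)
  case (Cons a ls)
  show ?case using lin_comp[OF lin_d Cons] by simp
qed (simp add: lin_id wd_def)

lemma wd_C: "e \<in> C \<Longrightarrow> wd ls e \<in> C" and wd_S: "e \<in> S \<Longrightarrow> wd ls e \<in> S"
  by (induction ls) (auto intro: d_C d_S)

lemma d_commute: assumes "p \<in> C"
  shows "d a (d b p) \<approx> d b (d a p) + smul (of_nat b - of_nat a) (d (a + b - 1) p)"
proof -
  let ?c = "of_nat b - of_nat a :: complex"
  have "smul ?c (d (a + b - 1) p) \<approx> T (smul ?c (vf l (a + b - 1))) p"
    unfolding d_def by (rule eqS_sym[OF T_scale[OF assms]])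
  also have "\<dots> \<approx> T (bracket (vf l a) (vf l b)) p"
    by (rule T_lg[OF _ assms]) (simp add: lg_bracket wbr_vf lin_smul[OF lin_lg])
  also have "\<dots> \<approx> d a (d b p) - d b (d a p)"
    unfolding d_def by (rule T_bracket[OF assms])
  finally have "d b (d a p) + smul ?c (d (a + b - 1) p) \<approx> d b (d a p) + (d a (d b p) - d b (d a p))"
    by (intro eqS_add eqS_refl)
  then show ?thesis by (simp add: eqS_sym)
qed

lemma m_0: "b > q \<Longrightarrow> m b = 0" and m_q: "m q \<noteq> 0"
  using \<mu>_above \<mu>_q by (auto simp: m_def)

lemma d_E: "e \<in> E \<Longrightarrow> b \<ge> n \<Longrightarrow> d b e \<approx> smul (m b) e"
  unfolding d_def m_def by (rule E_char) (auto simp: vf_def le_imp_power_dvd)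

text \<open>The steps of two matter. Corrections from moving fields past each other must have lower
  weight, and the tightest case is \<open>n = 2\<close>, \<open>q = 2\<close>: moving
  \<open>d 2\<close> past \<open>d 0\<close> leaves \<open>d 1\<close>, and
  \<open>om 1 + om 1 < om 0\<close> has to hold. The weight \<open>n - a\<close> would give equality
  there. From index \<open>n\<close> on, truncation makes the weight 0.\<close>

definition om :: "nat \<Rightarrow> nat" where "om a = 2 * (n - a) - 1"
definition wt :: "nat list \<Rightarrow> nat" where "wt ls = sum_list (map om ls)"
text \<open>The strict inequality makes \<open>XX 0\<close> equal to \<open>S\<close>, so that a
  truncated weight bound of 0 means vanishing in the quotient.\<close>

definition XX :: "nat \<Rightarrow> ('b \<Rightarrow>\<^sub>0 complex) set" where
  "XX k = pm.span (S \<union> {wd ls e | ls e. set ls \<subseteq> {..<n} \<and> e \<in> E \<and> wt ls < k})"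
definition UU :: "('b \<Rightarrow>\<^sub>0 complex) set" where
  "UU = pm.span (S \<union> {wd ls e | ls e. set ls \<subseteq> {..<n} \<and> e \<in> E})"

lemma wt_simps [simp]: "wt [] = 0" "wt (a # ls) = om a + wt ls" "wt (ls @ ls') = wt ls + wt ls'"
  by (simp_all add: wt_def)

lemma om_pos: "a < n \<Longrightarrow> om a \<ge> 1" and om_anti: "a \<le> b \<Longrightarrow> om b \<le> om a"
  and om_strict: "a < b \<Longrightarrow> a < n \<Longrightarrow> om b < om a"
  by (auto simp: om_def)

lemma sub_XX: "pm.subspace (XX k)" and S_XX: "S \<subseteq> XX k"
  unfolding XX_def by (auto intro: pm.span_base)

lemma XX_mono: "k \<le> k' \<Longrightarrow> XX k \<subseteq> XX k'"
  unfolding XX_def by (rule pm.span_mono) fastforce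

lemma wd_XX: "set ls \<subseteq> {..<n} \<Longrightarrow> e \<in> E \<Longrightarrow> wt ls < k \<Longrightarrow> wd ls e \<in> XX k"
  unfolding XX_def by (auto intro: pm.span_base)

lemma XX_UU: "XX k \<subseteq> UU"
  unfolding XX_def UU_def by (rule pm.span_mono) auto

lemma XX_0: "XX 0 = S"
  by (simp add: XX_def pm.span_eq_iff sub_S)

lemma XX_induct:
  assumes "p \<in> XX k" "lin f" "pm.subspace R" "\<And>s. s \<in> S \<Longrightarrow> f s \<in> R"
    "\<And>ls e. set ls \<subseteq> {..<n} \<Longrightarrow> e \<in> E \<Longrightarrow> wt ls < k \<Longrightarrow> f (wd ls e) \<in> R"
  shows "f p \<in> R"
  by (rule lin_span_image[OF assms(2,3) assms(1)[unfolded XX_def]]) (use assms(4,5) in auto)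

lemma d_XX: assumes "a < n" "p \<in> XX k" shows "d a p \<in> XX (k + om a)"
  by (rule XX_induct[OF assms(2) lin_d sub_XX])
     (use assms(1) S_XX d_S in \<open>auto simp flip: wd_simps(2) intro!: wd_XX\<close>)

lemma XX_eq: "p \<approx> r \<Longrightarrow> p \<in> XX k \<longleftrightarrow> r \<in> XX k"
  by (rule eqS_mem[OF _ S_XX sub_XX])

lemmas XX_intros = pm.subspace_add[OF sub_XX] pm.subspace_diff[OF sub_XX] pm.subspace_scale[OF sub_XX]

text \<open>The vector field \<open>vf l b\<close> lowers the weight by at least this amount.\<close>

abbreviation sg :: "nat \<Rightarrow> nat" where "sg b \<equiv> om (q + 1 - b)"

text \<open>Both values allowed for \<open>q\<close> are large enough that
  \<open>q + 1 - a \<ge> n\<close> for all \<open>a < n\<close>, so the fields used for lowering act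
  on \<open>E\<close> by scalars.\<close>

lemma sg_n: "1 + sg n \<le> om 0" and q_n: "q + 1 \<ge> n + (if q = 2 * n - 1 then n else n - 1)"
  using q_cases n1 by (auto simp: om_def)

lemma d_step: assumes "p \<in> C"
  shows "d b (d c p) - smul (m b) (d c p) \<approx>
     d c (d b p - smul (m b) p) + smul (of_nat c - of_nat b) (d (b + c - 1) p)"
proof -
  have "d b (d c p) - smul (m b) (d c p) \<approx>
      (d c (d b p) + smul (of_nat c - of_nat b) (d (b + c - 1) p)) - smul (m b) (d c p)"
    by (intro eqS_diff eqS_refl d_commute[OF assms])
  then show ?thesis by (simp add: lin_diff[OF lin_d] lin_smul[OF lin_d] algebra_simps)
qed

text \<open>Induction on the word, moving \<open>d b\<close> past its first letter \<open>c\<close>.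
  The commutator is a multiple of \<open>d (b + c - 1)\<close>, to which the induction hypothesis
  applies again unless \<open>b = n\<close> and \<open>c = 0\<close>.\<close>

lemma d_low:
  assumes "set ls \<subseteq> {..<n}" "e \<in> E" "b \<ge> n"
  shows "d b (wd ls e) - smul (m b) (wd ls e) \<in> XX (Suc (wt ls) - sg b)"
  using assms(1,3)
proof (induction ls arbitrary: b)
  case Nil
  then show ?case using d_E[OF assms(2), of b] S_XX by (auto simp: eqm_def)
next
  case (Cons c ls)
  let ?u = "wd ls e" and ?k = "Suc (om c + wt ls) - sg b"
  have c: "c < n" and ls: "set ls \<subseteq> {..<n}" using Cons by auto
  have uC: "?u \<in> C" using assms(2) E_C wd_C by auto
  have u: "?u \<in> XX (Suc (wt ls))" using ls assms(2) by (intro wd_XX) auto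
  have 1: "d c (d b ?u - smul (m b) ?u) \<in> XX ?k"
  proof (cases "Suc (wt ls) \<le> sg b")
    case True
    \<comment> \<open>The truncated bound is 0 in this case, so the term vanishes in the quotient
      instead of merely having low weight.\<close>
    then have "d b ?u - smul (m b) ?u \<in> S" using Cons.IH[OF ls Cons.prems(2)] XX_0 by simp
    then show ?thesis using d_S S_XX by auto
  next
    case False
    then show ?thesis using d_XX[OF c Cons.IH[OF ls Cons.prems(2)]] by (auto simp: algebra_simps)
  qed
  have 2: "d (b + c - 1) ?u \<in> XX ?k"
  proof (cases "b + c - 1 < n")
    case True
    then have bc: "b = n" "c = 0" using Cons.prems(2) n1 by auto
    have "d (n - 1) ?u \<in> XX (Suc (wt ls) + om (n - 1))" using n1 by (intro d_XX u) auto
    moreover have "om (n - 1) = 1" using n1 by (simp add: om_def)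
    ultimately show ?thesis using sg_n bc by (auto elim!: subsetD[OF XX_mono, rotated])
  next
    case False
    have "d (b + c - 1) ?u - smul (m (b + c - 1)) ?u \<in> XX (Suc (wt ls) - sg (b + c - 1))"
      using False by (intro Cons.IH ls) auto
    moreover have "Suc (wt ls) - sg (b + c - 1) \<le> ?k"
    proof (cases "c = 0")
      case True
      then show ?thesis using om_anti[of 0 "q + 1 - b"] by simp
    next
      case False
      then have "q + 1 - (b + c - 1) \<le> q + 1 - b" by linarith
      from om_anti[OF this] show ?thesis by simp
    qed
    ultimately have "d (b + c - 1) ?u - smul (m (b + c - 1)) ?u \<in> XX ?k" using XX_mono by blast
    moreover have "smul (m (b + c - 1)) ?u \<in> XX ?k"
    proof (cases "b + c - 1 > q")
      case True
      then show ?thesis by (simp add: m_0 pm.subspace_0[OF sub_XX])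
    next
      case F: False
      \<comment> \<open>An index \<open>b + c - 1\<close> of at most \<open>q\<close> forces
        \<open>c \<le> q + 1 - b\<close>, so losing the letter \<open>c\<close> already lowers the
        weight by \<open>sg b\<close>.\<close>
      then have "sg b \<le> om c" using False n1 by (intro om_anti) auto
      then have "?u \<in> XX ?k" using u by (auto elim!: subsetD[OF XX_mono, rotated])
      then show ?thesis by (rule XX_intros)
    qed
    ultimately show ?thesis using XX_intros(1) by fastforce
  qed
  show ?case
    using XX_eq[OF d_step[OF uC, of b c], of ?k] XX_intros(1)[OF 1 XX_intros(3)[OF 2, of "of_nat c - of_nat b"]]
    by simp
qed

lemma d_low': assumes "set ls \<subseteq> {..<n}" "e \<in> E" "b \<ge> n" shows "d b (wd ls e) \<in> XX (Suc (wt ls))"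
proof -
  have "smul (m b) (wd ls e) \<in> XX (Suc (wt ls))" using assms by (intro XX_intros wd_XX) auto
  moreover have "d b (wd ls e) - smul (m b) (wd ls e) \<in> XX (Suc (wt ls))"
    using d_low[OF assms] XX_mono[of "Suc (wt ls) - sg b" "Suc (wt ls)"] by auto
  ultimately show ?thesis using XX_intros(1) by fastforce
qed

text \<open>The commutator is a multiple of \<open>d (a + b - 1)\<close>. If this index is below
  \<open>n\<close>, its weight is smaller than \<open>om a + om b\<close>; otherwise the field does
  not raise the weight at all.\<close>

lemma wd_swap: assumes "set ls \<subseteq> {..<n}" "e \<in> E" "a < n" "b < n"
  shows "wd (a # b # ls) e - wd (b # a # ls) e \<in> XX (wt (a # b # ls))"
proof -
  let ?u = "wd ls e"
  have "d (a + b - 1) ?u \<in> XX (wt (a # b # ls))"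
  proof (cases "a + b - 1 < n")
    case True
    have "d (a + b - 1) ?u \<in> XX (Suc (wt ls) + om (a + b - 1))"
      using assms True by (intro d_XX wd_XX) auto
    moreover have "Suc (om (a + b - 1)) \<le> om a + om b"
    proof (cases "b = 0")
      case True
      then show ?thesis using om_anti[of 0 "a + b - 1"] om_pos[OF assms(3)] by simp
    next
      case False
      then have "a \<le> a + b - 1" by linarith
      from om_anti[OF this] show ?thesis using om_pos[OF assms(4)] by simp
    qed
    ultimately show ?thesis by (auto elim!: subsetD[OF XX_mono, rotated])
  next
    case False
    then have "d (a + b - 1) ?u \<in> XX (Suc (wt ls))" using assms by (intro d_low') auto
    then show ?thesis using om_pos[OF assms(3)] by (auto elim!: subsetD[OF XX_mono, rotated])
  qed
  then have *: "smul (of_nat b - of_nat a) (d (a + b - 1) ?u) \<in> XX (wt (a # b # ls))" by (rule XX_intros)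
  have "wd (a # b # ls) e - wd (b # a # ls) e \<approx>
      (d b (d a ?u) + smul (of_nat b - of_nat a) (d (a + b - 1) ?u)) - d b (d a ?u)"
    unfolding wd_simps using assms E_C by (intro eqS_diff eqS_refl d_commute wd_C) auto
  then show ?thesis using * by (subst XX_eq) auto
qed

lemma wd_shift:
  assumes "p - r \<in> XX k" "a < n" shows "d a p - d a r \<in> XX (om a + k)"
  using d_XX[OF assms(2,1)] by (simp add: lin_diff[OF lin_d] add.commute)

lemma wd_bubble: assumes "set ls \<subseteq> {..<n}" "set ks \<subseteq> {..<n}" "e \<in> E" "a < n"
  shows "wd (ks @ a # ls) e - wd (a # ks @ ls) e \<in> XX (wt (a # ks @ ls))"
  using assms(2)
proof (induction ks)
  case Nil
  then show ?case by (simp add: pm.subspace_0[OF sub_XX])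
next
  case (Cons b ks)
  have "d b (wd (ks @ a # ls) e) - d b (wd (a # ks @ ls) e) \<in> XX (om b + wt (a # ks @ ls))"
    using Cons by (intro wd_shift) auto
  moreover have "wd (b # a # ks @ ls) e - wd (a # b # ks @ ls) e \<in> XX (wt (b # a # ks @ ls))"
    using Cons assms by (intro wd_swap) auto
  ultimately show ?case using XX_intros(1) by (fastforce simp: algebra_simps)
qed

text \<open>The fields of index below \<open>n\<close> thus commute on leading forms, which can
  therefore be indexed by multisets.\<close>

lemma wd_mset: assumes "mset ls = mset ks" "set ls \<subseteq> {..<n}" "e \<in> E"
  shows "wd ls e - wd ks e \<in> XX (wt ls)"
  using assms(1,2)
proof (induction ls arbitrary: ks)
  case Nil
  then show ?case by (simp add: pm.subspace_0[OF sub_XX])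
next
  case (Cons a ls)
  have "a \<in> set ks" using Cons.prems(1) by (metis list.set_intros(1) set_mset_mset)
  then obtain k1 k2 where ks: "ks = k1 @ a # k2" by (auto simp: in_set_conv_decomp)
  have ms: "mset ls = mset (k1 @ k2)" using Cons.prems(1) by (simp add: ks)
  have set: "set (k1 @ k2) \<subseteq> {..<n}" using Cons.prems(2) mset_eq_setD[OF ms] by auto
  have wt: "wt ls = wt (k1 @ k2)"
    using arg_cong[OF ms, of "\<lambda>M. sum_mset (image_mset om M)"] by (simp add: wt_def sum_mset_sum_list flip: mset_map)
  have "d a (wd ls e) - d a (wd (k1 @ k2) e) \<in> XX (om a + wt ls)"
    using Cons.prems by (intro wd_shift Cons.IH ms) auto
  moreover have "wd (k1 @ a # k2) e - wd (a # k1 @ k2) e \<in> XX (wt (a # k1 @ k2))"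
    using set Cons.prems assms(3) by (intro wd_bubble) auto
  ultimately show ?case using XX_intros(2) wt by (fastforce simp: ks algebra_simps)
qed

text \<open>On leading forms \<open>d b\<close> minus its scalar is \<open>(a - b) * m q\<close>
  times the partial derivative in \<open>d a\<close>. Passing a letter \<open>c = a\<close> produces
  \<open>d q\<close>, with nonzero scalar. A letter \<open>c > a\<close> leads to an index above
  \<open>q\<close>, where the character vanishes. A letter \<open>c < a\<close> has larger weight
  than \<open>a\<close>, so losing it leaves only lower terms.\<close>

lemma d_sharp:
  assumes "set ls \<subseteq> {..<n}" "e \<in> E" "a < n" "n \<ge> 2" and b: "b = q + 1 - a"
  shows "d b (wd ls e) - smul (m b) (wd ls e) -
      smul (of_nat (count_list ls a) * ((of_nat a - of_nat b) * m q)) (wd (remove1 a ls) e) \<in> XX (wt ls - om a)"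
  using assms(1)
proof (induction ls)
  case Nil
  have "b \<ge> n" using b q_n assms(3) by (auto split: if_splits)
  then show ?case using d_E[OF assms(2), of b] S_XX by (auto simp: eqm_def)
next
  case (Cons c ls)
  let ?\<kappa> = "(of_nat a - of_nat b) * m q"
  let ?u = "wd ls e" and ?k = "om c + wt ls - om a"
  have bn: "b \<ge> n" and qa: "q \<ge> a" using b q_n assms(3,4) by (auto split: if_splits)
  have sg: "sg b = om a" using qa by (simp add: b)
  have c: "c < n" and ls: "set ls \<subseteq> {..<n}" using Cons by auto
  have uC: "?u \<in> C" using assms(2) E_C wd_C by auto
  have u: "?u \<in> XX (Suc (wt ls))" using ls assms(2) by (intro wd_XX) auto
  let ?r = "d b ?u - smul (m b) ?u - smul (of_nat (count_list ls a) * ?\<kappa>) (wd (remove1 a ls) e)"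
  have 1: "d c ?r \<in> XX ?k"
  proof (cases "wt ls \<le> om a")
    case True
    then have "?r \<in> S" using Cons.IH[OF ls] XX_0 by simp
    then show ?thesis using d_S S_XX by auto
  next
    case False
    then show ?thesis using d_XX[OF c Cons.IH[OF ls]] by (auto simp: algebra_simps)
  qed
  \<comment> \<open>The only contribution of the commutator to the leading form: its index is
    \<open>q\<close> exactly for \<open>c = a\<close>.\<close>
  let ?x = "if c = a then smul (m q) ?u else 0"
  have 2: "d (b + c - 1) ?u - ?x \<in> XX ?k"
  proof (cases "b + c - 1 < n")
    case True
    then have bc: "b = n" "c = 0" using bn n1 by auto
    \<comment> \<open>Here \<open>a = n - 1\<close> has weight 1, and \<open>om 0 \<ge> 3\<close>
      leaves room for the letter \<open>n - 1\<close> that replaces the letter 0.\<close>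
    then have q: "q = 2 * n - 2" "a = n - 1" using q_cases b assms(3,4) by auto
    have "d (n - 1) ?u \<in> XX (Suc (wt ls) + om (n - 1))" using n1 by (intro d_XX u) auto
    moreover have "om (n - 1) = 1" "om 0 \<ge> 3" using n1 assms(4) by (simp_all add: om_def)
    moreover have "c \<noteq> a" using bc q assms(4) by auto
    ultimately show ?thesis using bc q by (auto elim!: subsetD[OF XX_mono, rotated])
  next
    case False
    have "d (b + c - 1) ?u - smul (m (b + c - 1)) ?u \<in> XX (Suc (wt ls) - sg (b + c - 1))"
      using False by (intro d_low ls assms(2)) auto
    moreover have "Suc (wt ls) - sg (b + c - 1) \<le> ?k"
    proof (cases "c = 0")
      case c0: True
      show ?thesis
      proof (cases "a = 0")
        case True
        \<comment> \<open>For \<open>a = c = 0\<close> the commutator is a multiple of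
          \<open>d q\<close>, which differs from its scalar by terms lower by \<open>om 1\<close>.
          For \<open>n = 1\<close> this would be 0, which is why that case gets its own
          computation.\<close>
        then have "sg (b + c - 1) = om 1" using c0 b by simp
        moreover have "om 1 \<ge> 1" using assms(4) by (intro om_pos) auto
        ultimately show ?thesis using True c0 by auto
      next
        case False
        then show ?thesis using om_strict[of 0 a] n1 c0 by auto
      qed
    next
      case False
      then have "q + 1 - (b + c - 1) \<le> q + 1 - b" by linarith
      from om_anti[OF this] show ?thesis using om_pos[OF c] sg by simp
    qed
    ultimately have 3: "d (b + c - 1) ?u - smul (m (b + c - 1)) ?u \<in> XX ?k" using XX_mono by blast
    have "smul (m (b + c - 1)) ?u - ?x \<in> XX ?k"
    proof (cases c a rule: linorder_cases)
      case equal
      then show ?thesis using qa b by (simp add: pm.subspace_0[OF sub_XX])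
    next
      case greater
      then have "b + c - 1 > q" using b qa by auto
      then show ?thesis using greater by (simp add: m_0 pm.subspace_0[OF sub_XX])
    next
      case less
      then have "?u \<in> XX ?k" using u om_strict[OF less c] by (auto elim!: subsetD[OF XX_mono, rotated])
      then show ?thesis using less by (simp add: XX_intros)
    qed
    from XX_intros(1)[OF 3 this] show ?thesis by simp
  qed
  let ?y = "smul (of_nat (count_list ls a) * ?\<kappa>) (wd (c # remove1 a ls) e) + smul (of_nat c - of_nat b) ?x"
  have 3: "?y - smul (of_nat (count_list (c # ls) a) * ?\<kappa>) (wd (remove1 a (c # ls)) e) \<in> XX ?k"
  proof (cases "c = a")
    case True
    have eq: "?y - smul (of_nat (count_list (c # ls) a) * ?\<kappa>) (wd (remove1 a (c # ls)) e) =
       smul (of_nat (count_list ls a) * ?\<kappa>) (wd (a # remove1 a ls) e - wd ls e)"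
      using True by (simp add: algebra_simps)
    show ?thesis
    proof (cases "a \<in> set ls")
      case T: True
      then have "mset (a # remove1 a ls) = mset ls" by simp
      moreover have "set (a # remove1 a ls) \<subseteq> {..<n}" using ls assms(3) set_remove1_subset[of a ls] by auto
      ultimately have "wd (a # remove1 a ls) e - wd ls e \<in> XX (wt (a # remove1 a ls))"
        using assms(2) by (intro wd_mset) auto
      moreover have "wt (a # remove1 a ls) = ?k"
        using T True by (simp add: wt_def sum_list_map_remove1)
      ultimately show ?thesis unfolding eq by (simp only: XX_intros)
    next
      case False
      then show ?thesis unfolding eq by (simp add: count_notin pm.subspace_0[OF sub_XX])
    qed
  next
    case False
    then show ?thesis by (simp add: pm.subspace_0[OF sub_XX])
  qed
  have "d b (wd (c # ls) e) - smul (m b) (wd (c # ls) e) -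
      smul (of_nat (count_list (c # ls) a) * ?\<kappa>) (wd (remove1 a (c # ls)) e) \<approx>
    d c (d b ?u - smul (m b) ?u) + smul (of_nat c - of_nat b) (d (b + c - 1) ?u) -
      smul (of_nat (count_list (c # ls) a) * ?\<kappa>) (wd (remove1 a (c # ls)) e)" (is "?lhs \<approx> ?rhs")
    using d_step[OF uC, of b c] by (intro eqS_diff eqS_refl) simp
  moreover have "?rhs = d c ?r + smul (of_nat c - of_nat b) (d (b + c - 1) ?u - ?x) +
      (?y - smul (of_nat (count_list (c # ls) a) * ?\<kappa>) (wd (remove1 a (c # ls)) e))"
    by (simp add: lin_diff[OF lin_d] lin_smul[OF lin_d] pm.scale_right_diff_distrib)
  ultimately have "?lhs \<in> XX ?k \<longleftrightarrow> d c ?r + smul (of_nat c - of_nat b) (d (b + c - 1) ?u - ?x) +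
      (?y - smul (of_nat (count_list (c # ls) a) * ?\<kappa>) (wd (remove1 a (c # ls)) e)) \<in> XX ?k"
    by (simp only: XX_eq)
  then show ?case using XX_intros(1)[OF XX_intros(1)[OF 1 XX_intros(3)[OF 2]] 3] by simp
qed

text \<open>Each letter costs one order of vanishing through the bracket. On the empty word order
  \<open>2 n\<close> is enough, because \<mu> vanishes there.\<close>

lemma wd_kill:
  assumes "e \<in> E" "lpt l ^ (2 * n + length ls) dvd lg v"
  shows "T v (wd ls e) \<in> S"
  using assms(2)
proof (induction ls arbitrary: v)
  case Nil
  have "T v e \<approx> smul (\<mu> v) e"
    using Nil by (intro E_char assms(1)) (auto intro: dvd_trans[OF le_imp_power_dvd[of n "2 * n"]])
  then show ?case using Nil \<mu>_vanish[of v] by (simp add: eqS_0)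
next
  case (Cons a ls)
  let ?u = "wd ls e"
  have uC: "?u \<in> C" using assms(1) E_C wd_C by auto
  have "lpt l ^ (2 * n + length ls) dvd lg v"
    using Cons.prems by (auto intro: dvd_trans[OF le_imp_power_dvd])
  then have 1: "T (vf l a) (T v ?u) \<in> S" using Cons.IH T_S by auto
  have "lpt l ^ (2 * n + length ls) dvd lg (bracket v (vf l a))"
    unfolding lg_bracket using Cons.prems by (intro wbr_dvd_left) simp
  then have 2: "T (bracket v (vf l a)) ?u \<in> S" by (rule Cons.IH)
  have "T v (d a ?u) - T (vf l a) (T v ?u) \<in> S"
    using eqS_S[OF T_bracket[OF uC, of v "vf l a"]] 2 by (simp add: d_def)
  from pm.subspace_add[OF sub_S this 1] show ?case by simp
qed

lemma sub_UU: "pm.subspace UU" and S_UU: "S \<subseteq> UU" and E_UU: "E \<subseteq> UU"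
  using pm.span_base[of "wd [] e" for e] by (auto simp: UU_def intro!: pm.span_base exI[of _ "[]"])

lemma UU_XX: assumes "p \<in> UU" shows "\<exists>k. p \<in> XX k"
proof -
  have "pm.subspace {p. \<exists>k. p \<in> XX k}"
    unfolding pm.subspace_def
  proof (intro conjI allI ballI; clarsimp)
    show "\<exists>k. 0 \<in> XX k" using pm.subspace_0[OF sub_XX] by blast
    show "\<exists>k. x + y \<in> XX k" if "x \<in> XX k1" "y \<in> XX k2" for x y k1 k2
      using that XX_mono[of k1 "k1 + k2"] XX_mono[of k2 "k1 + k2"] by (intro exI[of _ "k1 + k2"] XX_intros(1)) auto
    show "\<exists>k. smul c x \<in> XX k" if "x \<in> XX k" for c x k using that XX_intros(3) by blast
  qed
  moreover have "S \<union> {wd ls e | ls e. set ls \<subseteq> {..<n} \<and> e \<in> E} \<subseteq> {p. \<exists>k. p \<in> XX k}"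
    using S_XX wd_XX by blast
  ultimately show ?thesis using pm.span_minimal assms unfolding UU_def by blast
qed

text \<open>By \<open>wd_kill\<close>, \<open>v\<close> may be replaced by a Taylor polynomial whose
  order depends on the length of the word. Its fields of index below \<open>n\<close> lengthen the
  word, and the others preserve the filtration.\<close>

lemma T_UU: assumes "p \<in> UU" shows "T v p \<in> UU"
proof (rule lin_span_image[OF T_lin sub_UU assms[unfolded UU_def]])
  fix a assume "a \<in> S \<union> {wd ls e | ls e. set ls \<subseteq> {..<n} \<and> e \<in> E}"
  then consider "a \<in> S" | ls e where "a = wd ls e" "set ls \<subseteq> {..<n}" "e \<in> E" by blast
  then show "T v a \<in> UU"
  proof cases
    case 1
    then show ?thesis using T_S S_UU by auto
  next
    case 2
    have aC: "a \<in> C" using 2 E_C wd_C by auto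
    let ?N = "2 * n + length ls"
    obtain \<alpha> where \<alpha>: "lpt l ^ ?N dvd lg v - (\<Sum>b<?N. smul (\<alpha> b) (lg (vf l b)))" using taylor[OF l0] by blast
    let ?w = "\<Sum>b<?N. smul (\<alpha> b) (vf l b)"
    have "T (v - ?w) a \<in> S"
      unfolding 2 using \<alpha> by (intro wd_kill 2) (simp add: lin_diff[OF lin_lg] lin_sum[OF lin_lg] lin_smul[OF lin_lg])
    then have "T v a - T ?w a \<in> S" using eqS_S[OF T_minus[OF aC, of v ?w]] by simp
    moreover have "T (\<Sum>b\<in>B. smul (\<alpha> b) (vf l b)) a \<approx> (\<Sum>b\<in>B. smul (\<alpha> b) (d b a))" if "finite B" for B
      using that
    proof (induction B rule: finite_induct)
      case empty
      show ?case using T_scale[OF aC, of 0 0] by simp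
    next
      case (insert b B)
      have "T (smul (\<alpha> b) (vf l b) + (\<Sum>b\<in>B. smul (\<alpha> b) (vf l b))) a \<approx>
          T (smul (\<alpha> b) (vf l b)) a + T (\<Sum>b\<in>B. smul (\<alpha> b) (vf l b)) a"
        by (rule T_plus[OF aC])
      also have "\<dots> \<approx> smul (\<alpha> b) (d b a) + (\<Sum>b\<in>B. smul (\<alpha> b) (d b a))"
        unfolding d_def using insert by (intro eqS_add T_scale aC) (simp add: d_def)
      finally show ?case using insert by simp
    qed
    moreover have "d b a \<in> UU" for b
    proof (cases "b < n")
      case True
      then have "wd (b # ls) e \<in> UU" using 2 unfolding UU_def
        by (intro pm.span_base UnI2 CollectI exI[of _ "b # ls"] exI[of _ e]) auto
      then show ?thesis using 2 by simp
    next
      case False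
      then show ?thesis using d_low'[OF 2(2,3), of b] XX_UU 2 by auto
    qed
    then have "(\<Sum>b<?N. smul (\<alpha> b) (d b a)) \<in> UU"
      by (intro pm.subspace_sum[OF sub_UU] pm.subspace_scale[OF sub_UU])
    ultimately show ?thesis
      using eqS_mem[OF _ S_UU sub_UU] by (metis finite_lessThan eqm_def)
  qed
qed

text \<open>For \<open>n = 1\<close> the words are powers of \<open>d 0\<close>, and the factors
  follow by recursion on \<open>j\<close> from \<open>[d b, d 0] = - b d (b - 1)\<close>. The
  exponents \<open>j - 1\<close> and \<open>j - 2\<close> are truncated only where the factor is
  zero.\<close>

lemma simple_root:
  assumes "n = 1" "e \<in> E"
  shows "d 1 (wd (replicate j 0) e) \<approx> smul (m 1 - of_nat j) (wd (replicate j 0) e)"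
    and "d 2 (wd (replicate j 0) e) \<approx> smul (- of_nat j * (2 * m 1 - of_nat j + 1)) (wd (replicate (j - 1) 0) e)"
    and "d 3 (wd (replicate j 0) e) \<approx>
      smul (of_nat j * (of_nat j - 1) * (3 * m 1 - of_nat j + 2)) (wd (replicate (j - 2) 0) e)"
proof -
  have q: "q = 1" using q_cases assms(1) by auto
  have step: "d b (d 0 p) \<approx> d 0 (smul x r) + smul (- of_nat b) (smul y r')"
    if "p \<in> C" "d b p \<approx> smul x r" "d (b - 1) p \<approx> smul y r'" for b p x y r r'
  proof -
    have "d b (d 0 p) \<approx> d 0 (d b p) + smul (- of_nat b) (d (b - 1) p)"
      using d_commute[OF that(1), of b 0] by simp
    also have "\<dots> \<approx> d 0 (smul x r) + smul (- of_nat b) (smul y r')"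
      by (intro eqS_add eqS_smul eqS_d that)
    finally show ?thesis .
  qed
  have C: "wd ls e \<in> C" for ls using assms(2) E_C wd_C by auto
  have base: "d b e \<approx> smul (m b) e" if "b \<ge> 1" for b using d_E assms that by auto
  show 1: "d 1 (wd (replicate j 0) e) \<approx> smul (m 1 - of_nat j) (wd (replicate j 0) e)" for j
  proof (induction j)
    case (Suc j)
    have "d 1 (d 0 (wd (replicate j 0) e)) \<approx> d 0 (smul (m 1 - of_nat j) (wd (replicate j 0) e)) +
        smul (- of_nat 1) (smul 1 (d 0 (wd (replicate j 0) e)))"
      by (rule step[OF C Suc]) simp
    moreover have "smul (m 1 - of_nat (Suc j)) p = smul (m 1 - of_nat j) p + smul (- of_nat 1) (smul 1 p)"
      for p :: "'b \<Rightarrow>\<^sub>0 complex"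
      by (simp add: pm.scale_left_diff_distrib pm.scale_left_distrib)
    ultimately show ?case by (simp add: lin_smul[OF lin_d])
  qed (use base[of 1] in simp)
  show 2: "d 2 (wd (replicate j 0) e) \<approx> smul (- of_nat j * (2 * m 1 - of_nat j + 1)) (wd (replicate (j - 1) 0) e)" for j
  proof (induction j)
    case (Suc j)
    have r: "of_nat j * (2 * m 1 - of_nat j + 1) = 0 \<or> d 0 (wd (replicate (j - 1) 0) e) = wd (replicate j 0) e"
      by (cases j) auto
    have "d 2 (d 0 (wd (replicate j 0) e)) \<approx>
        d 0 (smul (- of_nat j * (2 * m 1 - of_nat j + 1)) (wd (replicate (j - 1) 0) e)) +
        smul (- of_nat 2) (smul (m 1 - of_nat j) (wd (replicate j 0) e))"
      by (rule step[OF C Suc]) (use 1[of j] in simp)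
    also have "\<dots> = smul (- of_nat j * (2 * m 1 - of_nat j + 1)) (wd (replicate j 0) e) +
        smul (- of_nat 2) (smul (m 1 - of_nat j) (wd (replicate j 0) e))"
      using r by (auto simp: lin_smul[OF lin_d] lin_minus[OF lin_d] lin_0[OF lin_d])
    also have "\<dots> = smul (- of_nat (Suc j) * (2 * m 1 - of_nat (Suc j) + 1)) (wd (replicate j 0) e)"
      by (simp add: algebra_simps flip: pm.scale_left_distrib pm.scale_left_diff_distrib)
    finally show ?case by simp
  qed (use base[of 2] m_0[of 2] q in simp)
  show "d 3 (wd (replicate j 0) e) \<approx>
      smul (of_nat j * (of_nat j - 1) * (3 * m 1 - of_nat j + 2)) (wd (replicate (j - 2) 0) e)"
  proof (induction j)
    case (Suc j)
    have r: "of_nat j * (of_nat j - 1) = (0::complex) \<or> d 0 (wd (replicate (j - 2) 0) e) = wd (replicate (j - 1) 0) e"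
      by (cases j; cases "j - 1") auto
    have "d 3 (d 0 (wd (replicate j 0) e)) \<approx>
        d 0 (smul (of_nat j * (of_nat j - 1) * (3 * m 1 - of_nat j + 2)) (wd (replicate (j - 2) 0) e)) +
        smul (- of_nat 3) (smul (- of_nat j * (2 * m 1 - of_nat j + 1)) (wd (replicate (j - 1) 0) e))"
      by (rule step[OF C Suc]) (use 2[of j] in simp)
    also have "\<dots> = smul (of_nat j * (of_nat j - 1) * (3 * m 1 - of_nat j + 2)) (wd (replicate (j - 1) 0) e) +
        smul (- of_nat 3) (smul (- of_nat j * (2 * m 1 - of_nat j + 1)) (wd (replicate (j - 1) 0) e))"
      using r by (auto simp: lin_smul[OF lin_d] lin_minus[OF lin_d] lin_0[OF lin_d])
    also have "\<dots> = smul (of_nat (Suc j) * (of_nat (Suc j) - 1) * (3 * m 1 - of_nat (Suc j) + 2)) (wd (replicate (j - 1) 0) e)"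
      by (simp add: algebra_simps flip: pm.scale_left_distrib pm.scale_left_diff_distrib)
    finally show ?case by simp
  qed (use base[of 3] m_0[of 3] q in simp)
qed

section \<open>Leading forms\<close>

definition wtm :: "nat multiset \<Rightarrow> nat" where "wtm M = sum_mset (image_mset om M)"
definition wdm :: "nat multiset \<Rightarrow> ('b \<Rightarrow>\<^sub>0 complex) \<Rightarrow> ('b \<Rightarrow>\<^sub>0 complex)" where
  "wdm M = wd (sorted_list_of_multiset M)"

lemma wt_mset: "wt ls = wtm (mset ls)"
  by (simp add: wt_def wtm_def sum_mset_sum_list flip: mset_map)

lemma wdm_mset: "set ls \<subseteq> {..<n} \<Longrightarrow> e \<in> E \<Longrightarrow> wd ls e - wdm (mset ls) e \<in> XX (wt ls)"
  unfolding wdm_def by (rule wd_mset) auto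

text \<open>An element of weight at most \<open>k\<close> has a leading form of weight \<open>k\<close>, with coefficients in \<open>E\<close>.\<close>

definition lead :: "nat \<Rightarrow> (nat multiset \<Rightarrow> ('b \<Rightarrow>\<^sub>0 complex)) \<Rightarrow> nat multiset set \<Rightarrow> ('b \<Rightarrow>\<^sub>0 complex) \<Rightarrow> bool" where
  "lead k g F p \<longleftrightarrow> finite F \<and> (\<forall>M\<in>F. set_mset M \<subseteq> {..<n} \<and> wtm M = k) \<and> (\<forall>M. g M \<in> E) \<and>
     p - (\<Sum>M\<in>F. wdm M (g M)) \<in> XX k"

text \<open>Words with the same letters agree modulo lower weight, so their vectors from
  \<open>E\<close> can be added up. No uniqueness is claimed.\<close>

lemma lead_exists:
  assumes "p \<in> XX (Suc k)" shows "\<exists>g F. lead k g F p"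
proof -
  have E0: "0 \<in> E" using pm.subspace_0[OF sub_E] .
  have sub: "pm.subspace {p. \<exists>g F. lead k g F p}"
    unfolding pm.subspace_def
  proof (intro conjI allI ballI; clarsimp)
    show "\<exists>g F. lead k g F 0"
      using E0 by (intro exI[of _ "\<lambda>_. 0"] exI[of _ "{}"]) (simp add: lead_def pm.subspace_0[OF sub_XX])
    show "\<exists>g F. lead k g F (smul c p)" if "lead k g F p" for c p g F
      using that XX_intros(3)[of "p - (\<Sum>M\<in>F. wdm M (g M))" k c]
      by (intro exI[of _ "\<lambda>M. smul c (g M)"] exI[of _ F])
         (auto simp: lead_def pm.subspace_scale[OF sub_E] wdm_def lin_smul[OF lin_wd] pm.scale_right_diff_distrib
            pm.scale_sum_right)
    show "\<exists>g F. lead k g F (p + r)" if p: "lead k g F p" and r: "lead k g' F' r" for p r g F g' F'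
    proof -
      define h where "h M = (if M \<in> F then g M else 0) + (if M \<in> F' then g' M else 0)" for M
      have fin: "finite F" "finite F'" using p r by (auto simp: lead_def)
      have "(\<Sum>M\<in>F \<union> F'. wdm M (h M)) =
          (\<Sum>M\<in>F \<union> F'. if M \<in> F then wdm M (g M) else 0) + (\<Sum>M\<in>F \<union> F'. if M \<in> F' then wdm M (g' M) else 0)"
        unfolding sum.distrib[symmetric] h_def wdm_def
        by (intro sum.cong) (auto simp: lin_add[OF lin_wd] lin_0[OF lin_wd])
      also have "(\<Sum>M\<in>F \<union> F'. if M \<in> F then wdm M (g M) else 0) = (\<Sum>M\<in>F. wdm M (g M))"
        using fin by (intro sum.mono_neutral_cong_right) auto
      also have "(\<Sum>M\<in>F \<union> F'. if M \<in> F' then wdm M (g' M) else 0) = (\<Sum>M\<in>F'. wdm M (g' M))"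
        using fin by (intro sum.mono_neutral_cong_right) auto
      finally have "p + r - (\<Sum>M\<in>F \<union> F'. wdm M (h M)) =
          (p - (\<Sum>M\<in>F. wdm M (g M))) + (r - (\<Sum>M\<in>F'. wdm M (g' M)))" by simp
      then have "p + r - (\<Sum>M\<in>F \<union> F'. wdm M (h M)) \<in> XX k"
        using p r XX_intros(1)[of "p - (\<Sum>M\<in>F. wdm M (g M))" k "r - (\<Sum>M\<in>F'. wdm M (g' M))"]
        by (simp only: lead_def)
      moreover have "h M \<in> E" for M
        using p r E0 pm.subspace_add[OF sub_E] by (auto simp: h_def lead_def)
      ultimately have "lead k h (F \<union> F') (p + r)" using p r by (auto simp: lead_def)
      then show ?thesis by blast
    qed
  qed
  have "S \<union> {wd ls e | ls e. set ls \<subseteq> {..<n} \<and> e \<in> E \<and> wt ls < Suc k} \<subseteq> {p. \<exists>g F. lead k g F p}"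
  proof
    fix a assume "a \<in> S \<union> {wd ls e | ls e. set ls \<subseteq> {..<n} \<and> e \<in> E \<and> wt ls < Suc k}"
    then consider "a \<in> XX k" | ls e where "a = wd ls e" "set ls \<subseteq> {..<n}" "e \<in> E" "wt ls = k"
      using S_XX wd_XX less_Suc_eq by fastforce
    then have "\<exists>g F. lead k g F a"
    proof cases
      case 1
      then show ?thesis using E0 by (intro exI[of _ "\<lambda>_. 0"] exI[of _ "{}"]) (simp add: lead_def)
    next
      case 2
      then show ?thesis using wdm_mset[OF 2(2,3)]
        by (intro exI[of _ "\<lambda>_. e"] exI[of _ "{mset ls}"]) (simp add: lead_def wt_mset)
    qed
    then show "a \<in> {p. \<exists>g F. lead k g F p}" by blast
  qed
  from pm.span_minimal[OF this sub] assms show ?thesis unfolding XX_def by blast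
qed

text \<open>Removing one letter \<open>a\<close> is injective on the multisets that contain it, so
  the derivative in \<open>d a\<close> cannot merge coefficients: the new coefficient at
  \<open>M0 - {#a#}\<close> is a nonzero multiple of \<open>g M0\<close>.\<close>

lemma lead_lower:
  assumes "n \<ge> 2" "lead k g F p" "M0 \<in> F" "g M0 \<notin> S" "a \<in># M0"
  defines "b \<equiv> q + 1 - a"
  shows "\<exists>g' F'. lead (k - om a) g' F' (d b p - smul (m b) p) \<and> (\<exists>M\<in>F'. g' M \<notin> S) \<and> k - om a < k"
proof -
  let ?\<kappa> = "(of_nat a - of_nat b) * m q"
  let ?f = "\<lambda>p. d b p - smul (m b) p"
  let ?k = "k - om a"
  have F: "finite F" "\<And>M. M \<in> F \<Longrightarrow> set_mset M \<subseteq> {..<n}" "\<And>M. M \<in> F \<Longrightarrow> wtm M = k" "\<And>M. g M \<in> E"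
    and lead: "p - (\<Sum>M\<in>F. wdm M (g M)) \<in> XX k"
    using assms(2) by (auto simp: lead_def)
  have an: "a < n" using F(2)[OF assms(3)] assms(5) by auto
  have "q \<ge> a" and bn: "b \<ge> n" using q_n an assms(1) by (auto simp: b_def split: if_splits)
  then have sg: "sg b = om a" and ab: "a \<noteq> b" using an by (auto simp: b_def)
  have lin: "lin ?f" by (intro lin_subtract lin_d lin_scale lin_id)
  have kap: "?\<kappa> \<noteq> 0" using ab m_q by simp
  have ka: "k \<ge> om a"
  proof -
    obtain M1 where "M0 = add_mset a M1" using assms(5) by (metis insert_DiffM)
    then show ?thesis using F(3)[OF assms(3)] by (simp add: wtm_def)
  qed
  have 1: "?f (p - (\<Sum>M\<in>F. wdm M (g M))) \<in> XX ?k"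
  proof (rule XX_induct[OF lead lin sub_XX])
    show "?f s \<in> XX ?k" if "s \<in> S" for s
      using that d_S S_XX pm.subspace_diff[OF sub_S] pm.subspace_scale[OF sub_S] by blast
    fix ls e assume "set ls \<subseteq> {..<n}" "e \<in> E" "wt ls < k"
    moreover from this have "Suc (wt ls) - sg b \<le> ?k" unfolding sg by (simp add: diff_le_mono Suc_leI)
    ultimately show "?f (wd ls e) \<in> XX ?k"
      using d_low[of ls e b] bn XX_mono[of "Suc (wt ls) - sg b" ?k] by auto
  qed
  define F' where "F' = (\<lambda>M. M - {#a#}) ` {M \<in> F. a \<in># M}"
  define g' where "g' M = smul (of_nat (Suc (count M a)) * ?\<kappa>) (g (add_mset a M))" for M
  have 2: "?f (wdm M (g M)) - (if a \<in># M then wdm (M - {#a#}) (g' (M - {#a#})) else 0) \<in> XX ?k" if M: "M \<in> F" for M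
  proof -
    let ?l = "sorted_list_of_multiset M"
    have sl: "set ?l \<subseteq> {..<n}" using F(2)[OF M] by simp
    have wl: "wt ?l = k" using F(3)[OF M] by (simp add: wt_mset)
    have cnt: "count_list ?l a = count M a" by (simp flip: count_mset)
    note sharp = d_sharp[OF sl F(4)[of M] an assms(1) b_def[THEN meta_eq_to_obj_eq], unfolded wl cnt]
    show ?thesis
    proof (cases "a \<in># M")
      case True
      then have M': "add_mset a (M - {#a#}) = M" by simp
      have "wd (remove1 a ?l) (g M) - wdm (mset (remove1 a ?l)) (g M) \<in> XX (wt (remove1 a ?l))"
        using set_remove1_subset[of a ?l] sl F(4) by (intro wdm_mset) auto
      moreover have "wt (remove1 a ?l) = ?k"
        using True wl by (simp add: wt_def sum_list_map_remove1)
      ultimately have "wd (remove1 a ?l) (g M) - wdm (M - {#a#}) (g M) \<in> XX ?k" by simp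
      then have "smul (of_nat (count M a) * ?\<kappa>) (wd (remove1 a ?l) (g M) - wdm (M - {#a#}) (g M)) \<in> XX ?k"
        by (rule XX_intros(3))
      from XX_intros(1)[OF sharp this]
      have "?f (wd ?l (g M)) - smul (of_nat (count M a) * ?\<kappa>) (wdm (M - {#a#}) (g M)) \<in> XX ?k"
        by (simp add: pm.scale_right_diff_distrib)
      moreover have "wdm (M - {#a#}) (g' (M - {#a#})) = smul (of_nat (count M a) * ?\<kappa>) (wdm (M - {#a#}) (g M))"
      proof -
        have "Suc (count (M - {#a#}) a) = count M a" using True by simp
        then show ?thesis unfolding g'_def M' by (simp only: wdm_def lin_smul[OF lin_wd])
      qed
      ultimately show ?thesis using True by (simp add: wdm_def)
    next
      case False
      then have "count M a = 0" by (simp add: not_in_iff)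
      then show ?thesis using sharp False by (simp add: wdm_def)
    qed
  qed
  have "inj_on (\<lambda>M. M - {#a#}) {M \<in> F. a \<in># M}"
    by (rule inj_onI) (metis (no_types, lifting) insert_DiffM mem_Collect_eq)
  then have "(\<Sum>M\<in>F'. wdm M (g' M)) = (\<Sum>M | M \<in> F \<and> a \<in># M. wdm (M - {#a#}) (g' (M - {#a#})))"
    unfolding F'_def by (simp add: sum.reindex)
  also have "\<dots> = (\<Sum>M\<in>F. if a \<in># M then wdm (M - {#a#}) (g' (M - {#a#})) else 0)"
    using F(1) by (simp add: sum.inter_filter)
  finally have "?f p - (\<Sum>M\<in>F'. wdm M (g' M)) = ?f (p - (\<Sum>M\<in>F. wdm M (g M))) +
      (\<Sum>M\<in>F. ?f (wdm M (g M)) - (if a \<in># M then wdm (M - {#a#}) (g' (M - {#a#})) else 0))"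
    unfolding lin_diff[OF lin] lin_sum[OF lin] sum_subtractf by simp
  also have "\<dots> \<in> XX ?k"
    using 2 by (intro XX_intros(1)[OF 1] pm.subspace_sum[OF sub_XX])
  finally have "?f p - (\<Sum>M\<in>F'. wdm M (g' M)) \<in> XX ?k" .
  moreover have "wtm (M - {#a#}) = ?k" if "M \<in> F" "a \<in># M" for M
    using F(3)[OF that(1)] that(2) by (metis add_diff_cancel_left' image_mset_add_mset insert_DiffM sum_mset.add_mset wtm_def)
  moreover have "set_mset (M - {#a#}) \<subseteq> {..<n}" if "M \<in> F" for M
    using F(2)[OF that] by (auto dest: in_diffD)
  ultimately have "lead ?k g' F' (?f p)"
    using F(1,4) by (auto simp: lead_def F'_def g'_def pm.subspace_scale[OF sub_E])
  moreover have "\<exists>M\<in>F'. g' M \<notin> S"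
  proof (rule bexI)
    let ?c = "of_nat (Suc (count (M0 - {#a#}) a)) * ?\<kappa>"
    have c: "?c \<noteq> 0" using kap by (metis mult_eq_0_iff of_nat_eq_0_iff nat.simps(3))
    have "g' (M0 - {#a#}) = smul ?c (g M0)" using assms(5) by (simp add: g'_def)
    moreover have "smul (inverse ?c) (smul ?c (g M0)) = g M0" by (rule smul_inverse[OF c])
    ultimately show "g' (M0 - {#a#}) \<notin> S" using assms(4) pm.subspace_scale[OF sub_S] by metis
    show "M0 - {#a#} \<in> F'" using assms(3,5) by (auto simp: F'_def)
  qed
  ultimately show ?thesis using ka om_pos[OF an] by (intro exI[of _ g'] exI[of _ F']) auto
qed

text \<open>Among the elements of \<open>W\<close> having a leading form with some coefficient
  outside \<open>S\<close>, one of least weight is chosen. Positive weight would allow another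
  lowering step, and a leading form of weight 0 is a vector of \<open>E\<close>. Nontriviality is
  asked of the coefficients, since that is what survives lowering.\<close>

theorem lowering:
  assumes W: "pm.subspace W" "S \<subseteq> W" "\<And>v p. p \<in> W \<Longrightarrow> T v p \<in> W"
    and w: "w \<in> W" "w \<in> UU" "w \<notin> S"
  shows "\<exists>e. e \<in> E \<and> e \<in> W \<and> e \<notin> S"
proof -
  define good where "good k \<longleftrightarrow> (\<exists>g F p. p \<in> W \<and> lead k g F p \<and> (\<exists>M\<in>F. g M \<notin> S))" for k
  have ex: "\<exists>k. good k"
  proof -
    obtain k0 where "w \<in> XX k0" using UU_XX[OF w(2)] by blast
    define k where "k = (LEAST k. w \<in> XX k)"
    have k: "w \<in> XX k" unfolding k_def by (rule LeastI) fact
    have "k \<noteq> 0" using k w(3) XX_0 by metis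
    then obtain k' where k': "k = Suc k'" by (cases k) auto
    have nk: "w \<notin> XX k'" using not_less_Least[of k' "\<lambda>k. w \<in> XX k"] k' by (simp add: k_def)
    obtain g F where l: "lead k' g F w" using lead_exists k k' by blast
    have "\<exists>M\<in>F. g M \<notin> S"
    proof (rule ccontr)
      assume "\<not> (\<exists>M\<in>F. g M \<notin> S)"
      then have "(\<Sum>M\<in>F. wdm M (g M)) \<in> XX k'"
        using S_XX wd_S unfolding wdm_def by (intro pm.subspace_sum[OF sub_XX]) blast
      moreover have "w - (\<Sum>M\<in>F. wdm M (g M)) \<in> XX k'" using l by (simp only: lead_def)
      ultimately have "(w - (\<Sum>M\<in>F. wdm M (g M))) + (\<Sum>M\<in>F. wdm M (g M)) \<in> XX k'" by (intro XX_intros(1))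
      then show False using nk by simp
    qed
    then show ?thesis using l w(1) unfolding good_def by blast
  qed
  define k where "k = (LEAST k. good k)"
  have gk: "good k" unfolding k_def by (rule LeastI_ex[OF ex])
  have least: "\<not> good k'" if "k' < k" for k' using that not_less_Least unfolding k_def by blast
  obtain g F p M0 where p: "p \<in> W" "lead k g F p" "M0 \<in> F" "g M0 \<notin> S" using gk by (auto simp: good_def)
  have dW: "smul c p \<in> W" "d b p \<in> W" if "p \<in> W" for b c p
    using that W pm.subspace_scale[OF W(1)] by (auto simp: d_def)
  have "k = 0"
  proof (rule ccontr)
    assume "k \<noteq> 0"
    have M0: "set_mset M0 \<subseteq> {..<n}" "wtm M0 = k" using p by (auto simp: lead_def)
    then obtain a where a: "a \<in># M0" using \<open>k \<noteq> 0\<close> by (cases M0) (auto simp: wtm_def)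
    show False
    proof (cases "n \<ge> 2")
      case True
      from lead_lower[OF True p(2-4) a] obtain g' F' where
        "lead (k - om a) g' F' (d (q + 1 - a) p - smul (m (q + 1 - a)) p)" "\<exists>M\<in>F'. g' M \<notin> S" "k - om a < k"
        by blast
      then have "good (k - om a)" unfolding good_def using dW p(1) pm.subspace_diff[OF W(1)] by blast
      then show False using least \<open>k - om a < k\<close> by blast
    next
      case False
      then have n: "n = 1" using n1 by simp
      then have q: "q = 1" using q_cases by auto
      have om0: "om 0 = 1" unfolding om_def by (simp add: n)
      have nn: "{..<n} = {0}" unfolding n by auto
      have rep: "M = replicate_mset k 0" if "M \<in> F" for M
      proof -
        have *: "set_mset M \<subseteq> {0}" "wtm M = k" using that p(2) by (auto simp: lead_def nn)
        then have "M = replicate_mset (size M) 0" by (metis set_mset_subset_singletonD)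
        moreover from this have "wtm M = size M" by (metis om0 wtm_def image_replicate_mset sum_mset_replicate_mset mult.right_neutral id_apply of_nat_eq_id)
        ultimately show ?thesis using * by metis
      qed
      then have F: "F = {replicate_mset k 0}" using p(3) by auto
      define e0 where "e0 = g (replicate_mset k 0)"
      have e0: "e0 \<in> E" "e0 \<notin> S" using p rep[OF p(3)] by (auto simp: e0_def lead_def)
      have lists: "ls = replicate (length ls) 0 \<and> wt ls = length ls" if "set ls \<subseteq> {..<n}" for ls
        using that om0 by (induction ls) (auto simp: nn)
      have wdm0: "wdm (replicate_mset j 0) e = wd (replicate j 0) e" for j e
      proof -
        let ?l = "sorted_list_of_multiset (replicate_mset j (0::nat))"
        have "length ?l = j" by (metis size_replicate_mset mset_sorted_list_of_multiset size_mset)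
        moreover have "set ?l \<subseteq> {..<n}" by (auto simp: nn)
        ultimately show ?thesis using lists[of ?l] by (simp add: wdm_def)
      qed
      have lead0: "p - wd (replicate k 0) e0 \<in> XX k" using p(2) by (simp add: lead_def F wdm0 e0_def)
      \<comment> \<open>The lowering step for \<open>n = 1\<close>, shared by \<open>d 2\<close>
        (with \<open>r = 1\<close>) and \<open>d 3\<close> (with \<open>r = 2\<close>). The
        assumption \<open>vanish\<close> covers the powers below \<open>r\<close>, where the
        exponent \<open>j - r\<close> is truncated.\<close>
      have lower: "good (k - r) \<and> k - r < k" if r: "1 \<le> r" "r \<le> k" and c0: "\<gamma> k \<noteq> 0"
        and f: "\<And>j e. e \<in> E \<Longrightarrow> d b (wd (replicate j 0) e) \<approx> smul (\<gamma> j) (wd (replicate (j - r) 0) e)"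
        and vanish: "\<And>j. j < r \<Longrightarrow> \<gamma> j = 0" for r b and \<gamma> :: "nat \<Rightarrow> complex"
      proof -
        have low: "d b x \<in> XX (k - r)" if "x \<in> XX k" for x
        proof (rule XX_induct[OF that lin_d sub_XX])
          show "d b s \<in> XX (k - r)" if "s \<in> S" for s using that d_S S_XX by auto
          fix ls e assume ls: "set ls \<subseteq> {..<n}" "e \<in> E" "wt ls < k"
          define j where "j = length ls"
          have j: "ls = replicate j 0" "j < k" using lists[OF ls(1)] ls(3) by (auto simp: j_def)
          have "smul (\<gamma> j) (wd (replicate (j - r) 0) e) \<in> XX (k - r)"
          proof (cases "j < r")
            case True
            then show ?thesis by (simp add: vanish pm.subspace_0[OF sub_XX])
          next
            case False
            have "wt (replicate (j - r) 0) = j - r" by (simp add: wt_def om0 sum_list_replicate)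
            then show ?thesis using ls(2) j False by (intro XX_intros wd_XX) (auto simp: nn)
          qed
          then show "d b (wd ls e) \<in> XX (k - r)" using XX_eq[OF f[OF ls(2), of j]] j by simp
        qed
        have "d b p - smul (\<gamma> k) (wd (replicate (k - r) 0) e0) \<in> XX (k - r)"
        proof -
          have "d b (p - wd (replicate k 0) e0) \<in> XX (k - r)" by (rule low[OF lead0])
          moreover have "d b (wd (replicate k 0) e0) - smul (\<gamma> k) (wd (replicate (k - r) 0) e0) \<in> XX (k - r)"
            using f[OF e0(1), of k] S_XX by (auto simp: eqm_def)
          ultimately show ?thesis using XX_intros(1) by (fastforce simp: lin_diff[OF lin_d])
        qed
        then have "lead (k - r) (\<lambda>_. smul (\<gamma> k) e0) {replicate_mset (k - r) 0} (d b p)"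
          using e0(1)
          by (auto simp: nn lead_def wdm0 lin_smul[OF lin_wd] pm.subspace_scale[OF sub_E] wtm_def om0)
        moreover have "smul (\<gamma> k) e0 \<notin> S"
        proof
          assume "smul (\<gamma> k) e0 \<in> S"
          from pm.subspace_scale[OF sub_S this, of "inverse (\<gamma> k)"] show False using e0(2) c0 by simp
        qed
        ultimately have "good (k - r)" using p(1) dW unfolding good_def by blast
        then show ?thesis using r by auto
      qed
      show False
      proof (cases "2 * m 1 - of_nat k + 1 = 0")
        case False
        have "good (k - 1) \<and> k - 1 < k"
          by (rule lower[where b = 2 and \<gamma> = "\<lambda>j. - of_nat j * (2 * m 1 - of_nat j + 1)"])
             (use \<open>k \<noteq> 0\<close> False simple_root(2)[OF n] in auto)
        then show False using least by blast
      next
        case True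
        \<comment> \<open>The one exponent at which \<open>d 2\<close> fails. There
          \<open>d 3\<close> has the factor \<open>k (k - 1) (k + 1) / 2\<close>, and
          \<open>k = 1\<close> is impossible because it would mean \<open>m 1 = 0\<close>.\<close>
        then have mk: "2 * m 1 = of_nat k - 1" by (simp add: algebra_simps)
        have "k \<noteq> 1" using mk m_q q by auto
        then have k2: "k \<ge> 2" using \<open>k \<noteq> 0\<close> by simp
        have "2 * (3 * m 1 - of_nat k + 2) = 3 * (2 * m 1) - 2 * of_nat k + 4" by (simp add: algebra_simps)
        also have "\<dots> = of_nat (k + 1)" unfolding mk by (simp add: algebra_simps)
        finally have "3 * m 1 - of_nat k + 2 \<noteq> (0::complex)" by (metis mult_zero_right of_nat_eq_0_iff add_is_0 zero_neq_one)
        moreover have "of_nat k - 1 \<noteq> (0::complex)" using \<open>k \<noteq> 1\<close> by (metis of_nat_1 of_nat_eq_iff right_minus_eq)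
        ultimately have "good (k - 2) \<and> k - 2 < k"
          by (intro lower[where b = 3 and \<gamma> = "\<lambda>j. of_nat j * (of_nat j - 1) * (3 * m 1 - of_nat j + 2)"])
             (use k2 simple_root(3)[OF n] in \<open>auto simp: less_2_cases_iff\<close>)
        then show False using least by blast
      qed
    qed
  qed
  then have "wtm M = 0 \<and> set_mset M \<subseteq> {..<n}" if "M \<in> F" for M using that p(2) by (auto simp: lead_def)
  then have "M = {#}" if "M \<in> F" for M using that om_pos by (cases M) (auto simp: wtm_def, fastforce)
  then have F: "F = {{#}}" using p(3) by auto
  then have eq: "p \<approx> g {#}" using p(2) \<open>k = 0\<close> by (simp add: lead_def XX_0 wdm_def eqm_def)
  have "g {#} \<in> E" "g {#} \<notin> S" using p F by (auto simp: lead_def)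
  moreover have "g {#} \<in> W" using eqS_mem[OF eq W(2,1)] p(1) by simp
  ultimately show ?thesis by blast
qed

end


section \<open>Characters\<close>

lemma lookup_bracket_Z:
  "Poly_Mapping.lookup (bracket (e_of g) (e_of h)) Z =
     cext (\<lambda>j. Poly_Mapping.lookup h (- j) * of_int (j ^ 3 - j) / 12) g"
proof -
  have lz: "linc (\<lambda>v. Poly_Mapping.lookup v Z)" by (simp add: linc_def lookup_add)
  have 1: "Poly_Mapping.lookup (bracket (e_of (bv j)) (e_of h)) Z = Poly_Mapping.lookup h (- j) * of_int (j ^ 3 - j) / 12" for j h
  proof (rule linc_eqI[where f = "\<lambda>h. Poly_Mapping.lookup (bracket (e_of (bv j)) (e_of h)) Z"])
    show "linc (\<lambda>h. Poly_Mapping.lookup (bracket (e_of (bv j)) (e_of h)) Z)"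
      by (rule linc_comp[OF lz lin_comp[OF lin_bracket_right lin_e_of]])
    show "linc (\<lambda>h. Poly_Mapping.lookup h (- j) * of_int (j ^ 3 - j) / 12)"
      by (simp add: linc_def lookup_add distrib_right add_divide_distrib mult.assoc)
    show "Poly_Mapping.lookup (bracket (e_of (bv j)) (e_of (bv i))) Z =
        Poly_Mapping.lookup (bv i) (- j) * of_int (j ^ 3 - j) / 12" for i
      by (auto simp: e_of_def bracket_def lookup_add lookup_single when_def)
  qed
  show ?thesis
    by (rule linc_eqI[where f = "\<lambda>g. Poly_Mapping.lookup (bracket (e_of g) (e_of h)) Z",
          OF linc_comp[OF lz lin_comp[OF lin_bracket_left lin_e_of]] linc_cext])
       (simp add: 1)
qed

lemma vir_sub_closed:
  "v \<in> vir_sub f \<Longrightarrow> w \<in> vir_sub f \<Longrightarrow> v + w \<in> vir_sub f" "v \<in> vir_sub f \<Longrightarrow> smul c v \<in> vir_sub f"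
  "v \<in> vir_sub f \<Longrightarrow> w \<in> vir_sub f \<Longrightarrow> v - w \<in> vir_sub f"
  using pm.subspace_add[OF subspace_vir_sub] pm.subspace_scale[OF subspace_vir_sub]
    pm.subspace_diff[OF subspace_vir_sub] by auto

lemma wbr_bv: "wbr (bv i) (bv j) = smul (of_int (j - i)) (bv (i + j))"
  by (simp add: wbr_def mult_single of_int_diff flip: single_diff)

context
  fixes f :: "complex poly" and \<mu> :: "vir \<Rightarrow> complex"
  assumes f0: "coeff f 0 \<noteq> 0" and mu: "lie_char (vir_sub f) \<mu>"
begin

lemma char_add: "v \<in> vir_sub f \<Longrightarrow> w \<in> vir_sub f \<Longrightarrow> \<mu> (v + w) = \<mu> v + \<mu> w"
  and char_smul: "v \<in> vir_sub f \<Longrightarrow> \<mu> (smul c v) = c * \<mu> v"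
  and char_bracket: "v \<in> vir_sub f \<Longrightarrow> w \<in> vir_sub f \<Longrightarrow> \<mu> (bracket v w) = 0"
  using mu by (auto simp: lie_char_def)

lemma char_diff: "v \<in> vir_sub f \<Longrightarrow> w \<in> vir_sub f \<Longrightarrow> \<mu> (v - w) = \<mu> v - \<mu> w"
  using char_add[of v "smul (-1) w"] char_smul[of w "-1"] vir_sub_closed(2)[of w f "-1"] by simp

text \<open>The brackets \<open>[e(t\<^sup>i f), e(t\<^sup>-\<^sup>i f)]\<close> for \<open>i = 1, 2\<close> separate \<open>e(f\<^sup>2)\<close> from the central element.\<close>

lemma char_Z: "\<mu> (bv Z) = 0"
proof -
  let ?F = "LP f"
  have mem: "e_of (bv j * ?F) \<in> vir_sub f" "bv Z \<in> vir_sub f" "e_of (?F\<^sup>2) \<in> vir_sub f" for j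
    by (auto simp: vir_sub_iff power2_eq_square)
  have br: "bracket (e_of (bv i * ?F)) (e_of (bv (- i) * ?F)) =
      smul (- 2 * of_int i) (e_of (?F\<^sup>2)) + smul ((coeff f 0)\<^sup>2 * of_int (i ^ 3 - i) / 12) (bv Z)" for i
  proof -
    let ?b = "bracket (e_of (bv i * ?F)) (e_of (bv (- i) * ?F))"
    have "lg ?b = wbr (?F * bv i) (?F * bv (- i))" by (simp add: lg_bracket mult.commute)
    also have "\<dots> = smul (of_int (- i - i)) (?F\<^sup>2 * bv (i + - i))"
      unfolding wbr_mult_self wbr_bv mult_smul_right ..
    also have "of_int (- i - i) = - 2 * (of_int i :: complex)" by simp
    finally have 1: "lg ?b = smul (- 2 * of_int i) (?F\<^sup>2)" by simp
    let ?\<phi> = "\<lambda>j. Poly_Mapping.lookup (bv i * ?F) j * (Poly_Mapping.lookup (bv (- i) * ?F) (- j) * of_int (j ^ 3 - j) / 12)"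
    have "Poly_Mapping.lookup ?b Z = (\<Sum>j\<in>Poly_Mapping.keys (bv i * ?F). ?\<phi> j)"
      unfolding lookup_bracket_Z cext_def ..
    \<comment> \<open>Only the lowest terms of the two factors meet: a nonzero coefficient of the
      first requires \<open>j \<ge> i\<close>, one of the second \<open>j \<le> i\<close>.\<close>
    also have "\<dots> = (\<Sum>j\<in>{i}. ?\<phi> j)"
    proof (rule sum.mono_neutral_right)
      show "{i} \<subseteq> Poly_Mapping.keys (bv i * ?F)"
        using f0 by (simp add: in_keys_iff lookup_bv_mult lookup_LP)
    qed (auto simp: lookup_bv_mult lookup_LP)
    also have "\<dots> = (coeff f 0)\<^sup>2 * of_int (i ^ 3 - i) / 12"
      by (simp add: lookup_bv_mult lookup_LP power2_eq_square)
    finally have 2: "Poly_Mapping.lookup ?b Z = (coeff f 0)\<^sup>2 * of_int (i ^ 3 - i) / 12" .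
    show ?thesis by (subst vir_decomp) (simp only: 1 2 lin_smul[OF lin_e_of])
  qed
  have eq: "- 2 * of_int i * \<mu> (e_of (?F\<^sup>2)) + (coeff f 0)\<^sup>2 * of_int (i ^ 3 - i) / 12 * \<mu> (bv Z) = 0" for i
    using char_bracket[OF mem(1)[of i] mem(1)[of "- i"]] unfolding br
    by (simp only: char_add char_smul mem vir_sub_closed)
  \<comment> \<open>The central coefficient contains \<open>i^3 - i\<close>, which vanishes at
    \<open>i = 1\<close>.\<close>
  have "\<mu> (e_of (?F\<^sup>2)) = 0" using eq[of 1] by simp
  then show ?thesis using eq[of 2] f0 by simp
qed

lemma char_lg0: "lg v = 0 \<Longrightarrow> \<mu> v = 0"
proof -
  assume "lg v = 0"
  then have "v = smul (Poly_Mapping.lookup v Z) (bv Z)"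
    using vir_decomp[of v] by (simp add: lin_0[OF lin_e_of])
  moreover have "\<mu> (smul (Poly_Mapping.lookup v Z) (bv Z)) = 0"
    using char_smul[of "bv Z"] char_Z by (simp add: vir_sub_iff del: smul_single)
  ultimately show ?thesis by metis
qed

lemma char_lg: "v \<in> vir_sub f \<Longrightarrow> lg v = lg w \<Longrightarrow> \<mu> v = \<mu> w"
  using char_diff[of v w] char_lg0[of "v - w"] by (simp add: vir_sub_iff lin_diff[OF lin_lg])

text \<open>Modulo the central element, \<open>t^j f^2\<close> is a nonzero multiple of the bracket
  of \<open>t^i f\<close> and \<open>t^(j - i) f\<close>, provided that
  \<open>j \<noteq> 2 * i\<close>.\<close>

lemma char_square:
  assumes "LP f ^ 2 dvd lg v" shows "\<mu> v = 0"
proof -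
  let ?F = "LP f"
  obtain h where h: "lg v = ?F ^ 2 * h" using assms by (rule dvdE)
  have mem: "e_of (?F ^ 2 * h) \<in> vir_sub f" for h by (simp add: vir_sub_iff power2_eq_square mult.assoc)
  have "\<mu> (e_of (?F ^ 2 * h)) = 0"
  proof (induction h rule: pm_induct)
    case zero
    then show ?case using char_lg0 by (simp add: lin_0[OF lin_e_of] lin_0[OF lin_lg])
  next
    case (add p q)
    then show ?case using char_add[OF mem mem, of p q] by (simp add: distrib_left lin_add[OF lin_e_of])
  next
    case (smul c p)
    then show ?case using char_smul[OF mem, of c p] by (simp add: lin_smul[OF lin_e_of])
  next
    case (bv j)
    define i where "i = (if j = 0 then 1 else 0 :: int)"
    have c: "of_int (j - 2 * i) \<noteq> (0 :: complex)" by (auto simp: i_def simp flip: of_int_mult of_int_diff)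
    let ?b = "bracket (e_of (?F * bv i)) (e_of (?F * bv (j - i)))"
    have "lg ?b = ?F\<^sup>2 * wbr (bv i) (bv (j - i))" by (simp add: lg_bracket wbr_mult_self)
    also have "wbr (bv i) (bv (j - i)) = smul (of_int (j - 2 * i)) (bv j)"
      unfolding wbr_bv by simp
    also have "?F\<^sup>2 * smul (of_int (j - 2 * i)) (bv j) = smul (of_int (j - 2 * i)) (?F\<^sup>2 * bv j)"
      by (rule mult_smul_right)
    finally have lb: "lg ?b = smul (of_int (j - 2 * i)) (?F\<^sup>2 * bv j)" .
    have "\<mu> ?b = 0" by (rule char_bracket) (simp_all add: vir_sub_iff)
    moreover have "\<mu> ?b = \<mu> (smul (of_int (j - 2 * i)) (e_of (?F\<^sup>2 * bv j)))"
      by (rule char_lg) (simp_all add: lb vir_sub_iff dvd_smul power2_eq_square lin_smul[OF lin_lg] mult.assoc)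
    ultimately show ?case using char_smul[OF mem, of "of_int (j - 2 * i)" "bv j"] c by simp
  qed
  moreover have "\<mu> v = \<mu> (e_of (?F ^ 2 * h))"
    by (rule char_lg) (simp_all add: h vir_sub_iff power2_eq_square mult.assoc)
  ultimately show ?thesis by simp
qed

end

text \<open>Brackets in \<open>Vir\<^sup>f\<close> project to multiples of \<open>f^2\<close>. With
  \<open>char_square\<close>, the characters for \<open>f\<close> with nonzero constant term are
  exactly the linear forms vanishing on all elements that project to such multiples.\<close>

lemma lie_charI:
  assumes "\<And>v w. v \<in> vir_sub f \<Longrightarrow> w \<in> vir_sub f \<Longrightarrow> \<mu> (v + w) = \<mu> v + \<mu> w"
    and "\<And>c v. v \<in> vir_sub f \<Longrightarrow> \<mu> (smul c v) = c * \<mu> v"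
    and "\<And>v. LP f ^ 2 dvd lg v \<Longrightarrow> \<mu> v = 0"
  shows "lie_char (vir_sub f) \<mu>"
  using assms
  by (auto simp: lie_char_def vir_sub_iff lg_bracket wbr_mult_self elim!: dvdE)


section \<open>Taylor coefficients\<close>

text \<open>The Taylor coefficient of order \<open>a\<close> at the point \<open>l\<close>.\<close>

definition tau :: "complex \<Rightarrow> nat \<Rightarrow> laurent \<Rightarrow> complex" where
  "tau l a = cext (\<lambda>j. (of_int j gchoose a) * l powi (j - int a))"

lemma linc_tau: "linc (tau l a)"
  by (simp add: tau_def linc_cext)

lemma tau_lpt:
  assumes "l \<noteq> 0"
  shows "tau l a (lpt l * g) = (if a = 0 then 0 else tau l (a - 1) g)"
proof (rule linc_eqI[where f = "\<lambda>g. tau l a (lpt l * g)", OF linc_comp[OF linc_tau lin_mult_left]])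
  show "linc (\<lambda>g. if a = 0 then 0 else tau l (a - 1) g)" using linc_tau by (auto simp: linc_def)
  fix j
  have "tau l a (lpt l * bv j) = tau l a (bv (j + 1) - Poly_Mapping.single j l)"
    by (simp add: lpt_eq left_diff_distrib mult_single add.commute)
  also have "\<dots> = (of_int (j + 1) gchoose a) * l powi (j + 1 - int a) - l * ((of_int j gchoose a) * l powi (j - int a))"
    by (simp add: linc_diff[OF linc_tau]) (simp add: tau_def)
  also have "\<dots> = ((of_int (j + 1) gchoose a) - (of_int j gchoose a)) * l powi (j + 1 - int a)"
    using assms power_int_add[of l "j - int a" 1] by (simp add: algebra_simps)
  also have "\<dots> = (if a = 0 then 0 else tau l (a - 1) (bv j))"
  proof (cases a)
    case (Suc b)
    then show ?thesis
      using gbinomial_addition_formula[of "of_int (j + 1) :: complex" b] by (simp add: tau_def algebra_simps)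
  qed simp
  finally show "tau l a (lpt l * bv j) = (if a = 0 then 0 else tau l (a - 1) (bv j))" .
qed

lemma tau_lpt_power:
  assumes "l \<noteq> 0"
  shows "tau l a (lpt l ^ n * g) = (if a < n then 0 else tau l (a - n) g)"
proof (induction n arbitrary: a)
  case (Suc n)
  then show ?case using tau_lpt[OF assms, of a "lpt l ^ n * g"] by (auto simp: mult.assoc)
qed simp

lemma tau_dvd: "l \<noteq> 0 \<Longrightarrow> lpt l ^ n dvd g \<Longrightarrow> a < n \<Longrightarrow> tau l a g = 0"
  using tau_lpt_power by (auto elim!: dvdE)

lemma tau_0_poly: assumes "l \<noteq> 0" shows "tau l 0 (bv j * LP f) = l powi j * poly f l"
proof (induction f arbitrary: j)
  case (pCons c f)
  have "tau l 0 (bv j * LP (pCons c f)) = tau l 0 (Poly_Mapping.single j c) + tau l 0 (bv (j + 1) * LP f)"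
    by (simp add: LP_pCons distrib_left mult_single linc_add[OF linc_tau] flip: mult.assoc)
  then show ?case using pCons power_int_add[of l j 1] assms by (simp add: tau_def algebra_simps)
qed (simp add: LP_0 linc_0[OF linc_tau])


section \<open>Partial fractions\<close>

text \<open>Comaximality. It passes to products and powers, which is all that the Chinese remainder
  theorem for powers of distinct \<open>t - \<lambda>\<close> uses.\<close>

definition bez :: "'a::comm_ring_1 \<Rightarrow> 'a \<Rightarrow> bool" where
  "bez a b \<longleftrightarrow> (\<exists>u v. u * a + v * b = 1)"

lemma bez_sym: "bez a b \<Longrightarrow> bez b a"
  unfolding bez_def by (metis add.commute)

lemma bez_mult: assumes "bez a b" "bez a c" shows "bez a (b * c)"
proof -
  obtain u v u' v' where "u * a + v * b = 1" "u' * a + v' * c = 1" using assms by (auto simp: bez_def)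
  then have "(u * a + v * b) * (u' * a + v' * c) = 1" by simp
  then have "(u * a * u' + u * v' * c + v * b * u') * a + (v * v') * (b * c) = 1" by (simp add: algebra_simps)
  then show ?thesis unfolding bez_def by blast
qed

lemma bez_1: "bez a 1"
  unfolding bez_def by (intro exI[of _ 0] exI[of _ 1]) simp

lemma bez_power: "bez a b \<Longrightarrow> bez a (b ^ n)"
  by (induction n) (auto intro: bez_mult bez_1)

lemma bez_prod: "(\<And>i. i \<in> I \<Longrightarrow> bez a (g i)) \<Longrightarrow> bez a (prod g I)"
  by (induction I rule: infinite_finite_induct) (auto intro: bez_mult bez_1)

lemma bez_dvd: assumes "bez a b" "a dvd x" "b dvd x" shows "a * b dvd x"
proof -
  obtain u v where uv: "u * a + v * b = 1" using assms by (auto simp: bez_def)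
  obtain r s where rs: "x = b * r" "x = a * s" using assms by (auto elim!: dvdE)
  have "x = u * a * x + v * b * x" using uv by (metis distrib_right mult_1)
  also have "\<dots> = u * a * (b * r) + v * b * (a * s)" using rs by metis
  also have "\<dots> = (a * b) * (u * r + v * s)" by (simp add: algebra_simps)
  finally show ?thesis by (rule dvdI)
qed

lemma bez_lpt: assumes "l \<noteq> l'" shows "bez (lpt l) (lpt l')"
proof -
  have "Poly_Mapping.single 0 (1 / (l' - l)) * lpt l + Poly_Mapping.single 0 (- 1 / (l' - l)) * lpt l' =
      Poly_Mapping.single 0 (1 / (l' - l)) * (lpt l - lpt l')"
    by (simp add: right_diff_distrib single_uminus)
  also have "lpt l - lpt l' = Poly_Mapping.single 0 (l' - l)" by (simp add: lpt_eq single_diff)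
  finally show ?thesis using assms unfolding bez_def
    by (intro exI) (simp add: mult_single)
qed

locale roots =
  fixes k :: nat and lam :: "nat \<Rightarrow> complex" and ns :: "nat \<Rightarrow> nat"
  assumes inj_lam: "inj_on lam {1..k}" and lam_0: "i \<in> {1..k} \<Longrightarrow> lam i \<noteq> 0" and ns_1: "i \<in> {1..k} \<Longrightarrow> ns i \<ge> 1"
begin

definition A :: "nat \<Rightarrow> laurent" where "A i = lpt (lam i) ^ ns i"
definition F :: laurent where "F = (\<Prod>i=1..k. A i)"

lemma bez_A: "i \<in> {1..k} \<Longrightarrow> j \<in> {1..k} \<Longrightarrow> i \<noteq> j \<Longrightarrow> bez (A i ^ N) (A j ^ N')"
  using inj_lam unfolding A_def power_mult[symmetric]
  by (intro bez_power bez_sym[OF bez_power[OF bez_sym]] bez_lpt) (auto dest: inj_onD)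

lemma A_dvd_F: "i \<in> {1..k} \<Longrightarrow> A i ^ N dvd F ^ N"
  unfolding F_def by (intro dvd_power_same dvd_prodI) auto

lemma F_dvd:
  assumes "\<And>i. i \<in> {1..k} \<Longrightarrow> A i ^ N dvd g" shows "F ^ N dvd g"
proof -
  have "(\<Prod>i\<in>I. A i ^ N) dvd g" if "I \<subseteq> {1..k}" "finite I" for I
    using that(2,1)
  proof (induction I rule: finite_induct)
    case (insert i I)
    then have "A i ^ N * (\<Prod>i\<in>I. A i ^ N) dvd g"
      using assms by (intro bez_dvd bez_prod bez_A) auto
    then show ?case using insert by simp
  qed simp
  from this[of "{1..k}"] show ?thesis by (simp add: F_def prod_power_distrib)
qed

lemma ep_exists:
  assumes "i \<in> {1..k}"
  shows "\<exists>e. A i ^ N dvd e - 1 \<and> (\<forall>j\<in>{1..k} - {i}. A j ^ N dvd e)"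
proof -
  let ?G = "\<Prod>j\<in>{1..k} - {i}. A j ^ N"
  have "bez (A i ^ N) ?G" using assms by (intro bez_prod bez_A) auto
  then obtain u v where uv: "u * A i ^ N + v * ?G = 1" by (auto simp: bez_def)
  have "v * ?G - 1 = A i ^ N * (- u)" using uv by (simp add: algebra_simps)
  then have "A i ^ N dvd v * ?G - 1" by (rule dvdI)
  moreover have "\<forall>j\<in>{1..k} - {i}. A j ^ N dvd v * ?G" by (auto intro!: dvd_mult dvd_prodI)
  ultimately show ?thesis by blast
qed

text \<open>A lift of an idempotent of the Laurent polynomials modulo \<open>F ^ N\<close>: it is 1
  at the root \<open>lam i\<close> and 0 at the other roots. These are the partial fractions that
  localize the action.\<close>

definition ep :: "nat \<Rightarrow> nat \<Rightarrow> laurent" where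
  "ep i N = (SOME e. A i ^ N dvd e - 1 \<and> (\<forall>j\<in>{1..k} - {i}. A j ^ N dvd e))"

lemma ep: "i \<in> {1..k} \<Longrightarrow> A i ^ N dvd ep i N - 1"
  and ep_other: "i \<in> {1..k} \<Longrightarrow> j \<in> {1..k} \<Longrightarrow> j \<noteq> i \<Longrightarrow> A j ^ N dvd ep i N"
  using someI_ex[OF ep_exists] unfolding ep_def by blast+

lemma ep_sum: "F ^ N dvd (\<Sum>i=1..k. ep i N) - 1"
proof (rule F_dvd)
  fix i assume i: "i \<in> {1..k}"
  have "(\<Sum>i=1..k. ep i N) - 1 = (ep i N - 1) + (\<Sum>j\<in>{1..k} - {i}. ep j N)"
    using i by (simp add: sum.remove)
  moreover have "A i ^ N dvd (\<Sum>j\<in>{1..k} - {i}. ep j N)" using i by (intro dvd_sum ep_other) auto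
  ultimately show "A i ^ N dvd (\<Sum>i=1..k. ep i N) - 1" using ep[OF i] by (metis dvd_add)
qed

lemma LP_prod: "LP (Polynomial.smult a (\<Prod>i=1..k. linpow (lam i) (ns i))) = smul a F"
proof -
  have "LP (\<Prod>i\<in>I. linpow (lam i) (ns i)) = (\<Prod>i\<in>I. A i)" if "finite I" for I
    using that by (induction I rule: finite_induct) (simp_all add: LP_1 LP_mult LP_power A_def)
  then show ?thesis by (simp add: LP_smult F_def)
qed

lemma poly_prod_0: "poly (\<Prod>i=1..k. linpow (lam i) (ns i)) 0 \<noteq> 0"
  by (auto simp: poly_prod lam_0)

end

lemma smul_dvd_iff: "c \<noteq> 0 \<Longrightarrow> smul c g ^ N dvd h \<longleftrightarrow> g ^ N dvd (h :: laurent)"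
proof -
  assume c: "c \<noteq> 0"
  have p: "Poly_Mapping.single 0 c ^ N = (Poly_Mapping.single 0 (c ^ N) :: laurent)"
    by (induction N) (simp_all add: mult_single single_one)
  have "smul c g ^ N = Poly_Mapping.single 0 (c ^ N) * g ^ N" by (simp add: smul_eq_mult power_mult_distrib p)
  moreover have "Poly_Mapping.single 0 (inverse (c ^ N)) * (Poly_Mapping.single 0 (c ^ N) * g ^ N) = g ^ N"
    using c by (simp add: mult_single flip: mult.assoc)
  ultimately have "smul c g ^ N dvd g ^ N" "g ^ N dvd smul c g ^ N" by (metis dvd_triv_right)+
  then show ?thesis by (metis dvd_trans)
qed

text \<open>The component at a root is \<mu> after multiplication by the idempotent of that root.
  Order 2 suffices because characters of \<open>Vir\<^sup>f\<close> vanish on multiples of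
  \<open>f^2\<close>.\<close>

lemma decomposition_exists:
  assumes f0: "coeff f 0 \<noteq> 0" and mu: "lie_char (vir_sub f) \<mu>"
  obtains a k lam ns mus where "decomposition f \<mu> a k lam ns mus"
proof -
  have "f \<noteq> 0" using f0 by auto
  define R where "R = {z. poly f z = 0}"
  have fin: "finite R" using poly_roots_finite[OF \<open>f \<noteq> 0\<close>] by (simp add: R_def)
  define k where "k = card R"
  obtain lam where lam: "bij_betw lam {1..k} R" using ex_bij_betw_nat_finite_1[OF fin] by (auto simp: k_def)
  define ns where "ns i = Polynomial.order (lam i) f" for i
  have R: "lam i \<in> R" if "i \<in> {1..k}" for i using lam that by (auto simp: bij_betw_def)
  have ns: "ns i \<ge> 1" if "i \<in> {1..k}" for i
    using R[OF that] \<open>f \<noteq> 0\<close> by (simp add: R_def ns_def order_root Suc_le_eq)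
  have l0: "lam i \<noteq> 0" if "i \<in> {1..k}" for i
    using R[OF that] f0 by (auto simp: R_def poly_0_coeff_0)
  interpret roots k lam ns
    using lam l0 ns by unfold_locales (auto simp: bij_betw_def)
  define a where "a = lead_coeff f"
  have a: "a \<noteq> 0" using \<open>f \<noteq> 0\<close> by (simp add: a_def)
  have f: "f = Polynomial.smult a (\<Prod>i=1..k. linpow (lam i) (ns i))"
  proof -
    have "(\<Prod>i=1..k. linpow (lam i) (ns i)) = (\<Prod>z\<in>R. [:- z, 1:] ^ Polynomial.order z f)"
      unfolding ns_def by (rule prod.reindex_bij_betw[OF lam])
    then show ?thesis using complex_poly_decompose[of f] by (simp add: R_def a_def)
  qed
  have LPf: "LP f ^ N dvd g \<longleftrightarrow> F ^ N dvd g" for N g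
    by (subst f) (simp only: LP_prod smul_dvd_iff[OF a])
  have sub: "v \<in> vir_sub f \<longleftrightarrow> F dvd lg v" for v using LPf[of 1 "lg v"] by (simp add: vir_sub_iff)
  define mus where "mus i v = \<mu> (e_of (ep i 2 * lg v))" for i v
  have subi: "v \<in> vir_sub (linpow (lam i) (ns i)) \<longleftrightarrow> A i dvd lg v" for i v
    by (simp add: vir_sub_iff LP_power A_def)
  have mem: "e_of (ep i 2 * lg v) \<in> vir_sub f" if "i \<in> {1..k}" "A i dvd lg v" for i v
    unfolding sub lg_e_of using F_dvd[of 1 "ep i 2 * lg v"]
  proof -
    have "A j ^ 1 dvd ep i 2 * lg v" if "j \<in> {1..k}" for j
      using that \<open>i \<in> {1..k}\<close> \<open>A i dvd lg v\<close> dvd_trans[OF le_imp_power_dvd ep_other[of i j 2], of 1]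
      by (cases "i = j") (auto intro: dvd_mult dvd_mult2)
    then show "F dvd ep i 2 * lg v" using F_dvd[of 1 "ep i 2 * lg v"] by simp
  qed
  have "lie_char (vir_sub (linpow (lam i) (ns i))) (mus i)" if i: "i \<in> {1..k}" for i
  proof (rule lie_charI)
    fix v w c assume v: "v \<in> vir_sub (linpow (lam i) (ns i))"
    show "mus i (smul c v) = c * mus i v"
      using v char_smul[OF f0 mu mem[OF i, of v]] by (simp add: mus_def subi lin_smul[OF lin_lg] lin_smul[OF lin_e_of])
    assume w: "w \<in> vir_sub (linpow (lam i) (ns i))"
    show "mus i (v + w) = mus i v + mus i w"
      using v w char_add[OF f0 mu mem[OF i, of v] mem[OF i, of w]]
      by (simp add: mus_def subi lin_add[OF lin_lg] lin_add[OF lin_e_of] distrib_left)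
  next
    fix v assume "LP (linpow (lam i) (ns i)) ^ 2 dvd lg v"
    then have v: "A i ^ 2 dvd lg v" by (simp add: LP_power A_def)
    have "A j ^ 2 dvd ep i 2 * lg v" if "j \<in> {1..k}" for j
      using that i v ep_other[of i j 2] by (cases "i = j") (auto intro: dvd_mult dvd_mult2)
    then have "F ^ 2 dvd ep i 2 * lg v" by (rule F_dvd)
    then show "mus i v = 0" unfolding mus_def by (intro char_square[OF f0 mu]) (simp add: LPf)
  qed
  moreover have "\<mu> v = (\<Sum>i=1..k. mus i v)" if v: "v \<in> vir_sub f" for v
  proof -
    have Fv: "F dvd lg v" using v sub by simp
    have Ai: "A i dvd lg v" if "i \<in> {1..k}" for i using A_dvd_F[OF that, of 1] Fv by (auto intro: dvd_trans)
    have mem2: "e_of ((\<Sum>i\<in>I. ep i 2) * lg v) \<in> vir_sub f" for I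
      using Fv by (simp add: sub dvd_mult)
    have "(\<Sum>i\<in>I. mus i v) = \<mu> (e_of ((\<Sum>i\<in>I. ep i 2) * lg v))" if "I \<subseteq> {1..k}" "finite I" for I
      using that(2,1)
    proof (induction I rule: finite_induct)
      case empty
      show ?case using char_lg0[OF f0 mu, of 0] by (simp add: lin_0[OF lin_e_of] lin_0[OF lin_lg])
    next
      case (insert i I)
      then show ?case using char_add[OF f0 mu mem[of i v] mem2[of I]] Ai[of i]
        by (simp add: mus_def distrib_right lin_add[OF lin_e_of])
    qed
    then have "(\<Sum>i=1..k. mus i v) = \<mu> (e_of ((\<Sum>i=1..k. ep i 2) * lg v))" by simp
    also have "\<mu> (e_of ((\<Sum>i=1..k. ep i 2) * lg v)) - \<mu> v = \<mu> (e_of ((\<Sum>i=1..k. ep i 2) * lg v) - v)"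
      using char_diff[OF f0 mu mem2 v] by simp
    also have "\<dots> = 0"
    proof (rule char_square[OF f0 mu])
      have "lg (e_of ((\<Sum>i=1..k. ep i 2) * lg v) - v) = ((\<Sum>i=1..k. ep i 2) - 1) * lg v"
        by (simp add: lin_diff[OF lin_lg] left_diff_distrib)
      then show "LP f ^ 2 dvd lg (e_of ((\<Sum>i=1..k. ep i 2) * lg v) - v)"
        using ep_sum[of 2] by (simp add: LPf dvd_mult2)
    qed
    finally show ?thesis by simp
  qed
  ultimately have "decomposition f \<mu> a k lam ns mus"
    unfolding decomposition_def using a f l0 ns inj_lam by blast
  then show ?thesis by (rule that)
qed


section \<open>Finite differences\<close>

definition fd :: "(int \<Rightarrow> complex) \<Rightarrow> int \<Rightarrow> complex" where
  "fd a j = a (j + 1) - a j"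

text \<open>Newton's forward difference formula. Both sides have the same first difference, by
  induction and Pascal's rule, and the same value at 0; hence they agree at all integers, negative
  ones included.\<close>

lemma newton:
  assumes "(fd ^^ n) a = (\<lambda>_. 0)"
  shows "a j = (\<Sum>r<n. (fd ^^ r) a 0 * (of_int j gchoose r))"
  using assms
proof (induction n arbitrary: a j)
  case (Suc n)
  have IH: "fd a j = (\<Sum>r<n. (fd ^^ r) (fd a) 0 * (of_int j gchoose r))" for j
    using Suc.prems by (intro Suc.IH) (simp add: funpow_swap1)
  define c where "c j = (\<Sum>r<Suc n. (fd ^^ r) a 0 * (of_int j gchoose r))" for j :: int
  have c: "c j = a 0 + (\<Sum>r<n. (fd ^^ Suc r) a 0 * (of_int j gchoose Suc r))" for j
    unfolding c_def sum.lessThan_Suc_shift by simp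
  have cfd: "c (j + 1) - c j = fd a j" for j
  proof -
    have pascal: "(of_int (j + 1) gchoose Suc r) - (of_int j gchoose Suc r) = (of_int j gchoose r :: complex)" for r
      using gbinomial_addition_formula[of "of_int (j + 1) :: complex" r] by simp
    have "c (j + 1) - c j = (\<Sum>r<n. (fd ^^ Suc r) a 0 * ((of_int (j + 1) gchoose Suc r) - (of_int j gchoose Suc r)))"
      unfolding c by (simp only: right_diff_distrib sum_subtractf add_diff_cancel_left)
    also have "\<dots> = fd a j"
      unfolding pascal by (subst IH) (simp only: funpow_Suc_right o_apply)
    finally show ?thesis .
  qed
  have step: "a (j + 1) - c (j + 1) = a j - c j" for j
  proof -
    have "(a (j + 1) - c (j + 1)) - (a j - c j) = fd a j - (c (j + 1) - c j)" by (simp add: fd_def)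
    then show ?thesis using cfd[of j] by simp
  qed
  have const: "a j - c j = a 0 - c 0" for j
  proof (induction j rule: int_induct[of _ 0])
    case (step2 i)
    then show ?case using step[of "i - 1"] by simp
  qed (use step in auto)
  have "c 0 = a 0" by (simp add: c)
  then have "a j = c j" using const[of j] by simp
  then show ?case by (simp only: c_def)
qed simp

section \<open>Degree and vanishing of differences\<close>

definition binp :: "nat \<Rightarrow> complex poly" where
  "binp r = Polynomial.smult (1 / fact r) (\<Prod>i<r. [:- of_nat i, 1:])"

lemma poly_binp: "poly (binp r) x = x gchoose r"
  by (simp add: binp_def poly_prod gbinomial_prod_rev atLeast0LessThan)

lemma degree_binp: "degree (binp r) = r"
proof -
  have "degree (\<Prod>i<r. [:- of_nat i, 1 :: complex:]) = r"
    by (subst degree_prod_eq_sum_degree) auto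
  then show ?thesis by (simp add: binp_def)
qed

lemma fd_poly:
  assumes "(fd ^^ n) a = (\<lambda>_. 0)"
  shows "\<exists>p. (\<forall>j. a j = poly p (of_int j)) \<and> (p = 0 \<or> degree p < n)"
proof (intro exI conjI allI)
  let ?p = "\<Sum>r<n. Polynomial.smult ((fd ^^ r) a 0) (binp r)"
  show "a j = poly ?p (of_int j)" for j
    by (subst newton[OF assms]) (simp add: poly_sum poly_binp)
  show "?p = 0 \<or> degree ?p < n"
  proof (cases n)
    case (Suc n')
    have "degree ?p \<le> n'"
      by (rule degree_sum_le) (use Suc in \<open>auto intro: order_trans[OF degree_smult_le] simp: degree_binp\<close>)
    then show ?thesis using Suc by simp
  qed simp
qed

lemma fd_poly_0:
  assumes "\<And>j. a j = poly p (of_int j)" "p = 0 \<or> degree p < n"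
  shows "(fd ^^ n) a = (\<lambda>_. 0)"
  using assms
proof (induction n arbitrary: a p)
  case 0
  then show ?case by auto
next
  case (Suc n)
  let ?p = "pcompose p [:1, 1:] - p"
  have a: "fd a j = poly ?p (of_int j)" for j using Suc.prems(1) by (simp add: fd_def poly_pcompose add.commute)
  have "?p = 0 \<or> degree ?p < n"
  proof (cases "degree p = 0")
    case True
    then obtain c where "p = [:c:]" by (metis degree_eq_zeroE)
    then show ?thesis by simp
  next
    case False
    have d: "degree (pcompose p [:1, 1:]) = degree p" by (simp add: degree_pcompose)
    have "lead_coeff (pcompose p [:1, 1:]) = lead_coeff p" by (subst lead_coeff_comp) auto
    then have "coeff ?p (degree p) = 0" by (simp add: d)
    moreover have "degree ?p \<le> degree p" by (rule degree_diff_le) (simp_all add: d)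
    ultimately have "?p = 0 \<or> degree ?p < degree p" by (metis le_neq_implies_less leading_coeff_0_iff)
    then show ?thesis using Suc.prems(2) False by auto
  qed
  from Suc.IH[OF a this] show ?case by (simp add: funpow_swap1)
qed

text \<open>The difference of order \<open>degree p\<close> is constant. If it were 0, the sequence
  would come from a polynomial of smaller degree, but two polynomials that agree on all integers
  coincide.\<close>

lemma fd_degree:
  assumes a: "\<And>j. a j = poly p (of_int j)" and "p \<noteq> 0"
  shows "(fd ^^ degree p) a j \<noteq> 0"
proof
  assume 0: "(fd ^^ degree p) a j = 0"
  have "(fd ^^ Suc (degree p)) a = (\<lambda>_. 0)" by (rule fd_poly_0[OF a]) simp
  then have const: "(fd ^^ degree p) a (i + 1) = (fd ^^ degree p) a i" for i
    by (simp add: fd_def fun_eq_iff)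
  have "(fd ^^ degree p) a i = 0" for i
  proof (induction i rule: int_induct[of _ j])
    case (step2 i)
    then show ?case using const[of "i - 1"] by simp
  qed (use 0 const in auto)
  then obtain p' where p': "\<And>j. a j = poly p' (of_int j)" "p' = 0 \<or> degree p' < degree p"
    using fd_poly[of "degree p" a] by auto
  have "p - p' = 0"
  proof (rule ccontr)
    assume "p - p' \<noteq> 0"
    then have "finite {x. poly (p - p') x = 0}" by (rule poly_roots_finite)
    moreover have "range (of_int :: int \<Rightarrow> complex) \<subseteq> {x. poly (p - p') x = 0}" using a p'(1) by auto
    moreover have "infinite (range (of_int :: int \<Rightarrow> complex))"
      using finite_imageD[of "of_int :: int \<Rightarrow> complex" "UNIV :: int set"] infinite_UNIV_int by (auto simp: inj_def)
    ultimately show False using finite_subset by blast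
  qed
  then show False using p'(2) \<open>p \<noteq> 0\<close> by simp
qed

text \<open>Multiplying the argument by \<open>t - l\<close> turns the sequence
  \<open>a j * l^j\<close> into \<open>l^(j + 1)\<close> times the difference of \<open>a\<close>.
  The degree of the polynomial thus shows in the order of vanishing from which on the character is
  zero.\<close>

lemma char_fd:
  assumes l: "l \<noteq> 0" and mu: "lie_char (vir_sub (linpow l n)) \<mu>"
    and a: "\<And>j. \<mu> (vir_gen (linpow l n) j) = a j * l powi j"
  shows "\<mu> (e_of (bv j * lpt l ^ (n + r))) = l powi (j + int r) * (fd ^^ r) a j"
proof (induction r arbitrary: j)
  case 0
  then show ?case using a[of j] by (simp add: vir_gen_def LP_power mult.commute)
next
  case (Suc r)
  have f0: "coeff (linpow l n) 0 \<noteq> 0" using l by (simp flip: poly_0_coeff_0)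
  have mem: "e_of (bv j * lpt l ^ (n + r)) \<in> vir_sub (linpow l n)" for j
    by (simp add: vir_sub_iff LP_power dvd_mult le_imp_power_dvd)
  have "bv j * lpt l ^ (n + Suc r) = (bv j * lpt l) * lpt l ^ (n + r)" by simp
  also have "bv j * lpt l = bv (j + 1) - smul l (bv j)"
    by (simp add: lpt_eq right_diff_distrib mult_single)
  finally have "e_of (bv j * lpt l ^ (n + Suc r)) =
      e_of (bv (j + 1) * lpt l ^ (n + r)) - smul l (e_of (bv j * lpt l ^ (n + r)))"
    by (simp add: left_diff_distrib lin_diff[OF lin_e_of] lin_smul[OF lin_e_of] del: smul_single)
  then have "\<mu> (e_of (bv j * lpt l ^ (n + Suc r))) =
      l powi (j + 1 + int r) * (fd ^^ r) a (j + 1) - l * (l powi (j + int r) * (fd ^^ r) a j)"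
    using Suc[of j] Suc[of "j + 1"] char_diff[OF f0 mu mem vir_sub_closed(2)[OF mem], of "j + 1" l j]
      char_smul[OF f0 mu mem, of l j] by simp
  also have "\<dots> = l powi (j + int (Suc r)) * (fd ^^ Suc r) a j"
    using l power_int_add[of l "j + int r" 1] by (simp add: fd_def algebra_simps)
  finally show ?case .
qed

lemma poly_0_linpow: "l \<noteq> 0 \<Longrightarrow> coeff (linpow l n) 0 \<noteq> 0"
  by (simp flip: poly_0_coeff_0)

text \<open>Up to a nonzero factor, the difference of order \<open>n\<close> is the value at a
  multiple of \<open>(t - l)^(2 n)\<close>, which is zero by \<open>char_square\<close>.\<close>

lemma char_poly:
  assumes l: "l \<noteq> 0" and mu: "lie_char (vir_sub (linpow l n)) \<mu>"
  shows "\<exists>p. (\<forall>j. \<mu> (vir_gen (linpow l n) j) = poly p (of_int j) * l powi j) \<and> (p = 0 \<or> degree p < n)"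
proof -
  define a where "a j = \<mu> (vir_gen (linpow l n) j) * l powi (- j)" for j
  have a: "\<mu> (vir_gen (linpow l n) j) = a j * l powi j" for j
    using l by (simp add: a_def power_int_minus)
  have "(fd ^^ n) a j = 0" for j
  proof -
    have "\<mu> (e_of (bv j * lpt l ^ (n + n))) = 0"
      by (rule char_square[OF poly_0_linpow[OF l] mu])
         (simp add: LP_power power2_eq_square flip: power_add)
    then show ?thesis using char_fd[OF l mu a, of j n] l by simp
  qed
  then have "(fd ^^ n) a = (\<lambda>_. 0)" by blast
  from fd_poly[OF this] a show ?thesis by metis
qed


section \<open>Derivations of polynomial algebras\<close>

text \<open>Polynomials in variables from \<open>'a\<close> are the elements of the monoid algebra of the multisets.\<close>

type_synonym 'a sym = "'a multiset \<Rightarrow>\<^sub>0 complex"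

definition deriv :: "('a \<Rightarrow> 'a sym) \<Rightarrow> 'a sym \<Rightarrow> 'a sym" where
  "deriv \<delta> = lin_ext (\<lambda>M. \<Sum>a\<in>#M. \<delta> a * bv (M - {#a#}))"

lemma lin_deriv: "lin (deriv \<delta>)"
  by (simp add: deriv_def lin_lin_ext)

lemma deriv_var: "deriv \<delta> (bv {#a#}) = \<delta> a"
  by (simp add: deriv_def)

lemma deriv_1: "deriv \<delta> 1 = 0"
  by (simp add: deriv_def flip: single_one)

lemma deriv_mult: "deriv \<delta> (p * q) = deriv \<delta> p * q + p * deriv \<delta> q"
proof -
  have 0: "deriv \<delta> (bv M * bv N) = deriv \<delta> (bv M) * bv N + bv M * deriv \<delta> (bv N)" for M N
  proof -
    have l: "(\<Sum>a\<in>#M. \<delta> a * bv (M + N - {#a#})) = (\<Sum>a\<in>#M. \<delta> a * bv (M - {#a#}) * bv N)" for M N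
    proof (intro arg_cong[where f = sum_mset] image_mset_cong)
      fix a assume "a \<in># M"
      then have "M + N - {#a#} = (M - {#a#}) + N" by (metis multiset_diff_union_assoc add.commute single_subset_iff)
      then show "\<delta> a * bv (M + N - {#a#}) = \<delta> a * bv (M - {#a#}) * bv N"
        by (simp add: mult.assoc mult_single)
    qed
    have "deriv \<delta> (bv M * bv N) = (\<Sum>a\<in>#M. \<delta> a * bv (M + N - {#a#})) + (\<Sum>a\<in>#N. \<delta> a * bv (N + M - {#a#}))"
      by (simp add: deriv_def mult_single add.commute)
    also have "\<dots> = (\<Sum>a\<in>#M. \<delta> a * bv (M - {#a#})) * bv N + (\<Sum>a\<in>#N. \<delta> a * bv (N - {#a#})) * bv M"
      unfolding l by (simp add: sum_mset_distrib_right)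
    finally show ?thesis by (simp add: deriv_def mult.commute)
  qed
  have 1: "deriv \<delta> (bv M * q) = deriv \<delta> (bv M) * q + bv M * deriv \<delta> q" for M q
    by (rule lin_eqI[where f = "\<lambda>q. deriv \<delta> (bv M * q)"])
       (intro lin_comp[OF lin_deriv] lin_mult_left lin_plus lin_comp[OF lin_mult_left lin_deriv] 0)+
  show ?thesis
    by (rule lin_eqI[where f = "\<lambda>p. deriv \<delta> (p * q)"])
       (intro lin_comp[OF lin_deriv] lin_mult_right lin_plus lin_comp[OF lin_mult_right lin_deriv] 1)+
qed

lemma derivation_0:
  assumes "lin X" "\<And>p q. X (p * q) = X p * q + p * X q" "\<And>a. X (bv {#a#}) = 0"
  shows "X p = (0 :: 'a sym)"
proof -
  have "X 1 = 0" using assms(2)[of 1 1] by simp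
  then have "X (bv M) = 0" for M
  proof (induction M)
    case (add a M)
    have "X (bv {#a#} * bv M) = 0" using assms(2)[of "bv {#a#}" "bv M"] assms(3) add by simp
    then show ?case by (simp add: mult_single)
  qed (simp flip: single_one)
  then show ?thesis by (rule lin_eqI[OF assms(1) lin_zero])
qed

section \<open>Characters of polynomial algebras\<close>

definition evs :: "('a \<Rightarrow> complex) \<Rightarrow> 'a sym \<Rightarrow> complex" where
  "evs \<rho> = cext (\<lambda>M. \<Prod>a\<in>#M. \<rho> a)"

lemma linc_evs: "linc (evs \<rho>)"
  by (simp add: evs_def linc_cext)

lemma evs_var: "evs \<rho> (bv {#a#}) = \<rho> a" and evs_1: "evs \<rho> 1 = 1"
  by (simp_all add: evs_def flip: single_one)

lemma evs_mult: "evs \<rho> (p * q) = evs \<rho> p * evs \<rho> q"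
proof -
  have l: "linc (\<lambda>q. c * evs \<rho> q)" "linc (\<lambda>q. evs \<rho> q * c)" for c
    by (auto simp: linc_def linc_add[OF linc_evs] linc_smul[OF linc_evs] algebra_simps)
  have 1: "evs \<rho> (bv M * q) = evs \<rho> (bv M) * evs \<rho> q" for M q
    by (rule linc_eqI[where f = "\<lambda>q. evs \<rho> (bv M * q)", OF linc_comp[OF linc_evs lin_mult_left] l(1)])
       (simp add: mult_single evs_def)
  show ?thesis
    by (rule linc_eqI[where f = "\<lambda>p. evs \<rho> (p * q)", OF linc_comp[OF linc_evs lin_mult_right] l(2)]) (rule 1)
qed

lemma evs_derivation_0:
  assumes "lin X" "\<And>p q. X (p * q) = X p * q + p * X q" "\<And>a. evs \<rho> (X (bv {#a#})) = 0"
  shows "evs \<rho> (X p) = 0"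
proof -
  have "X 1 = 0" using assms(2)[of 1 1] by simp
  then have "evs \<rho> (X (bv M)) = 0" for M
  proof (induction M)
    case (add a M)
    have "evs \<rho> (X (bv {#a#} * bv M)) = 0"
      using assms(2)[of "bv {#a#}" "bv M"] assms(3) add by (simp add: linc_add[OF linc_evs] evs_mult)
    then show ?case by (simp add: mult_single)
  qed (simp add: linc_0[OF linc_evs] flip: single_one)
  note 0 = this
  have z: "linc (\<lambda>_. 0)" by (simp add: linc_def)
  show ?thesis
    by (rule linc_eqI[where f = "\<lambda>p. evs \<rho> (X p)", OF linc_comp[OF linc_evs assms(1)] z]) (rule 0)
qed


section \<open>Laurent polynomials in two variables\<close>

type_synonym laurent2 = "int \<times> int \<Rightarrow>\<^sub>0 complex"

definition emb1 :: "laurent \<Rightarrow> laurent2" where "emb1 = lin_ext (\<lambda>i. bv (i, 0))"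
definition emb2 :: "laurent \<Rightarrow> laurent2" where "emb2 = lin_ext (\<lambda>i. bv (0, i))"
definition D1 :: "laurent2 \<Rightarrow> laurent2" where "D1 = lin_ext (\<lambda>(i, j). smul (of_int i) (bv (i, j)))"
definition D2 :: "laurent2 \<Rightarrow> laurent2" where "D2 = lin_ext (\<lambda>(i, j). smul (of_int j) (bv (i, j)))"

lemma lin2: "lin emb1" "lin emb2" "lin D1" "lin D2"
  by (simp_all add: emb1_def emb2_def D1_def D2_def lin_lin_ext)

lemma bilin_eqI:
  fixes f g :: "('a \<Rightarrow>\<^sub>0 complex) \<Rightarrow> ('b \<Rightarrow>\<^sub>0 complex) \<Rightarrow> ('c \<Rightarrow>\<^sub>0 complex)"
  assumes "\<And>q. lin (\<lambda>p. f p q)" "\<And>q. lin (\<lambda>p. g p q)" "\<And>p. lin (f p)" "\<And>p. lin (g p)"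
    "\<And>a b. f (bv a) (bv b) = g (bv a) (bv b)"
  shows "f p q = g p q"
proof -
  have "f (bv a) q = g (bv a) q" for a by (rule lin_eqI[OF assms(3,4)]) (rule assms(5))
  then show ?thesis by (rule lin_eqI[where f = "\<lambda>p. f p q", OF assms(1,2)])
qed

lemma emb_mult: "emb1 (g * h) = emb1 g * emb1 h" "emb2 (g * h) = emb2 g * emb2 h"
proof -
  show "emb1 (g * h) = emb1 g * emb1 h"
    by (rule bilin_eqI[where f = "\<lambda>g h. emb1 (g * h)" and g = "\<lambda>g h. emb1 g * emb1 h"])
       ((intro lin_comp[OF lin2(1)] lin_mult_left lin_mult_right lin_comp[OF lin_mult_left lin2(1)]
           lin_comp[OF lin_mult_right lin2(1)])+, simp add: emb1_def mult_single)
  show "emb2 (g * h) = emb2 g * emb2 h"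
    by (rule bilin_eqI[where f = "\<lambda>g h. emb2 (g * h)" and g = "\<lambda>g h. emb2 g * emb2 h"])
       ((intro lin_comp[OF lin2(2)] lin_mult_left lin_mult_right lin_comp[OF lin_mult_left lin2(2)]
           lin_comp[OF lin_mult_right lin2(2)])+, simp add: emb2_def mult_single)
qed

lemma D12_mult: "D1 (p * q) = D1 p * q + p * D1 q" "D2 (p * q) = D2 p * q + p * D2 q"
proof -
  show "D1 (p * q) = D1 p * q + p * D1 q"
    by (rule bilin_eqI[where f = "\<lambda>p q. D1 (p * q)" and g = "\<lambda>p q. D1 p * q + p * D1 q"])
       ((intro lin_comp[OF lin2(3)] lin_mult_left lin_mult_right lin_plus lin_comp[OF lin_mult_left lin2(3)]
           lin_comp[OF lin_mult_right lin2(3)])+, auto simp: D1_def mult_single algebra_simps simp flip: single_add)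
  show "D2 (p * q) = D2 p * q + p * D2 q"
    by (rule bilin_eqI[where f = "\<lambda>p q. D2 (p * q)" and g = "\<lambda>p q. D2 p * q + p * D2 q"])
       ((intro lin_comp[OF lin2(4)] lin_mult_left lin_mult_right lin_plus lin_comp[OF lin_mult_left lin2(4)]
           lin_comp[OF lin_mult_right lin2(4)])+, auto simp: D2_def mult_single algebra_simps simp flip: single_add)
qed

lemma D_emb: "D1 (emb1 g) = emb1 (D g)" "D2 (emb1 g) = 0" "D1 (emb2 g) = 0" "D2 (emb2 g) = emb2 (D g)"
proof -
  show "D1 (emb1 g) = emb1 (D g)"
    by (rule lin_eqI[where f = "\<lambda>g. D1 (emb1 g)", OF lin_comp[OF lin2(3,1)] lin_comp[OF lin2(1) lin_D]])
       (simp add: emb1_def D1_def)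
  show "D2 (emb2 g) = emb2 (D g)"
    by (rule lin_eqI[where f = "\<lambda>g. D2 (emb2 g)", OF lin_comp[OF lin2(4,2)] lin_comp[OF lin2(2) lin_D]])
       (simp add: emb2_def D2_def)
  show "D2 (emb1 g) = 0"
    by (rule lin_eqI[where f = "\<lambda>g. D2 (emb1 g)", OF lin_comp[OF lin2(4,1)] lin_zero])
       (simp add: emb1_def D2_def)
  show "D1 (emb2 g) = 0"
    by (rule lin_eqI[where f = "\<lambda>g. D1 (emb2 g)", OF lin_comp[OF lin2(3,2)] lin_zero])
       (simp add: emb2_def D1_def)
qed

lemma D12_commute: "D1 (D2 p) = D2 (D1 p)"
  by (rule lin_eqI[where f = "\<lambda>p. D1 (D2 p)", OF lin_comp[OF lin2(3,4)] lin_comp[OF lin2(4,3)]])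
     (auto simp: D1_def D2_def mult.commute)

text \<open>\<open>g\<close> acts on functions of two points of the line by moving both points.\<close>

definition X2 :: "laurent \<Rightarrow> laurent2 \<Rightarrow> laurent2" where
  "X2 g p = emb1 g * D1 p + emb2 g * D2 p"

lemma lin_X2: "lin (X2 g)"
  unfolding X2_def[abs_def] by (intro lin_plus lin_comp[OF lin_mult_left] lin2)

lemma lin_X2_left: "lin (\<lambda>g. X2 g p)"
  unfolding X2_def by (intro lin_plus lin_comp[OF lin_mult_right] lin2)

lemma X2_mult: "X2 g (p * q) = X2 g p * q + p * X2 g q"
  by (simp add: X2_def D12_mult algebra_simps)

lemma X2_bracket: "X2 (wbr g h) p = X2 g (X2 h p) - X2 h (X2 g p)"
  by (simp add: X2_def wbr_def D12_mult D_emb emb_mult lin_add[OF lin2(1)] lin_add[OF lin2(2)]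
      lin_diff[OF lin2(1)] lin_diff[OF lin2(2)] lin_add[OF lin2(3)] lin_add[OF lin2(4)] D12_commute algebra_simps)

definition dl :: laurent2 where "dl = emb1 (bv 1) - emb2 (bv 1)"

text \<open>The coefficients of an element killed by \<open>dl\<close> are constant along the lines
  of constant total degree, which contradicts finite support unless all are zero.\<close>

lemma dl_cancel: assumes "dl * p = 0" shows "p = 0"
proof (rule ccontr)
  assume "p \<noteq> 0"
  have sh: "Poly_Mapping.lookup (bv (c, d) * p) (a, b) = Poly_Mapping.lookup p (a - c, b - d)" for a b c d :: int and p :: laurent2
  proof -
    have "linc (\<lambda>p. Poly_Mapping.lookup (bv (c, d) * p) (a, b))" "linc (\<lambda>p. Poly_Mapping.lookup p (a - c, b - d))"
      by (auto simp: linc_def lookup_add distrib_left)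
    then show ?thesis by (rule linc_eqI) (auto simp: mult_single lookup_single when_def)
  qed
  have "Poly_Mapping.lookup (dl * p) (a, b) = Poly_Mapping.lookup p (a - 1, b) - Poly_Mapping.lookup p (a, b - 1)" for a b
    by (simp add: dl_def emb1_def emb2_def left_diff_distrib lookup_minus sh)
  then have step: "Poly_Mapping.lookup p (a - 1, b) = Poly_Mapping.lookup p (a, b - 1)" for a b
    using assms by simp
  have line: "Poly_Mapping.lookup p (a, b) = Poly_Mapping.lookup p (a + int n, b - int n)" for a b n
  proof (induction n)
    case (Suc n)
    then show ?case using step[of "a + int n + 1" "b - int n"] by (simp add: algebra_simps)
  qed simp
  from \<open>p \<noteq> 0\<close> obtain a b where "Poly_Mapping.lookup p (a, b) \<noteq> 0"
    by (metis poly_mapping_eqI lookup_zero surj_pair)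
  then have "(a + int n, b - int n) \<in> Poly_Mapping.keys p" for n using line[of a b n] by (simp add: in_keys_iff)
  then have "range (\<lambda>n. (a + int n, b - int n)) \<subseteq> Poly_Mapping.keys p" by blast
  moreover have "infinite (range (\<lambda>n. (a + int n, b - int n)))"
    using finite_imageD[of "\<lambda>n. (a + int n, b - int n)" "UNIV :: nat set"] infinite_UNIV_nat by (auto simp: inj_def)
  ultimately show False using finite_subset finite_keys by blast
qed

text \<open>The divided difference, written out on monomials.\<close>

definition dq :: "laurent \<Rightarrow> laurent2" where
  "dq = lin_ext (\<lambda>k. if k \<ge> 0 then \<Sum>a<nat k. bv (int a, k - 1 - int a) else - (\<Sum>a<nat (- k). bv (- 1 - int a, k + int a)))"

lemma lin_dq: "lin dq"
  by (simp add: dq_def lin_lin_ext)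

lemma dl_dq: "dl * dq g = emb1 g - emb2 g"
proof (rule lin_eqI[where f = "\<lambda>g. dl * dq g"])
  show "lin (\<lambda>g. dl * dq g)" by (rule lin_comp[OF lin_mult_left lin_dq])
  show "lin (\<lambda>g. emb1 g - emb2 g)" by (intro lin_subtract lin2)
  have dl: "dl * bv (a, b) = bv (a + 1, b) - bv (a, b + 1)" for a b
    by (simp add: dl_def emb1_def emb2_def left_diff_distrib mult_single add.commute)
  fix k :: int
  have "dl * dq (bv k) = bv (k, 0) - bv (0, k)"
  proof (cases "k \<ge> 0")
    case True
    have "dl * dq (bv k) = (\<Sum>a<nat k. bv (int (Suc a), k - int (Suc a)) - bv (int a, k - int a))"
      using True by (simp add: dq_def sum_distrib_left dl algebra_simps)
    also have "\<dots> = bv (int (nat k), k - int (nat k)) - bv (int 0, k - int 0)"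
      by (rule sum_lessThan_telescope[where f = "\<lambda>a. bv (int a, k - int a)"])
    finally show ?thesis using True by simp
  next
    case False
    have "dl * dq (bv k) = (\<Sum>a<nat (- k). bv (- int (Suc a), k + int (Suc a)) - bv (- int a, k + int a))"
      using False by (simp add: dq_def sum_distrib_left dl algebra_simps sum_negf[symmetric])
    also have "\<dots> = bv (- int (nat (- k)), k + int (nat (- k))) - bv (- int 0, k + int 0)"
      by (rule sum_lessThan_telescope[where f = "\<lambda>a. bv (- int a, k + int a)"])
    finally show ?thesis using False by simp
  qed
  then show "dl * dq (bv k) = emb1 (bv k) - emb2 (bv k)" by (simp add: emb1_def emb2_def)
qed

lemma dq_unique: "dl * p = emb1 g - emb2 g \<Longrightarrow> p = dq g"
  using dl_cancel[of "p - dq g"] dl_dq[of g] by (simp add: right_diff_distrib)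

lemma dq_mult: "dq (g * h) = emb1 g * dq h + dq g * emb2 h"
proof (rule dq_unique[symmetric])
  have "dl * (emb1 g * dq h + dq g * emb2 h) = emb1 g * (dl * dq h) + (dl * dq g) * emb2 h"
    by (simp add: algebra_simps)
  also have "\<dots> = emb1 (g * h) - emb2 (g * h)" unfolding dl_dq by (simp add: emb_mult algebra_simps)
  finally show "dl * (emb1 g * dq h + dq g * emb2 h) = emb1 (g * h) - emb2 (g * h)" .
qed

text \<open>The cocycle \<open>X2 g (log (t\<^sub>1 - t\<^sub>2))\<close>; it is not a coboundary, because the logarithm is no Laurent polynomial.\<close>

definition cocyc :: "laurent \<Rightarrow> laurent2" where "cocyc g = dq (bv 1 * g)"

lemma lin_cocyc: "lin cocyc"
  unfolding cocyc_def[abs_def] by (rule lin_comp[OF lin_dq lin_mult_left])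

text \<open>In effect \<open>cocyc g\<close> is \<open>X2 g dl / dl\<close>. In
  \<open>X2 g (cocyc h)\<close> the quadratic term \<open>cocyc g * cocyc h\<close> is symmetric and
  drops out of the commutator. Denominators are avoided by comparing both sides after multiplication
  by \<open>dl\<close> twice, which is injective.\<close>

lemma cocyc_bracket: "X2 g (cocyc h) - X2 h (cocyc g) = cocyc (wbr g h)"
proof -
  let ?G = "bv 1 * g" and ?H = "bv 1 * h"
  have X1: "X2 g (emb1 p) = emb1 (g * D p)" "X2 g (emb2 p) = emb2 (g * D p)" for g p
    by (simp_all add: X2_def D_emb emb_mult)
  have Xdl: "X2 g dl = emb1 (bv 1 * g) - emb2 (bv 1 * g)" for g
    by (simp add: dl_def lin_diff[OF lin_X2] X1 mult.commute)
  have c: "dl * cocyc g = emb1 (bv 1 * g) - emb2 (bv 1 * g)" for g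
    unfolding cocyc_def by (rule dl_dq)
  have Xc: "dl * (dl * X2 g (cocyc h)) = dl * (emb1 (g * D (bv 1 * h)) - emb2 (g * D (bv 1 * h))) -
      (dl * cocyc g) * (dl * cocyc h)" for g h
  proof -
    have "X2 g (dl * cocyc h) = emb1 (g * D (bv 1 * h)) - emb2 (g * D (bv 1 * h))"
      unfolding c by (simp add: lin_diff[OF lin_X2] X1)
    moreover have "X2 g (dl * cocyc h) = dl * cocyc g * cocyc h + dl * X2 g (cocyc h)"
      unfolding X2_mult Xdl c[of g] ..
    ultimately have "dl * X2 g (cocyc h) = emb1 (g * D (bv 1 * h)) - emb2 (g * D (bv 1 * h)) - dl * cocyc g * cocyc h"
      by (simp add: algebra_simps)
    from arg_cong[OF this, of "(*) dl"] show ?thesis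
      unfolding right_diff_distrib by (simp only: ac_simps)
  qed
  have br: "g * D ?H - h * D ?G = bv 1 * wbr g h"
    by (simp add: wbr_def D_mult algebra_simps)
  have "dl * (dl * (X2 g (cocyc h) - X2 h (cocyc g))) =
      dl * ((emb1 (g * D ?H) - emb1 (h * D ?G)) - (emb2 (g * D ?H) - emb2 (h * D ?G)))"
    by (simp only: right_diff_distrib[of dl] Xc) (simp add: algebra_simps)
  also have "(emb1 (g * D ?H) - emb1 (h * D ?G)) - (emb2 (g * D ?H) - emb2 (h * D ?G)) = dl * cocyc (wbr g h)"
    unfolding c br[symmetric] lin_diff[OF lin2(1)] lin_diff[OF lin2(2)] ..
  finally have "dl * (dl * (X2 g (cocyc h) - X2 h (cocyc g) - cocyc (wbr g h))) = 0"
    by (simp add: right_diff_distrib)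
  from dl_cancel[OF dl_cancel[OF this]] show ?thesis by simp
qed


section \<open>The dual module\<close>

text \<open>On polynomials in the functions of two points and the functions of one further point, \<open>Vir\<close> acts by
  derivations, twisted by the cocycle. A character of the polynomial algebra is a vector of the dual
  module on which \<open>Vir\<^sup>f\<close> acts by prescribed scalars.\<close>

type_synonym sym2 = "((int \<times> int) + int) sym"

definition i2 :: "laurent2 \<Rightarrow> sym2" where "i2 = lin_ext (\<lambda>a. bv {#Inl a#})"
definition i3 :: "laurent \<Rightarrow> sym2" where "i3 = lin_ext (\<lambda>a. bv {#Inr a#})"

definition XB :: "laurent \<Rightarrow> sym2 \<Rightarrow> sym2" where
  "XB g = deriv (\<lambda>a. case a of Inl b \<Rightarrow> i2 (X2 g (bv b)) | Inr j \<Rightarrow> i3 (g * D (bv j)))"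

definition TB :: "laurent \<Rightarrow> sym2 \<Rightarrow> sym2" where
  "TB g p = XB g p + i2 (cocyc g) * p"

lemma lin_i: "lin i2" "lin i3"
  by (simp_all add: i2_def i3_def lin_lin_ext)

lemma lin_XB: "lin (XB g)"
  by (simp add: XB_def lin_deriv)

lemma XB_mult: "XB g (p * q) = XB g p * q + p * XB g q"
  by (simp add: XB_def deriv_mult)

lemma XB_i2: "XB g (i2 p) = i2 (X2 g p)"
  by (rule lin_eqI[where f = "\<lambda>p. XB g (i2 p)", OF lin_comp[OF lin_XB lin_i(1)] lin_comp[OF lin_i(1) lin_X2]])
     (simp add: XB_def i2_def deriv_var)

lemma XB_i3: "XB g (i3 p) = i3 (g * D p)"
  by (rule lin_eqI[where f = "\<lambda>p. XB g (i3 p)", OF lin_comp[OF lin_XB lin_i(2)]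
        lin_comp[OF lin_i(2) lin_comp[OF lin_mult_left lin_D]]])
     (simp add: XB_def i3_def deriv_var del: D_single)

lemma i_var: "i2 (bv b) = bv {#Inl b#}" "i3 (bv j) = bv {#Inr j#}"
  by (simp_all add: i2_def i3_def)

text \<open>The difference of the two sides is a derivation in \<open>p\<close>, so it only has to
  vanish on the variables.\<close>

lemma XB_bracket: "XB (wbr g h) p = XB g (XB h p) - XB h (XB g p)"
proof -
  let ?X = "\<lambda>p. XB (wbr g h) p - (XB g (XB h p) - XB h (XB g p))"
  have "?X p = 0"
  proof (rule derivation_0[where X = ?X])
    show "lin ?X" by (intro lin_subtract lin_comp[OF lin_XB lin_XB] lin_XB)
    show "?X (p * q) = ?X p * q + p * ?X q" for p q
      by (simp add: XB_mult lin_add[OF lin_XB] algebra_simps)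
    show "?X (bv {#a#}) = 0" for a
    proof (cases a)
      case (Inl b)
      then show ?thesis
        by (simp only: i_var[symmetric] XB_i2 X2_bracket lin_diff[OF lin_i(1)]) simp
    next
      case (Inr j)
      have "wbr g h * D (bv j) = g * D (h * D (bv j)) - h * D (g * D (bv j))"
        unfolding wbr_def D_mult by (simp add: algebra_simps del: D_single)
      then show ?thesis unfolding Inr
        by (simp only: i_var[symmetric] XB_i3 lin_diff[OF lin_i(2)]) simp
    qed
  qed
  then show ?thesis by simp
qed

lemma TB_bracket: "TB (wbr g h) p = TB g (TB h p) - TB h (TB g p)"
  by (simp add: TB_def XB_bracket XB_mult lin_add[OF lin_XB] XB_i2 lin_diff[OF lin_i(1)] algebra_simps
      flip: cocyc_bracket)

lemma lin_TB: "lin (TB g)"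
  unfolding TB_def[abs_def] by (intro lin_plus lin_XB lin_mult_left)

lemma lin_TB_left: "lin (\<lambda>g. TB g p)"
proof -
  have "lin (\<lambda>g. XB g p)"
  proof -
    have "lin (\<lambda>g. case a of Inl b \<Rightarrow> i2 (X2 g (bv b)) | Inr j \<Rightarrow> i3 (g * D (bv j)))" for a
      by (cases a) (auto intro: lin_comp[OF lin_i(1) lin_X2_left] lin_comp[OF lin_i(2) lin_mult_right] simp del: D_single)
    then have "lin (\<lambda>g. (case a of Inl b \<Rightarrow> i2 (X2 g (bv b)) | Inr j \<Rightarrow> i3 (g * D (bv j))) * q)" for a q
      by (rule lin_comp[OF lin_mult_right])
    then have *: "lin (\<lambda>g. \<Sum>a\<in>#M. (case a of Inl b \<Rightarrow> i2 (X2 g (bv b)) | Inr j \<Rightarrow> i3 (g * D (bv j))) * bv (M' - {#a#}))" for M M'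
      by (induction M) (simp_all add: lin_zero lin_plus)
    show ?thesis unfolding XB_def deriv_def lin_ext_def by (intro lin_setsum lin_scale *)
  qed
  then show ?thesis unfolding TB_def by (intro lin_plus lin_comp[OF lin_mult_right] lin_comp[OF lin_i(1) lin_cocyc])
qed

context
  fixes f :: "complex poly" and \<mu> :: "vir \<Rightarrow> complex" and r2 :: "laurent2 \<Rightarrow> complex" and r3 :: "laurent \<Rightarrow> complex"
  assumes r2: "linc r2" and r3: "linc r3"
    and r2_X: "\<And>v p. v \<in> vir_sub f \<Longrightarrow> r2 (X2 (lg v) p) = 0"
    and r3_X: "\<And>v p. v \<in> vir_sub f \<Longrightarrow> r3 (lg v * p) = 0"
    and r2_c: "\<And>v. v \<in> vir_sub f \<Longrightarrow> r2 (cocyc (lg v)) = - \<mu> v"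
begin

definition chi :: "sym2 \<Rightarrow> complex" where
  "chi = evs (\<lambda>a. case a of Inl b \<Rightarrow> r2 (bv b) | Inr j \<Rightarrow> r3 (bv j))"

lemma chi_i: "chi (i2 p) = r2 p" "chi (i3 g) = r3 g"
proof -
  show "chi (i2 p) = r2 p"
    by (rule linc_eqI[where f = "\<lambda>p. chi (i2 p)", OF _ r2])
       (simp_all add: chi_def linc_comp[OF linc_evs lin_i(1)] i_var evs_var)
  show "chi (i3 g) = r3 g"
    by (rule linc_eqI[where f = "\<lambda>p. chi (i3 p)", OF _ r3])
       (simp_all add: chi_def linc_comp[OF linc_evs lin_i(2)] i_var evs_var)
qed

lemma chi_simps: "linc chi" "chi 1 = 1" "chi (p * q) = chi p * chi q"
  by (simp_all add: chi_def linc_evs evs_1 evs_mult)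

text \<open>The conditions on \<open>r2\<close> and \<open>r3\<close> say that
  \<open>Vir\<^sup>f\<close> fixes the point \<open>chi\<close>, so the derivation part contributes
  nothing and the whole eigenvalue comes from the twist.\<close>

lemma chi_T: assumes v: "v \<in> vir_sub f" shows "chi (TB (lg v) p) = - \<mu> v * chi p"
proof -
  have "chi (XB (lg v) p) = 0"
    unfolding chi_def
  proof (rule evs_derivation_0[OF lin_XB XB_mult])
    fix a
    show "evs (\<lambda>a. case a of Inl b \<Rightarrow> r2 (bv b) | Inr j \<Rightarrow> r3 (bv j)) (XB (lg v) (bv {#a#})) = 0"
      unfolding chi_def[symmetric]
      by (cases a) (auto simp: i_var[symmetric] XB_i2 XB_i3 chi_i r2_X[OF v] r3_X[OF v] simp del: D_single)
  qed
  then show ?thesis by (simp add: TB_def linc_add[OF chi_simps(1)] chi_simps chi_i r2_c[OF v])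
qed

text \<open>The word \<open>x\<^sub>1\<dots>x\<^sub>m\<close> acts on the dual module, hence the reversal and the signs.\<close>

definition th :: "free_alg \<Rightarrow> sym2 \<Rightarrow> sym2" where
  "th p b = lin_ext (\<lambda>w. fold (\<lambda>v b. - TB (lg v) b) (letters w) b) p"

lemma lin_fold_T: "lin (fold (\<lambda>v b. - TB (lg v) b) vs)"
proof (induction vs)
  case (Cons v vs)
  show ?case using lin_comp[OF Cons lin_uminus[OF lin_TB[of "lg v"]]] by (simp add: comp_def)
qed (simp add: lin_id id_def)

lemma lin_th: "lin (\<lambda>p. th p b)" "lin (th p)"
  unfolding th_def[abs_def] by (rule lin_lin_ext, unfold lin_ext_def, intro lin_setsum lin_scale lin_fold_T)

lemma th_mult: "th (p * q) b = th q (th p b)"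
  by (rule bilin_eqI[where f = "\<lambda>p q. th (p * q) b" and g = "\<lambda>p q. th q (th p b)"])
     ((intro lin_comp[OF lin_th(1)] lin_mult_left lin_mult_right lin_comp[OF lin_th(2) lin_th(1)] lin_th)+,
      simp add: th_def mult_single plus_word_def)

lemma th_gen: "th (gen v) b = - TB (lg v) b"
  by (simp add: th_def)

lemma th_1: "th 1 b = b"
  by (simp add: th_def zero_word_def flip: single_one)

lemma th_const: "th (Poly_Mapping.single 0 c) b = smul c b"
  by (simp add: th_def zero_word_def)

lemma th_rels: assumes "r \<in> env_rels UNIV" shows "th r b = 0"
  using assms unfolding env_rels_def
proof (elim UnE CollectE exE conjE)
  fix x y assume "r = gen (x + y) - (gen x + gen y)"
  then show ?thesis
    by (simp add: lin_diff[OF lin_th(1)] lin_add[OF lin_th(1)] th_gen lin_add[OF lin_lg] lin_add[OF lin_TB_left])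
next
  fix c x assume "r = gen (smul c x) - smul c (gen x)"
  then show ?thesis
    by (simp add: lin_diff[OF lin_th(1)] lin_smul[OF lin_th(1)] th_gen lin_smul[OF lin_lg] lin_smul[OF lin_TB_left]
        del: smul_single)
next
  fix x y assume "r = gen x * gen y - gen y * gen x - gen (bracket x y)"
  then show ?thesis
    by (simp add: lin_diff[OF lin_th(1)] th_mult th_gen lg_bracket TB_bracket lin_minus[OF lin_TB])
qed

text \<open>In the dual module \<open>p\<close> sends \<open>chi\<close> to the functional taking
  \<open>b\<close> to \<open>chi (th p b)\<close>. Since \<open>chi\<close> is an eigenvector of
  \<open>Vir\<^sup>f\<close> with eigenvalue \<mu>, the left ideal annihilates it.\<close>

lemma th_J: assumes "p \<in> J f \<mu>" shows "chi (th p b) = 0"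
proof (rule linc_span_zero[where f = "\<lambda>p. chi (th p b)", OF linc_comp[OF chi_simps(1) lin_th(1)] assms[unfolded J_def]])
  fix a assume "a \<in> {bv u * r * bv w | u r w. r \<in> env_rels UNIV} \<union>
     {bv u * (gen x - Poly_Mapping.single 0 (\<mu> x)) | u x. x \<in> vir_sub f}"
  then show "chi (th a b) = 0"
  proof (elim UnE CollectE exE conjE)
    fix u r w assume "a = bv u * r * bv w" "r \<in> env_rels UNIV"
    then show ?thesis by (simp add: th_mult th_rels lin_0[OF lin_th(2)] linc_0[OF chi_simps(1)])
  next
    fix u x assume "a = bv u * (gen x - Poly_Mapping.single 0 (\<mu> x))" "x \<in> vir_sub f"
    then show ?thesis
      by (simp add: th_mult lin_diff[OF lin_th(1)] th_gen th_const linc_diff[OF chi_simps(1)] linc_minus[OF chi_simps(1)]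
          linc_smul[OF chi_simps(1)] chi_T)
  qed
qed

lemma one_notin_J: "1 \<notin> J f \<mu>"
  using th_J[of 1 1] by (auto simp: th_1 chi_simps)

text \<open>If \<open>v\<close> acts by a scalar on the cyclic vector, then also on
  \<open>chi\<close>. Comparing the test elements 1 and \<open>i3 p\<close> cancels the twist and
  leaves only the motion of the further point.\<close>

lemma gen_notin_J:
  assumes "gen v - Poly_Mapping.single 0 c \<in> J f \<mu>" shows "r3 (lg v * D p) = 0"
proof -
  have chi: "chi (TB (lg v) b) = - c * chi b" for b
  proof -
    have "- chi (TB (lg v) b) - c * chi b = 0"
      using th_J[OF assms, of b]
      by (simp add: lin_diff[OF lin_th(1)] th_gen th_const linc_diff[OF chi_simps(1)] linc_minus[OF chi_simps(1)]
          linc_smul[OF chi_simps(1)])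
    then show ?thesis by (simp add: algebra_simps) (metis add_diff_cancel_left' add.inverse_inverse diff_0)
  qed
  have XB1: "XB (lg v) 1 = 0" by (simp add: XB_def deriv_1)
  have "r2 (cocyc (lg v)) = - c"
    using chi[of 1] by (simp add: TB_def XB1 chi_simps chi_i)
  then show ?thesis
    using chi[of "i3 p"] by (simp add: TB_def XB_i3 linc_add[OF chi_simps(1)] chi_simps chi_i)
qed

end


section \<open>Localization\<close>

lemma (in vmod) T_sum:
  assumes "p \<in> C" shows "finite I \<Longrightarrow> T (\<Sum>i\<in>I. g i) p \<approx> (\<Sum>i\<in>I. T (g i) p)"
proof (induction I rule: finite_induct)
  case empty
  show ?case using T_scale[OF assms, of 0 0] by simp
next
  case (insert i I)
  have "T (g i + sum g I) p \<approx> T (g i) p + T (sum g I) p" by (rule T_plus[OF assms])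
  also have "\<dots> \<approx> T (g i) p + (\<Sum>i\<in>I. T (g i) p)" using insert by (intro eqS_add eqS_refl)
  finally show ?case using insert by simp
qed

text \<open>The offset 2 is the order of vanishing, in powers of \<open>f\<close>, at which
  characters die; each letter adds one, because a bracket costs one order.\<close>

definition dep :: "free_alg \<Rightarrow> nat \<Rightarrow> bool" where
  "dep p N \<longleftrightarrow> (\<forall>w\<in>Poly_Mapping.keys p. length (letters w) + 2 \<le> N)"

lemma dep_exists: "\<exists>N. dep p N"
proof -
  have "finite ((\<lambda>w. length (letters w) + 2) ` Poly_Mapping.keys p)" by simp
  then show ?thesis unfolding dep_def finite_nat_set_iff_bounded_le by blast
qed

lemma dep_mono: "dep p N \<Longrightarrow> N \<le> N' \<Longrightarrow> dep p N'"
  by (auto simp: dep_def)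

lemma dep_gen: assumes "dep p N" shows "dep (gen v * p) (Suc N)"
  unfolding dep_def
proof
  fix w assume "w \<in> Poly_Mapping.keys (gen v * p)"
  then obtain a b where "a \<in> Poly_Mapping.keys (gen v)" "b \<in> Poly_Mapping.keys p" "w = a + b"
    using keys_mult[of "gen v" p] by blast
  then show "length (letters w) + 2 \<le> Suc N" using assms by (auto simp: dep_def plus_word_def)
qed

lemma J_kill:
  assumes f0: "coeff f 0 \<noteq> 0" and mu: "lie_char (vir_sub f) \<mu>" and "dep p N" "LP f ^ N dvd lg y"
  shows "gen y * p \<in> J f \<mu>"
proof -
  interpret vmod UNIV "J f \<mu>" "\<lambda>v p. gen v * p" by (rule vmod_J)
  have words: "gen y * bv (Word ls) \<in> J f \<mu>" if "LP f ^ (length ls + 2) dvd lg y" for ls y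
    using that
  proof (induction ls arbitrary: y)
    case Nil
    then have "\<mu> y = 0" using Nil char_square[OF f0 mu, of y] by (simp add: power2_eq_square)
    moreover have "y \<in> vir_sub f" using Nil by (auto simp: vir_sub_iff intro: dvd_trans[OF dvd_power[of 2 "LP f"]])
    ultimately show ?case using J_char[of y f 1 \<mu>] by (simp flip: zero_word_def)
  next
    case (Cons x ls)
    let ?W = "bv (Word ls) :: free_alg"
    have "LP f ^ (length ls + 2) dvd lg y" using Cons.prems by (auto intro: dvd_trans[OF le_imp_power_dvd])
    then have 1: "gen x * (gen y * ?W) \<in> J f \<mu>" by (intro J_left Cons.IH)
    have "LP f ^ (length ls + 2) dvd lg (bracket y x)"
      unfolding lg_bracket using Cons.prems by (intro wbr_dvd_left) simp
    then have 2: "gen (bracket y x) * ?W \<in> J f \<mu>" by (rule Cons.IH)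
    have "gen y * (gen x * ?W) - gen x * (gen y * ?W) \<in> J f \<mu>"
      using eqS_S[OF T_bracket[of ?W y x]] 2 by simp
    from pm.subspace_add[OF subspace_J this 1] have "gen y * (gen x * ?W) \<in> J f \<mu>" by simp
    then show ?case by (simp add: mult_single plus_word_def)
  qed
  show ?thesis
  proof (rule lin_mem_subspace[OF lin_mult_left subspace_J])
    fix w assume "w \<in> Poly_Mapping.keys p"
    then have "length (letters w) + 2 \<le> N" using assms(3) unfolding dep_def by blast
    then have "LP f ^ (length (letters w) + 2) dvd lg y"
      by (intro dvd_trans[OF le_imp_power_dvd assms(4)])
    from words[OF this] show "gen y * bv w \<in> J f \<mu>" by simp
  qed
qed

lemma J_cong:
  assumes f0: "coeff f 0 \<noteq> 0" and mu: "lie_char (vir_sub f) \<mu>" and "dep p N" "LP f ^ N dvd lg y - lg z"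
  shows "eqm (J f \<mu>) (gen y * p) (gen z * p)"
proof -
  interpret vmod UNIV "J f \<mu>" "\<lambda>v p. gen v * p" by (rule vmod_J)
  have "gen (y - z) * p \<in> J f \<mu>" using assms by (intro J_kill[OF f0 mu]) (simp_all add: lin_diff[OF lin_lg])
  then show ?thesis using eqS_S[OF T_minus[of p y z]] by (simp add: eqm_def)
qed

locale decomp = roots +
  fixes f :: "complex poly" and \<mu> :: "vir \<Rightarrow> complex" and a :: complex and mus :: "nat \<Rightarrow> vir \<Rightarrow> complex"
  assumes dec: "decomposition f \<mu> a k lam ns mus"
begin

declare One_nat_def [simp del] atLeastAtMost_iff [simp del]

abbreviation I where "I \<equiv> {1..k}"
abbreviation fi where "fi i \<equiv> linpow (lam i) (ns i)"

lemma a0: "a \<noteq> 0" and f_eq: "f = Polynomial.smult a (\<Prod>i=1..k. fi i)"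
  and mus_char: "i \<in> I \<Longrightarrow> lie_char (vir_sub (fi i)) (mus i)"
  and mu_sum: "v \<in> vir_sub f \<Longrightarrow> \<mu> v = (\<Sum>i\<in>I. mus i v)"
  using dec by (auto simp: decomposition_def)

lemma LPf: "LP f ^ N dvd g \<longleftrightarrow> F ^ N dvd g"
  by (subst f_eq) (simp only: LP_prod smul_dvd_iff[OF a0])

lemma sub_f: "v \<in> vir_sub f \<longleftrightarrow> F dvd lg v"
  using LPf[of 1 "lg v"] by (simp add: vir_sub_iff)

lemma LPfi: "LP (fi i) = A i"
  by (simp add: LP_power A_def)

lemma sub_fi: "v \<in> vir_sub (fi i) \<longleftrightarrow> A i dvd lg v"
  by (simp add: vir_sub_iff LPfi)

lemma f0: "coeff f 0 \<noteq> 0"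
  using a0 poly_prod_0 by (subst f_eq) (simp flip: poly_0_coeff_0)

lemma fi0: "i \<in> I \<Longrightarrow> coeff (fi i) 0 \<noteq> 0"
  by (rule poly_0_linpow[OF lam_0])

lemma sub_f_fi: "i \<in> I \<Longrightarrow> v \<in> vir_sub f \<Longrightarrow> v \<in> vir_sub (fi i)"
  using A_dvd_F[of i 1] by (auto simp: sub_f sub_fi intro: dvd_trans)

lemma mu_char: "lie_char (vir_sub f) \<mu>"
  unfolding lie_char_def
proof (intro conjI ballI allI)
  fix x c assume x: "x \<in> vir_sub f"
  show "\<mu> (smul c x) = c * \<mu> x"
    using x vir_sub_closed(2)[OF x] char_smul[OF fi0 mus_char sub_f_fi[OF _ x]]
    by (simp add: mu_sum sum_distrib_left)
  fix y assume y: "y \<in> vir_sub f"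
  show "\<mu> (x + y) = \<mu> x + \<mu> y"
    using x y vir_sub_closed(1)[OF x y] char_add[OF fi0 mus_char sub_f_fi[OF _ x] sub_f_fi[OF _ y]]
    by (simp add: mu_sum sum.distrib)
  show "\<mu> (bracket x y) = 0"
    using x y bracket_vir_sub[OF x y] char_bracket[OF fi0 mus_char sub_f_fi[OF _ x] sub_f_fi[OF _ y]]
    by (simp add: mu_sum)
qed

sublocale Jm: vmod UNIV "J f \<mu>" "\<lambda>v p. gen v * p"
  by (rule vmod_J)

abbreviation eqJ (infix \<open>\<simeq>\<close> 50) where "p \<simeq> q \<equiv> eqm (J f \<mu>) p q"

lemma gen_cong: "dep p N \<Longrightarrow> F ^ N dvd lg y - lg z \<Longrightarrow> gen y * p \<simeq> gen z * p"
  using J_cong[OF f0 mu_char] by (simp add: LPf)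

lemma gen_kill: "dep p N \<Longrightarrow> F ^ N dvd lg y \<Longrightarrow> gen y * p \<in> J f \<mu>"
  using J_kill[OF f0 mu_char] by (simp add: LPf)

text \<open>The part of \<open>v\<close> at the \<open>i\<close>-th root, as it acts on vectors of bounded depth.\<close>

definition cut :: "nat \<Rightarrow> nat \<Rightarrow> vir \<Rightarrow> vir" where "cut i N v = e_of (ep i N * lg v)"

text \<open>The cutoff is taken from the length of each word, which makes the map linear on the
  whole free algebra. A larger cutoff gives the same result modulo \<open>J f \<mu>\<close>.\<close>

definition locT :: "nat \<Rightarrow> vir \<Rightarrow> free_alg \<Rightarrow> free_alg" where
  "locT i v = lin_ext (\<lambda>w. gen (cut i (length (letters w) + 2) v) * bv w)"

lemma lg_cut [simp]: "lg (cut i N v) = ep i N * lg v"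
  by (simp add: cut_def)

lemma lin_cut: "lin (cut i N)"
  unfolding cut_def[abs_def] by (rule lin_comp[OF lin_e_of lin_comp[OF lin_mult_left lin_lg]])

lemma lin_locT: "lin (locT i v)"
  by (simp add: locT_def lin_lin_ext)

lemma ep_diff: assumes "i \<in> I" "M \<le> N" shows "F ^ M dvd ep i M - ep i N"
proof (rule F_dvd)
  fix j assume j: "j \<in> I"
  have N: "A j ^ M dvd A j ^ N" using assms(2) by (rule le_imp_power_dvd)
  show "A j ^ M dvd ep i M - ep i N"
  proof (cases "j = i")
    case True
    have "A j ^ M dvd ep i M - 1" "A j ^ M dvd ep i N - 1"
      using ep[OF assms(1)] N unfolding True by (blast intro: dvd_trans)+
    from dvd_diff[OF this] show ?thesis by simp
  next
    case False
    then show ?thesis using ep_other[OF assms(1) j False] N by (intro dvd_diff) (auto intro: dvd_trans)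
  qed
qed

lemma locT_eq: assumes "i \<in> I" "dep p N" shows "locT i v p \<simeq> gen (cut i N v) * p"
  unfolding eqm_def
proof (rule lin_mem_subspace[where f = "\<lambda>p. locT i v p - gen (cut i N v) * p", OF _ subspace_J])
  show "lin (\<lambda>p. locT i v p - gen (cut i N v) * p)" by (intro lin_subtract lin_locT lin_mult_left)
  fix w assume "w \<in> Poly_Mapping.keys p"
  then have w: "length (letters w) + 2 \<le> N" using assms(2) by (simp add: dep_def)
  have "gen (cut i (length (letters w) + 2) v) * bv w \<simeq> gen (cut i N v) * bv w"
    by (rule gen_cong[of _ "length (letters w) + 2"])
       (use ep_diff[OF assms(1) w] in \<open>auto simp: dep_def dvd_mult2 simp flip: left_diff_distrib\<close>)
  then show "locT i v (bv w) - gen (cut i N v) * bv w \<in> J f \<mu>" by (simp add: locT_def eqm_def)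
qed

lemma locT_J: "i \<in> I \<Longrightarrow> p \<in> J f \<mu> \<Longrightarrow> locT i v p \<in> J f \<mu>"
  using locT_eq dep_exists J_left Jm.eqS_S by meson

lemma locT_cong: "i \<in> I \<Longrightarrow> p \<simeq> q \<Longrightarrow> locT i v p \<simeq> locT i v q"
  using locT_J[of i "p - q" v] by (simp add: eqm_def lin_diff[OF lin_locT])

lemma locT_locT:
  assumes "i \<in> I" "j \<in> I" "dep p N"
  shows "locT i v (locT j w p) \<simeq> gen (cut i (Suc N) v) * (gen (cut j (Suc N) w) * p)"
proof -
  have "locT i v (locT j w p) \<simeq> locT i v (gen (cut j (Suc N) w) * p)"
    using assms by (intro locT_cong locT_eq dep_mono[OF assms(3)]) auto
  also have "\<dots> \<simeq> gen (cut i (Suc N) v) * (gen (cut j (Suc N) w) * p)"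
    by (intro locT_eq assms(1) dep_gen assms(3))
  finally show ?thesis .
qed

lemma vmod_locT: assumes i: "i \<in> I" shows "vmod UNIV (J f \<mu>) (locT i)"
proof
  fix p :: free_alg and v w c
  obtain N where N: "dep p N" using dep_exists by blast
  have N': "dep p (Suc N)" using N by (rule dep_mono) simp
  note e = locT_eq[OF i N']
  have "locT i (v + w) p \<simeq> gen (cut i (Suc N) v + cut i (Suc N) w) * p"
    using e[of "v + w"] by (simp add: lin_add[OF lin_cut])
  also have "\<dots> \<simeq> gen (cut i (Suc N) v) * p + gen (cut i (Suc N) w) * p"
    by (rule Jm.T_plus) simp
  also have "\<dots> \<simeq> locT i v p + locT i w p"
    by (intro Jm.eqS_add Jm.eqS_sym[OF e])
  finally show "locT i (v + w) p \<simeq> locT i v p + locT i w p" .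
  have "locT i (smul c v) p \<simeq> gen (smul c (cut i (Suc N) v)) * p"
    using e[of "smul c v"] by (simp add: lin_smul[OF lin_cut])
  also have "\<dots> \<simeq> smul c (gen (cut i (Suc N) v) * p)"
    by (rule Jm.T_scale) simp
  also have "\<dots> \<simeq> smul c (locT i v p)" by (intro Jm.eqS_smul Jm.eqS_sym[OF e])
  finally show "locT i (smul c v) p \<simeq> smul c (locT i v p)" .
  \<comment> \<open>The localizing factor is idempotent modulo \<open>F ^ Suc N\<close>, and the
    bracket of two multiples of it carries its square. The extra order over \<open>N\<close> allows
    for the letter added by the first of two actions.\<close>
  have "F ^ Suc N dvd (ep i (Suc N) - ep i (Suc N) ^ 2)"
  proof (rule F_dvd)
    fix j assume j: "j \<in> I"
    have "ep i (Suc N) - ep i (Suc N) ^ 2 = ep i (Suc N) * (ep i (Suc N) - 1) * (- 1)"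
      by (simp add: power2_eq_square algebra_simps)
    then show "A j ^ Suc N dvd ep i (Suc N) - ep i (Suc N) ^ 2"
      using ep[OF i, of "Suc N"] ep_other[OF i j, of "Suc N"] by (cases "j = i") (auto simp: dvd_mult dvd_mult2 simp del: power_Suc)
  qed
  then have "gen (cut i (Suc N) (bracket v w)) * p \<simeq> gen (bracket (cut i (Suc N) v) (cut i (Suc N) w)) * p"
    by (intro gen_cong[OF N'])
       (simp add: lg_bracket wbr_mult_self dvd_mult2 flip: left_diff_distrib del: power_Suc)
  also have "\<dots> \<simeq> gen (cut i (Suc N) v) * (gen (cut i (Suc N) w) * p) - gen (cut i (Suc N) w) * (gen (cut i (Suc N) v) * p)"
    by (intro Jm.T_bracket) simp
  also have "\<dots> \<simeq> locT i v (locT i w p) - locT i w (locT i v p)"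
    by (intro Jm.eqS_diff Jm.eqS_sym[OF locT_locT[OF i i N]])
  finally show "locT i (bracket v w) p \<simeq> locT i v (locT i w p) - locT i w (locT i v p)"
    by (rule Jm.eqS_trans[OF e])
qed (auto simp: subspace_J lin_locT intro: locT_J[OF i])

text \<open>At every root at least one of the two cut fields vanishes to high order, so their
  bracket acts by zero. The bracket loses one order, hence the cutoff \<open>Suc N\<close>.\<close>

lemma locT_commute:
  assumes "i \<in> I" "j \<in> I" "i \<noteq> j"
  shows "locT i v (locT j w p) \<simeq> locT j w (locT i v p)"
proof -
  obtain N where N: "dep p N" using dep_exists by blast
  let ?V = "cut i (Suc N) v" and ?W = "cut j (Suc N) w"
  have "F ^ N dvd lg (bracket ?V ?W)"
    unfolding lg_bracket
  proof (rule F_dvd)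
    fix l assume l: "l \<in> I"
    show "A l ^ N dvd wbr (lg ?V) (lg ?W)"
    proof (cases "l = i")
      case True
      then show ?thesis using ep_other[OF assms(2) l, of "Suc N"] assms(3)
        by (intro wbr_dvd_right) (simp add: dvd_mult2 del: power_Suc)
    next
      case False
      then show ?thesis using ep_other[OF assms(1) l, of "Suc N"]
        by (intro wbr_dvd_left) (simp add: dvd_mult2 del: power_Suc)
    qed
  qed
  then have "gen (bracket ?V ?W) * p \<in> J f \<mu>" by (rule gen_kill[OF N])
  then have "gen ?V * (gen ?W * p) - gen ?W * (gen ?V * p) \<in> J f \<mu>"
    using Jm.eqS_S[OF Jm.T_bracket[of p ?V ?W]] by simp
  then have "gen ?V * (gen ?W * p) \<simeq> gen ?W * (gen ?V * p)" by (simp add: eqm_def)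
  then show ?thesis
    using locT_locT[OF assms(1,2) N] Jm.eqS_sym[OF locT_locT[OF assms(2,1) N]] Jm.eqS_trans by blast
qed

lemma locT_sum: "(\<Sum>i\<in>I. locT i v p) \<simeq> gen v * p"
proof -
  obtain N where N: "dep p N" using dep_exists by blast
  have "(\<Sum>i\<in>I. locT i v p) \<simeq> (\<Sum>i\<in>I. gen (cut i N v) * p)"
    by (intro Jm.eqS_sum locT_eq N)
  also have "\<dots> \<simeq> gen (\<Sum>i\<in>I. cut i N v) * p"
    by (intro Jm.eqS_sym[OF Jm.T_sum]) auto
  also have "\<dots> \<simeq> gen v * p"
  proof (rule gen_cong[OF N])
    have "lg (\<Sum>i\<in>I. cut i N v) - lg v = ((\<Sum>i\<in>I. ep i N) - 1) * lg v"
      by (simp add: lin_sum[OF lin_lg] sum_distrib_right left_diff_distrib)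
    then show "F ^ N dvd lg (\<Sum>i\<in>I. cut i N v) - lg v" using ep_sum[of N] by (simp add: dvd_mult2)
  qed
  finally show ?thesis .
qed

text \<open>At the other roots the cut field vanishes to second order in \<open>A j\<close>, so
  their characters do not see it. At the root itself it differs from \<open>v\<close> by second
  order, which \<open>mus i\<close> does not see.\<close>

lemma locT_1:
  assumes i: "i \<in> I" and v: "v \<in> vir_sub (fi i)"
  shows "locT i v 1 \<simeq> smul (mus i v) 1"
proof -
  have d: "dep 1 2" by (simp add: dep_def zero_word_def)
  let ?V = "cut i 2 v"
  have Aj: "A j ^ 2 dvd lg ?V" if "j \<in> I" "j \<noteq> i" for j
    using ep_other[OF i that, of 2] by (simp add: dvd_mult2)
  have Ai: "A i dvd lg ?V" using v by (simp add: sub_fi dvd_mult)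
  have Aj1: "A j ^ 1 dvd lg ?V" if "j \<in> I" for j
    using Ai Aj[OF that] by (cases "j = i") (auto intro: dvd_trans[OF dvd_power[of 2 "A j"]])
  have V: "?V \<in> vir_sub f" using F_dvd[OF Aj1] by (simp add: sub_f)
  have "\<mu> ?V = mus i ?V + (\<Sum>j\<in>I - {i}. mus j ?V)" using mu_sum[OF V] i by (simp add: sum.remove)
  also have "(\<Sum>j\<in>I - {i}. mus j ?V) = 0"
    using char_square[OF fi0 mus_char] Aj by (intro sum.neutral) (auto simp: LPfi)
  also have "mus i ?V = mus i v"
  proof -
    have "lg (?V - v) = (ep i 2 - 1) * lg v" by (simp add: lin_diff[OF lin_lg] left_diff_distrib)
    then have "mus i (?V - v) = 0"
      using ep[OF i, of 2] by (intro char_square[OF fi0[OF i] mus_char[OF i]]) (simp add: LPfi dvd_mult2)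
    then show ?thesis using char_diff[OF fi0[OF i] mus_char[OF i] _ v, of ?V] Ai by (simp add: sub_fi)
  qed
  finally have m: "\<mu> ?V = mus i v" by simp
  have "locT i v 1 \<simeq> gen ?V * 1" by (rule locT_eq[OF i d])
  also have "gen ?V * 1 \<simeq> smul (mus i v) 1"
    using J_char[OF V, of 1 \<mu>] by (simp add: eqm_def m smul_eq_mult)
  finally show ?thesis .
qed


section \<open>Tensor products\<close>

context
  fixes M :: "nat \<Rightarrow> 'v vir_mod" and \<pi> :: "nat \<Rightarrow> free_alg \<Rightarrow> 'v"
  assumes pres: "i \<in> I \<Longrightarrow> presents (M i) UNIV (J (fi i) (mus i)) (\<lambda>v p. gen v * p) (\<pi> i)"
begin

abbreviation Ji where "Ji i \<equiv> J (fi i) (mus i)"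

text \<open>Pure tensors are given by representatives in the free algebra, one for each factor;
  changing these modulo \<open>Ji i\<close> does not change the symbol.\<close>

definition tt :: "(nat \<Rightarrow> free_alg) \<Rightarrow> nat \<Rightarrow> 'v" where "tt p = (\<lambda>i\<in>I. \<pi> i (p i))"
definition mm :: "(nat \<Rightarrow> free_alg) \<Rightarrow> ((nat \<Rightarrow> 'v) \<Rightarrow>\<^sub>0 complex)" where "mm p = bv (tt p)"
definition BT where "BT = (\<Pi>\<^sub>E i\<in>I. carrier (M i))"
definition CT where "CT = {p :: (nat \<Rightarrow> 'v) \<Rightarrow>\<^sub>0 complex. Poly_Mapping.keys p \<subseteq> BT}"
definition ST where "ST = pm.span (tensor_rels I M)"
definition TT where "TT x = lin_ext (\<lambda>t. \<Sum>i\<in>I. bv (t(i := act (M i) x (t i))))"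

lemma pi_eq: "i \<in> I \<Longrightarrow> \<pi> i p = \<pi> i q \<longleftrightarrow> p - q \<in> Ji i"
  and pi_carrier: "i \<in> I \<Longrightarrow> carrier (M i) = range (\<pi> i)"
  and pi_add: "i \<in> I \<Longrightarrow> \<pi> i p \<oplus>\<^bsub>M i\<^esub> \<pi> i q = \<pi> i (p + q)"
  and pi_smul: "i \<in> I \<Longrightarrow> c \<odot>\<^bsub>M i\<^esub> \<pi> i p = \<pi> i (smul c p)"
  and pi_act: "i \<in> I \<Longrightarrow> act (M i) x (\<pi> i p) = \<pi> i (gen x * p)"
  using pres[of i] by (auto simp: presents_def eqm_def)

lemma tt_upd: "i \<in> I \<Longrightarrow> (tt p)(i := \<pi> i q) = tt (p(i := q))"
  by (auto simp: tt_def fun_eq_iff)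

lemma tt_eq: "(\<And>i. i \<in> I \<Longrightarrow> p i - q i \<in> Ji i) \<Longrightarrow> tt p = tt q"
  by (auto simp: tt_def fun_eq_iff pi_eq)

lemma BT_tt: "t \<in> BT \<longleftrightarrow> (\<exists>p. t = tt p)"
proof
  assume t: "t \<in> BT"
  then have "\<forall>i\<in>I. \<exists>q. t i = \<pi> i q" by (auto simp: BT_def pi_carrier dest!: PiE_mem)
  then obtain p where "\<forall>i\<in>I. t i = \<pi> i (p i)" by metis
  then have "t i = tt p i" for i
    using t[unfolded BT_def, THEN PiE_arb, of i] by (cases "i \<in> I") (simp_all add: tt_def)
  then have "t = tt p" by blast
  then show "\<exists>p. t = tt p" by blast
qed (auto simp: BT_def tt_def pi_carrier)

lemma sub_ST: "pm.subspace ST" and sub_CT: "pm.subspace CT"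
  by (simp_all add: ST_def CT_def subspace_support)

lemma mm_CT: "mm p \<in> CT"
  using BT_tt by (auto simp: mm_def CT_def)

lemma rels_cases:
  assumes "r \<in> tensor_rels I M"
  obtains (add) p i q q' where "i \<in> I" "r = mm (p(i := q + q')) - (mm (p(i := q)) + mm (p(i := q')))"
  | (smul) p i c q where "i \<in> I" "r = mm (p(i := smul c q)) - smul c (mm (p(i := q)))"
  using assms unfolding tensor_rels_def
proof (elim UnE CollectE exE conjE)
  fix t i v w
  assume t: "t \<in> (\<Pi>\<^sub>E i\<in>I. carrier (M i))" and i: "i \<in> I" "v \<in> carrier (M i)" "w \<in> carrier (M i)"
    and r: "r = bv (t(i := v \<oplus>\<^bsub>M i\<^esub> w)) - (bv (t(i := v)) + bv (t(i := w)))"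
  obtain p where "t = tt p" using t BT_tt by (auto simp: BT_def)
  moreover obtain q q' where "v = \<pi> i q" "w = \<pi> i q'" using i by (auto simp: pi_carrier)
  ultimately show thesis using r i by (intro add[of i p q q']) (simp_all add: mm_def pi_add tt_upd)
next
  fix t i c v
  assume t: "t \<in> (\<Pi>\<^sub>E i\<in>I. carrier (M i))" and i: "i \<in> I" "v \<in> carrier (M i)"
    and r: "r = bv (t(i := c \<odot>\<^bsub>M i\<^esub> v)) - smul c (bv (t(i := v)))"
  obtain p where "t = tt p" using t BT_tt by (auto simp: BT_def)
  moreover obtain q where "v = \<pi> i q" using i by (auto simp: pi_carrier)
  ultimately show thesis using r i by (intro smul[of i p c q]) (simp_all add: mm_def pi_smul tt_upd)
qed

lemma mm_add: assumes "i \<in> I" shows "mm (p(i := q + q')) - (mm (p(i := q)) + mm (p(i := q'))) \<in> ST"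
proof -
  have "bv ((tt p)(i := \<pi> i q \<oplus>\<^bsub>M i\<^esub> \<pi> i q')) - (bv ((tt p)(i := \<pi> i q)) + bv ((tt p)(i := \<pi> i q'))) \<in> tensor_rels I M"
    unfolding tensor_rels_def using assms BT_tt[of "tt p"] pi_carrier[OF assms] BT_def by blast
  then show ?thesis by (simp add: ST_def pm.span_base mm_def pi_add tt_upd assms)
qed

lemma mm_smul: assumes "i \<in> I" shows "mm (p(i := smul c q)) - smul c (mm (p(i := q))) \<in> ST"
proof -
  have "bv ((tt p)(i := c \<odot>\<^bsub>M i\<^esub> \<pi> i q)) - smul c (bv ((tt p)(i := \<pi> i q))) \<in> tensor_rels I M"
    unfolding tensor_rels_def using assms BT_tt[of "tt p"] pi_carrier[OF assms] BT_def by blast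
  then show ?thesis by (simp add: ST_def pm.span_base mm_def pi_smul tt_upd assms del: smul_single)
qed

lemma mm_cong: "i \<in> I \<Longrightarrow> q - q' \<in> Ji i \<Longrightarrow> mm (p(i := q)) = mm (p(i := q'))"
  unfolding mm_def by (intro arg_cong[where f = bv] tt_eq) (auto simp: pm.subspace_0[OF subspace_J])

lemma mm_0: assumes "i \<in> I" "q \<in> Ji i" shows "mm (p(i := q)) \<in> ST"
  using mm_smul[OF assms(1), of p 0 0] mm_cong[OF assms(1), of q 0 p] assms(2) by simp

lemma lin_TT: "lin (TT x)"
  by (simp add: TT_def lin_lin_ext)

lemma TT_mm: "TT x (mm p) = (\<Sum>i\<in>I. mm (p(i := gen x * p i)))"
proof -
  have "TT x (mm p) = (\<Sum>i\<in>I. bv ((tt p)(i := act (M i) x (tt p i))))" by (simp add: TT_def mm_def)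
  also have "\<dots> = (\<Sum>i\<in>I. mm (p(i := gen x * p i)))"
  proof (intro sum.cong refl arg_cong[where f = bv])
    fix i assume i: "i \<in> I"
    have "act (M i) x (tt p i) = \<pi> i (gen x * p i)" using i by (simp add: tt_def pi_act)
    then show "bv ((tt p)(i := act (M i) x (tt p i))) = mm (p(i := gen x * p i))"
      using i by (simp add: mm_def tt_upd)
  qed
  finally show ?thesis .
qed

lemma CT_induct:
  assumes "p \<in> CT" "lin g" "pm.subspace R" "\<And>p. g (mm p) \<in> R" shows "g p \<in> R"
  by (rule lin_mem_subspace[OF assms(2,3)]) (use assms(1,4) BT_tt in \<open>auto simp: CT_def mm_def subset_iff\<close>)

lemma vmod_TT: "vmod CT ST TT"
proof
  have sumS: "(\<Sum>j\<in>I. h j) \<in> ST" if "\<And>j. j \<in> I \<Longrightarrow> h j \<in> ST" for h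
    using that by (rule pm.subspace_sum[OF sub_ST])
  show "ST \<subseteq> CT"
    unfolding ST_def
  proof (rule pm.span_minimal[OF subsetI sub_CT])
    fix r assume "r \<in> tensor_rels I M"
    then show "r \<in> CT"
      by (cases r rule: rels_cases)
         (auto intro!: pm.subspace_diff[OF sub_CT] pm.subspace_add[OF sub_CT] pm.subspace_scale[OF sub_CT] mm_CT)
  qed
  show "TT v p \<in> CT" if "p \<in> CT" for v p
    by (rule CT_induct[OF that lin_TT sub_CT]) (simp add: TT_mm pm.subspace_sum[OF sub_CT] mm_CT)
  show "TT v p \<in> ST" if "p \<in> ST" for v p
  proof (rule lin_span_image[OF lin_TT sub_ST that[unfolded ST_def]])
    fix r assume "r \<in> tensor_rels I M"
    then show "TT v r \<in> ST"
    proof (cases r rule: rels_cases)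
      case (add p i q q')
      let ?d = "\<lambda>j. mm ((p(i := q + q'))(j := gen v * (p(i := q + q')) j)) -
          (mm ((p(i := q))(j := gen v * (p(i := q)) j)) + mm ((p(i := q'))(j := gen v * (p(i := q')) j)))"
      have "?d j \<in> ST" for j
      proof (cases "j = i")
        case True
        then show ?thesis using mm_add[OF add(1), of p "gen v * q" "gen v * q'"] by (simp add: distrib_left)
      next
        case False
        then show ?thesis using mm_add[OF add(1), of "p(j := gen v * p j)" q q'] by (simp add: fun_upd_twist)
      qed
      then have "(\<Sum>j\<in>I. ?d j) \<in> ST" by (rule sumS)
      then show ?thesis unfolding add
        by (simp only: lin_diff[OF lin_TT] lin_add[OF lin_TT] TT_mm sum_subtractf sum.distrib)
    next
      case (smul p i c q)
      let ?d = "\<lambda>j. mm ((p(i := smul c q))(j := gen v * (p(i := smul c q)) j)) -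
          smul c (mm ((p(i := q))(j := gen v * (p(i := q)) j)))"
      have "?d j \<in> ST" for j
      proof (cases "j = i")
        case True
        then show ?thesis using mm_smul[OF smul(1), of p c "gen v * q"] by simp
      next
        case False
        then show ?thesis using mm_smul[OF smul(1), of "p(j := gen v * p j)" c q] by (simp add: fun_upd_twist)
      qed
      then have "(\<Sum>j\<in>I. ?d j) \<in> ST" by (rule sumS)
      then show ?thesis unfolding smul
        by (simp only: lin_diff[OF lin_TT] lin_smul[OF lin_TT] TT_mm sum_subtractf pm.scale_sum_right)
    qed
  qed
  fix p and v w :: vir and c
  assume p: "p \<in> CT"
  note L = lin_subtract lin_plus lin_scale lin_TT lin_comp[OF lin_TT lin_TT]
  show "eqm ST (TT (v + w) p) (TT v p + TT w p)"
    unfolding eqm_def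
  proof (rule CT_induct[where g = "\<lambda>p. TT (v + w) p - (TT v p + TT w p)", OF p _ sub_ST])
    fix p
    have "mm (p(i := gen (v + w) * p i)) - (mm (p(i := gen v * p i)) + mm (p(i := gen w * p i))) \<in> ST" if i: "i \<in> I" for i
      using mm_add[OF i, of p "gen v * p i" "gen w * p i"]
        mm_cong[OF i, of "gen (v + w) * p i" "gen v * p i + gen w * p i" p]
        vmod.T_plus[OF vmod_J, of "p i" "fi i" "mus i" v w] by (simp add: eqm_def)
    then have "(\<Sum>i\<in>I. mm (p(i := gen (v + w) * p i)) - (mm (p(i := gen v * p i)) + mm (p(i := gen w * p i)))) \<in> ST"
      by (rule sumS)
    then show "TT (v + w) (mm p) - (TT v (mm p) + TT w (mm p)) \<in> ST"
      by (simp add: TT_mm sum_subtractf sum.distrib)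
  qed (intro L)
  show "eqm ST (TT (smul c v) p) (smul c (TT v p))"
    unfolding eqm_def
  proof (rule CT_induct[where g = "\<lambda>p. TT (smul c v) p - smul c (TT v p)", OF p _ sub_ST])
    fix p
    have "mm (p(i := gen (smul c v) * p i)) - smul c (mm (p(i := gen v * p i))) \<in> ST" if i: "i \<in> I" for i
      using mm_smul[OF i, of p c "gen v * p i"]
        mm_cong[OF i, of "gen (smul c v) * p i" "smul c (gen v * p i)" p]
        vmod.T_scale[OF vmod_J, of "p i" "fi i" "mus i" c v] by (simp add: eqm_def)
    then have "(\<Sum>i\<in>I. mm (p(i := gen (smul c v) * p i)) - smul c (mm (p(i := gen v * p i)))) \<in> ST"
      by (rule sumS)
    then show "TT (smul c v) (mm p) - smul c (TT v (mm p)) \<in> ST"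
      by (simp add: TT_mm sum_subtractf pm.scale_sum_right)
  qed (intro L)
  show "eqm ST (TT (bracket v w) p) (TT v (TT w p) - TT w (TT v p))"
    unfolding eqm_def
  proof (rule CT_induct[where g = "\<lambda>p. TT (bracket v w) p - (TT v (TT w p) - TT w (TT v p))", OF p _ sub_ST])
    fix p
    let ?off = "\<lambda>v w i j. if i = j then 0 else mm (p(i := gen v * p i, j := gen w * p j))"
    have twice: "TT v (TT w (mm p)) = (\<Sum>j\<in>I. \<Sum>i\<in>I. ?off w v j i) + (\<Sum>i\<in>I. mm (p(i := gen v * (gen w * p i))))" for v w
    proof -
      have "TT v (TT w (mm p)) = (\<Sum>j\<in>I. \<Sum>i\<in>I. mm ((p(j := gen w * p j))(i := gen v * (p(j := gen w * p j)) i)))"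
        by (simp only: TT_mm lin_sum[OF lin_TT])
      also have "\<dots> = (\<Sum>j\<in>I. \<Sum>i\<in>I. ?off w v j i + (if i = j then mm (p(j := gen v * (gen w * p j))) else 0))"
        by (intro sum.cong) auto
      finally show ?thesis by (simp add: sum.distrib)
    qed
    \<comment> \<open>The terms in which \<open>v\<close> and \<open>w\<close> hit different factors
      are symmetric in the two, so they cancel in the commutator.\<close>
    have sym: "(\<Sum>j\<in>I. \<Sum>i\<in>I. ?off w v j i) = (\<Sum>j\<in>I. \<Sum>i\<in>I. ?off v w j i)"
      by (subst sum.swap) (intro sum.cong refl, auto simp: fun_upd_twist)
    have "mm (p(i := gen (bracket v w) * p i)) - (mm (p(i := gen v * (gen w * p i))) - mm (p(i := gen w * (gen v * p i)))) \<in> ST"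
      if i: "i \<in> I" for i
    proof -
      let ?x = "gen v * (gen w * p i)" and ?y = "gen w * (gen v * p i)"
      have "mm (p(i := gen (bracket v w) * p i)) = mm (p(i := ?x - ?y))"
        using vmod.T_bracket[OF vmod_J, of "p i" "fi i" "mus i" v w] by (intro mm_cong i) (simp add: eqm_def)
      moreover have "mm (p(i := ?x)) - (mm (p(i := ?x - ?y)) + mm (p(i := ?y))) \<in> ST"
        using mm_add[OF i, of p "?x - ?y" ?y] by simp
      from pm.subspace_neg[OF sub_ST this] have "mm (p(i := ?x - ?y)) - (mm (p(i := ?x)) - mm (p(i := ?y))) \<in> ST"
        by (simp add: algebra_simps)
      ultimately show ?thesis by simp
    qed
    then have "(\<Sum>i\<in>I. mm (p(i := gen (bracket v w) * p i)) -
        (mm (p(i := gen v * (gen w * p i))) - mm (p(i := gen w * (gen v * p i))))) \<in> ST"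
      by (rule sumS)
    then show "TT (bracket v w) (mm p) - (TT v (TT w (mm p)) - TT w (TT v (mm p))) \<in> ST"
      unfolding twice sym by (simp add: TT_mm sum_subtractf)
  qed (intro L)
qed (auto simp: sub_ST sub_CT lin_TT)

text \<open>The inverse of the map \<open>V\<^sup>f \<rightarrow> \<Otimes> V\<^sub>i\<close>: a tensor of words acts on the cyclic vector by the localized actions.\<close>

definition H :: "nat list \<Rightarrow> (nat \<Rightarrow> free_alg) \<Rightarrow> free_alg \<Rightarrow> free_alg" where
  "H is p x = foldr (\<lambda>i x. op (locT i) (p i) x) is x"

lemma H_simps [simp]: "H [] p x = x" "H (i # is) p x = op (locT i) (p i) (H is p x)"
  by (simp_all add: H_def)

lemmas op_locT = vmod.op_S[OF vmod_locT] vmod.eqS_op[OF vmod_locT] vmod.op_mult[OF vmod_locT]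
  vmod.op_1[OF vmod_locT] vmod.lin_op[OF vmod_locT] vmod.lin_op_right[OF vmod_locT] vmod.op_gen[OF vmod_locT]

lemma op_commute:
  assumes "i \<in> I" "j \<in> I" "i \<noteq> j"
  shows "locT i v (op (locT j) q x) \<simeq> op (locT j) q (locT i v x)"
  unfolding eqm_def
proof (rule lin_mem_subspace[where f = "\<lambda>q. locT i v (op (locT j) q x) - op (locT j) q (locT i v x)", OF _ subspace_J])
  show "lin (\<lambda>q. locT i v (op (locT j) q x) - op (locT j) q (locT i v x))"
    by (intro lin_subtract lin_comp[OF lin_locT] op_locT(5) assms)
  fix w
  have "locT i v (foldr (locT j) ls x) \<simeq> foldr (locT j) ls (locT i v x)" for ls
  proof (induction ls)
    case (Cons u ls)
    have "locT i v (locT j u (foldr (locT j) ls x)) \<simeq> locT j u (locT i v (foldr (locT j) ls x))"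
      by (rule locT_commute[OF assms])
    also have "\<dots> \<simeq> locT j u (foldr (locT j) ls (locT i v x))" by (rule locT_cong[OF assms(2) Cons])
    finally show ?case by simp
  qed simp
  then show "locT i v (op (locT j) (bv w) x) - op (locT j) (bv w) (locT i v x) \<in> J f \<mu>"
    by (simp add: vmod.op_word[OF vmod_locT[OF assms(2)]] eqm_def)
qed

lemma H_cong: "set is \<subseteq> I \<Longrightarrow> x \<simeq> y \<Longrightarrow> H is p x \<simeq> H is p y"
  by (induction "is") (auto intro: op_locT(2))

lemma lin_H: "set is \<subseteq> I \<Longrightarrow> lin (H is p)"
proof (induction "is")
  case (Cons i "is")
  then show ?case using lin_comp[OF op_locT(6)[of i "p i"], of "H is p"] by simp
qed (simp add: lin_def)

lemma H_fun_upd: "i \<notin> set is \<Longrightarrow> H is (p(i := q)) x = H is p x"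
  by (induction "is") auto

lemma H_comm:
  assumes "set is \<subseteq> I" "i \<in> I" "\<And>j. j \<in> set is \<Longrightarrow> j = i \<Longrightarrow> p j = 1"
  shows "locT i v (H is p x) \<simeq> H is p (locT i v x)"
  using assms(1,3)
proof (induction "is")
  case (Cons j "is")
  have IH: "locT i v (H is p x) \<simeq> H is p (locT i v x)" using Cons by auto
  have j: "j \<in> I" using Cons by auto
  show ?case
  proof (cases "j = i")
    case True
    then have "p j = 1" using Cons.prems(2) by auto
    then show ?thesis using IH by (simp add: op_locT(4)[OF j])
  next
    case False
    have "locT i v (op (locT j) (p j) (H is p x)) \<simeq> op (locT j) (p j) (locT i v (H is p x))"
      using False by (intro op_commute assms(2) j) auto
    also have "\<dots> \<simeq> op (locT j) (p j) (H is p (locT i v x))" by (rule op_locT(2)[OF j IH])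
    finally show ?thesis by simp
  qed
qed simp

text \<open>A letter at root \<open>i\<close> commutes past the actions at the other roots until it
  meets the word of its own factor.\<close>

lemma H_act:
  assumes "distinct is" "set is \<subseteq> I" "i \<in> set is"
  shows "locT i v (H is p x) \<simeq> H is (p(i := gen v * p i)) x"
  using assms
proof (induction "is")
  case (Cons j "is")
  have j: "j \<in> I" using Cons by auto
  show ?case
  proof (cases "j = i")
    case True
    then have ni: "i \<notin> set is" and i: "i \<in> I" using Cons.prems by auto
    have "H (i # is) (p(i := gen v * p i)) x = op (locT i) (gen v * p i) (H is p x)"
      unfolding H_simps fun_upd_same H_fun_upd[OF ni] ..
    also have "\<dots> = locT i v (H (i # is) p x)"
      unfolding H_simps op_locT(3)[OF i] op_locT(7)[OF i] ..
    finally show ?thesis unfolding True by (simp only: Jm.eqS_refl)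
  next
    case False
    then have i: "i \<in> set is" "i \<in> I" using Cons.prems by auto
    have "locT i v (op (locT j) (p j) (H is p x)) \<simeq> op (locT j) (p j) (locT i v (H is p x))"
      using False by (intro op_commute i j) auto
    also have "\<dots> \<simeq> op (locT j) (p j) (H is (p(i := gen v * p i)) x)"
      using Cons i by (intro op_locT(2)[OF j] Cons.IH) auto
    finally show ?thesis unfolding H_simps fun_upd_other[OF False] .
  qed
qed simp

lemma H_lin_upd: assumes "distinct is" "set is \<subseteq> I" "i \<in> set is" shows "lin (\<lambda>q. H is (p(i := q)) x)"
  using assms
proof (induction "is")
  case (Cons j "is")
  have j: "j \<in> I" using Cons by auto
  show ?case
  proof (cases "j = i")
    case True
    then have ni: "i \<notin> set is" and i: "i \<in> I" using Cons.prems by auto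
    show ?thesis unfolding True H_simps fun_upd_same H_fun_upd[OF ni] by (rule op_locT(5)[OF i])
  next
    case False
    have "lin (\<lambda>q. H is (p(i := q)) x)" by (rule Cons.IH) (use Cons.prems False in auto)
    then show ?thesis unfolding H_simps fun_upd_other[OF False] by (rule lin_comp[OF op_locT(6)[OF j]])
  qed
qed simp

lemma op_H: assumes "distinct is" "set is \<subseteq> I" "i \<in> set is"
  shows "op (locT i) q (H is (p(i := 1)) x) \<simeq> H is (p(i := q)) x"
  unfolding eqm_def
proof (rule lin_mem_subspace[where f = "\<lambda>q. op (locT i) q (H is (p(i := 1)) x) - H is (p(i := q)) x", OF _ subspace_J])
  have i: "i \<in> I" using assms by auto
  show "lin (\<lambda>q. op (locT i) q (H is (p(i := 1)) x) - H is (p(i := q)) x)"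
    by (intro lin_subtract op_locT(5)[OF i] H_lin_upd assms)
  fix w
  have "foldr (locT i) ls (H is (p(i := 1)) x) \<simeq> H is (p(i := bv (Word ls))) x" for ls
  proof (induction ls)
    case Nil
    then show ?case by (simp flip: zero_word_def)
  next
    case (Cons v ls)
    have "locT i v (foldr (locT i) ls (H is (p(i := 1)) x)) \<simeq> locT i v (H is (p(i := bv (Word ls))) x)"
      by (rule locT_cong[OF i Cons])
    also have "\<dots> \<simeq> H is ((p(i := bv (Word ls)))(i := gen v * (p(i := bv (Word ls))) i)) x"
      by (rule H_act[OF assms])
    also have "(p(i := bv (Word ls)))(i := gen v * (p(i := bv (Word ls))) i) = p(i := bv (Word (v # ls)))"
      by (simp add: mult_single plus_word_def)
    finally show ?case by (simp only: foldr_Cons o_apply)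
  qed
  from this[of "letters w"] show "op (locT i) (bv w) (H is (p(i := 1)) x) - H is (p(i := bv w)) x \<in> J f \<mu>"
    by (simp add: vmod.op_word[OF vmod_locT[OF i]] eqm_def)
qed

abbreviation G where "G p \<equiv> H [1..<Suc k] p 1"

lemma is_I: "distinct [1..<Suc k]" "set [1..<Suc k] \<subseteq> I" "i \<in> I \<Longrightarrow> i \<in> set [1..<Suc k]"
  by (auto simp: atLeastAtMost_iff)

text \<open>The action of factor \<open>i\<close> can be performed last. What the other factors make
  of the cyclic vector is still an eigenvector for the fields at root \<open>i\<close>, because
  local actions commute, so \<open>op_J\<close> applies.\<close>

lemma G_kill: assumes i: "i \<in> I" and q: "q \<in> Ji i" shows "G (p(i := q)) \<in> J f \<mu>"
proof -
  let ?y = "G (p(i := 1))"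
  interpret L: vmod UNIV "J f \<mu>" "locT i" by (rule vmod_locT[OF i])
  have "locT i v ?y \<simeq> smul (mus i v) ?y" if "v \<in> vir_sub (fi i)" for v
  proof -
    have "locT i v ?y \<simeq> H [1..<Suc k] (p(i := 1)) (locT i v 1)" by (rule H_comm[OF is_I(2) i]) auto
    also have "\<dots> \<simeq> H [1..<Suc k] (p(i := 1)) (smul (mus i v) 1)" by (rule H_cong[OF is_I(2) locT_1[OF i that]])
    finally show ?thesis by (simp only: lin_smul[OF lin_H[OF is_I(2)]])
  qed
  then have "op (locT i) q ?y \<in> J f \<mu>" by (intro L.op_J[OF _ _ q]) auto
  then show ?thesis using L.eqS_S[OF op_H[OF is_I(1,2) is_I(3)[OF i]]] by blast
qed

lemma G_cong: assumes "\<And>i. i \<in> I \<Longrightarrow> p i - p' i \<in> Ji i" shows "G p \<simeq> G p'"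
proof -
  have "G (\<lambda>i. if i \<in> set ks then p' i else p i) \<simeq> G p" if "set ks \<subseteq> I" for ks
    using that
  proof (induction ks)
    case (Cons j ks)
    let ?r = "\<lambda>i. if i \<in> set ks then p' i else p i"
    have j: "j \<in> I" and IH: "G ?r \<simeq> G p" using Cons by auto
    show ?case
    proof (cases "j \<in> set ks")
      case True
      then have "(\<lambda>i. if i \<in> set (j # ks) then p' i else p i) = ?r" by auto
      then show ?thesis using IH by simp
    next
      case False
      then have eq: "(\<lambda>i. if i \<in> set (j # ks) then p' i else p i) = ?r(j := p' j)" "?r = ?r(j := p j)" by auto
      have "G (?r(j := p' j - p j)) \<in> J f \<mu>"
        using assms[OF j] pm.subspace_neg[OF subspace_J, of "p j - p' j"] by (intro G_kill j) auto
      then have "G (?r(j := p' j)) - G (?r(j := p j)) \<in> J f \<mu>"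
        by (simp only: lin_diff[OF H_lin_upd[OF is_I(1,2) is_I(3)[OF j]]])
      then have "G (?r(j := p' j)) \<simeq> G (?r(j := p j))" by (simp only: eqm_def)
      then have "G (?r(j := p' j)) \<simeq> G ?r" by (simp only: eq(2)[symmetric])
      from Jm.eqS_trans[OF this IH] show ?thesis unfolding eq(1) .
    qed
  qed simp
  from this[of "[1..<Suc k]"] have "G (\<lambda>i. if i \<in> set [1..<Suc k] then p' i else p i) \<simeq> G p" using is_I by blast
  moreover have "H ks (\<lambda>i. if i \<in> set [1..<Suc k] then p' i else p i) x = H ks p' x" if "set ks \<subseteq> set [1..<Suc k]" for ks x
    using that by (induction ks) auto
  from this[OF order_refl] have "G (\<lambda>i. if i \<in> set [1..<Suc k] then p' i else p i) = G p'" .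
  ultimately show ?thesis by (simp only: Jm.eqS_sym)
qed

text \<open>Rests on a choice of representatives, which by \<open>G_cong\<close> does not matter
  modulo \<open>J f \<mu>\<close>.\<close>

definition Psi where "Psi = lin_ext (\<lambda>t. G (\<lambda>i. SOME q. \<pi> i q = t i))"

lemma lin_Psi: "lin Psi"
  by (simp add: Psi_def lin_lin_ext)

lemma Psi_mm: "Psi (mm p) \<simeq> G p"
proof -
  have "G (\<lambda>i. SOME q. \<pi> i q = tt p i) \<simeq> G p"
  proof (rule G_cong)
    fix i assume i: "i \<in> I"
    have "\<pi> i (SOME q. \<pi> i q = tt p i) = tt p i" by (rule someI[of _ "p i"]) (simp add: tt_def i)
    then have "\<pi> i (SOME q. \<pi> i q = tt p i) = \<pi> i (p i)" using i by (simp add: tt_def)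
    then show "(SOME q. \<pi> i q = tt p i) - p i \<in> Ji i" by (simp add: pi_eq[OF i])
  qed
  then show ?thesis by (simp add: Psi_def mm_def)
qed

lemma Psi_ST: "p \<in> ST \<Longrightarrow> Psi p \<in> J f \<mu>"
proof (rule lin_span_image[OF lin_Psi subspace_J], simp add: ST_def)
  fix r assume "r \<in> tensor_rels I M"
  then have "Psi r \<simeq> 0"
  proof (cases r rule: rels_cases)
    case (add p i q q')
    have "Psi r \<simeq> G (p(i := q + q')) - (G (p(i := q)) + G (p(i := q')))"
      unfolding add lin_diff[OF lin_Psi] lin_add[OF lin_Psi] by (intro Jm.eqS_diff Jm.eqS_add Psi_mm)
    then show ?thesis by (simp only: lin_add[OF H_lin_upd[OF is_I(1,2) is_I(3)[OF add(1)]]] diff_self)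
  next
    case (smul p i c q)
    have "Psi r \<simeq> G (p(i := smul c q)) - smul c (G (p(i := q)))"
      unfolding smul lin_diff[OF lin_Psi] lin_smul[OF lin_Psi] by (intro Jm.eqS_diff Jm.eqS_smul Psi_mm)
    then show ?thesis by (simp only: lin_smul[OF H_lin_upd[OF is_I(1,2) is_I(3)[OF smul(1)]]] diff_self)
  qed
  then show "Psi r \<in> J f \<mu>" by (simp add: Jm.eqS_0)
qed

lemma Psi_TT: assumes "p \<in> CT" shows "Psi (TT v p) \<simeq> gen v * Psi p"
  unfolding eqm_def
proof (rule CT_induct[where g = "\<lambda>p. Psi (TT v p) - gen v * Psi p", OF assms _ subspace_J])
  show "lin (\<lambda>p. Psi (TT v p) - gen v * Psi p)"
    by (intro lin_subtract lin_comp[OF lin_Psi lin_TT] lin_comp[OF lin_mult_left lin_Psi])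
  fix p
  have "Psi (TT v (mm p)) \<simeq> (\<Sum>i\<in>I. G (p(i := gen v * p i)))"
    unfolding TT_mm lin_sum[OF lin_Psi] by (intro Jm.eqS_sum Psi_mm)
  also have "\<dots> \<simeq> (\<Sum>i\<in>I. locT i v (G p))"
    by (intro Jm.eqS_sum Jm.eqS_sym[OF H_act] is_I)
  also have "\<dots> \<simeq> gen v * G p" by (rule locT_sum)
  also have "\<dots> \<simeq> gen v * Psi (mm p)" by (rule Jm.eqS_T[OF Jm.eqS_sym[OF Psi_mm]])
  finally show "Psi (TT v (mm p)) - gen v * Psi (mm p) \<in> J f \<mu>" by (simp add: eqm_def)
qed

section \<open>Comparison of the induced module with the tensor product\<close>

interpretation TT: vmod CT ST TT
  by (rule vmod_TT)

abbreviation m1 where "m1 \<equiv> mm (\<lambda>_. 1)"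

lemma TT_m1: assumes "x \<in> vir_sub f" shows "eqm ST (TT x m1) (smul (\<mu> x) m1)"
proof -
  have "eqm ST (mm ((\<lambda>_. 1)(i := gen x * 1))) (smul (mus i x) m1)" if i: "i \<in> I" for i
  proof -
    have "gen x * 1 - smul (mus i x) 1 \<in> Ji i"
      using J_char[OF sub_f_fi[OF i assms], of 1 "mus i"] by (simp add: smul_eq_mult)
    then have "mm ((\<lambda>_. 1)(i := gen x * 1)) = mm ((\<lambda>_. 1)(i := smul (mus i x) 1))" by (rule mm_cong[OF i])
    moreover have "(\<lambda>_. 1)(i := 1) = (\<lambda>_. 1 :: free_alg)" by auto
    ultimately show ?thesis using mm_smul[OF i, of "\<lambda>_. 1" "mus i x" 1] by (simp add: eqm_def)
  qed
  then have "eqm ST (TT x m1) (\<Sum>i\<in>I. smul (mus i x) m1)" unfolding TT_mm by (intro TT.eqS_sum)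
  then show ?thesis using mu_sum[OF assms] by (simp add: pm.scale_sum_left)
qed

text \<open>Both sides obey the same recursion on words, by equivariance of \<open>Psi\<close>, and
  the tensor of the cyclic vectors goes to 1. This gives injectivity of the map into the tensor
  product.\<close>

lemma Psi_op: "Psi (op TT p m1) \<simeq> p"
  unfolding eqm_def
proof (rule lin_mem_subspace[where f = "\<lambda>p. Psi (op TT p m1) - p", OF _ subspace_J])
  show "lin (\<lambda>p. Psi (op TT p m1) - p)" by (intro lin_subtract lin_id lin_comp[OF lin_Psi TT.lin_op])
  fix w
  have "H ks (\<lambda>_. 1) 1 = 1" if "set ks \<subseteq> I" for ks using that by (induction ks) (auto simp: op_locT(4))
  then have G1: "G (\<lambda>_. 1) = 1" using is_I(2) by blast
  have "Psi (foldr TT ls m1) \<simeq> bv (Word ls)" for ls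
  proof (induction ls)
    case Nil
    then show ?case using Psi_mm[of "\<lambda>_. 1"] unfolding G1 by (simp flip: zero_word_def)
  next
    case (Cons v ls)
    have "Psi (TT v (foldr TT ls m1)) \<simeq> gen v * Psi (foldr TT ls m1)"
      by (rule Psi_TT[OF TT.foldr_C[OF mm_CT]])
    also have "\<dots> \<simeq> gen v * bv (Word ls)" by (rule Jm.eqS_T[OF Cons])
    finally show ?case by (simp add: mult_single plus_word_def)
  qed
  from this[of "letters w"] show "Psi (op TT (bv w) m1) - bv w \<in> J f \<mu>" by (simp add: TT.op_word eqm_def)
qed

text \<open>Each factor can be acted on separately, so all pure tensors are reached from the tensor
  of the cyclic vectors, letter by letter and factor by factor.\<close>

lemma op_surj: assumes "q \<in> CT" shows "\<exists>p. eqm ST q (op TT p m1)"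
proof -
  define W where "W = {q. \<exists>p. eqm ST q (op TT p m1)}"
  have sub_W: "pm.subspace W"
    unfolding pm.subspace_def
  proof (intro conjI allI ballI)
    show "0 \<in> W" unfolding W_def by (intro CollectI exI[of _ 0]) (simp add: lin_0[OF TT.lin_op])
    show "x + y \<in> W" if xy: "x \<in> W" "y \<in> W" for x y
    proof -
      obtain p p' where "eqm ST x (op TT p m1)" "eqm ST y (op TT p' m1)" using xy by (auto simp: W_def)
      from TT.eqS_add[OF this] show ?thesis unfolding lin_add[OF TT.lin_op, symmetric] W_def by blast
    qed
    show "smul c x \<in> W" if x: "x \<in> W" for c x
    proof -
      obtain p where "eqm ST x (op TT p m1)" using x by (auto simp: W_def)
      from TT.eqS_smul[OF this, of c] show ?thesis unfolding lin_smul[OF TT.lin_op, symmetric] W_def by blast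
    qed
  qed
  have ST_W: "ST \<subseteq> W" unfolding W_def by (auto intro!: exI[of _ 0] simp: lin_0[OF TT.lin_op] TT.eqS_0)
  have TT_W: "TT v x \<in> W" if x: "x \<in> W" for v x
  proof -
    obtain p where "eqm ST x (op TT p m1)" using x by (auto simp: W_def)
    then have "eqm ST (TT v x) (op TT (gen v * p) m1)" using TT.eqS_T by (simp add: TT.op_mult TT.op_gen)
    then show ?thesis by (auto simp: W_def)
  qed
  have m1: "m1 \<in> W" unfolding W_def by (intro CollectI exI[of _ 1]) simp
  have W_eq: "x \<in> W \<longleftrightarrow> y \<in> W" if "eqm ST x y" for x y using TT.eqS_mem[OF that ST_W sub_W] .
  have step: "mm (p(i := q)) \<in> W" if i: "i \<in> I" and base: "mm (p(i := 1)) \<in> W" for p i q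
  proof (rule lin_mem_subspace[where f = "\<lambda>q. q", OF lin_id, of "{q. mm (p(i := q)) \<in> W}", simplified])
    show "pm.subspace {q. mm (p(i := q)) \<in> W}"
      unfolding pm.subspace_def
    proof (intro conjI allI ballI; clarsimp)
      show "mm (p(i := 0)) \<in> W" using mm_0[OF i pm.subspace_0[OF subspace_J]] ST_W by blast
      show "mm (p(i := x + y)) \<in> W" if "mm (p(i := x)) \<in> W" "mm (p(i := y)) \<in> W" for x y
        using W_eq[of "mm (p(i := x + y))"] mm_add[OF i, of p x y] that pm.subspace_add[OF sub_W] by (simp add: eqm_def)
      show "mm (p(i := smul c x)) \<in> W" if "mm (p(i := x)) \<in> W" for c x
        using W_eq[of "mm (p(i := smul c x))"] mm_smul[OF i, of p c x] that pm.subspace_scale[OF sub_W] by (simp add: eqm_def)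
    qed
    fix w
    have "mm (p(i := bv (Word ls))) \<in> W" for ls
    proof (induction ls)
      case Nil
      have "bv (Word []) = (1 :: free_alg)" by (simp flip: zero_word_def)
      then show ?case using base by (simp only:)
    next
      case (Cons v ls)
      let ?r = "p(i := bv (Word ls))"
      obtain N where N: "\<And>j. j \<in> I \<Longrightarrow> dep (?r j) N"
      proof -
        have "\<forall>j. \<exists>N. dep (?r j) N" by (rule allI, rule dep_exists)
        from choice[OF this] obtain n where n: "\<forall>j. dep (?r j) (n j)" by (rule exE)
        have "dep (?r j) (\<Sum>j\<in>I. n j)" if "j \<in> I" for j
          using that by (intro dep_mono[OF n[rule_format]] member_le_sum) auto
        then show thesis by (rule that)
      qed
      \<comment> \<open>Cut at root \<open>i\<close> beyond the depth of all factors,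
        \<open>v\<close> acts as before on factor \<open>i\<close> and by zero on the
        others.\<close>
      let ?u = "cut i N v"
      have other: "mm (?r(j := gen ?u * ?r j)) \<in> ST" if j: "j \<in> I" "j \<noteq> i" for j
      proof (rule mm_0[OF j(1)])
        have "A j ^ N dvd lg ?u" using ep_other[OF i j] by (simp add: dvd_mult2)
        then show "gen ?u * ?r j \<in> Ji j" by (intro J_kill[OF fi0 mus_char N] j) (simp_all add: LPfi j)
      qed
      have "A i ^ N dvd (ep i N - 1) * lg v" by (rule dvd_mult2[OF ep[OF i]])
      then have "A i ^ N dvd lg ?u - lg v" by (simp add: left_diff_distrib)
      then have "eqm (Ji i) (gen ?u * ?r i) (gen v * ?r i)"
        by (intro J_cong[OF fi0 mus_char N] i) (simp_all add: LPfi)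
      then have same: "mm (?r(i := gen ?u * ?r i)) = mm (?r(i := gen v * ?r i))" by (intro mm_cong i) (simp add: eqm_def)
      have "TT ?u (mm ?r) = mm (?r(i := gen ?u * ?r i)) + (\<Sum>j\<in>I - {i}. mm (?r(j := gen ?u * ?r j)))"
        unfolding TT_mm using i by (intro sum.remove) auto
      moreover have "(\<Sum>j\<in>I - {i}. mm (?r(j := gen ?u * ?r j))) \<in> ST"
        using other by (intro pm.subspace_sum[OF sub_ST]) auto
      ultimately have "eqm ST (TT ?u (mm ?r)) (mm (?r(i := gen v * ?r i)))" unfolding same by (simp add: eqm_def)
      then have "mm (?r(i := gen v * ?r i)) \<in> W" using W_eq TT_W[OF Cons] by blast
      moreover have "?r(i := gen v * ?r i) = p(i := bv (Word (v # ls)))" by (simp add: mult_single plus_word_def)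
      ultimately show ?case by (simp only:)
    qed
    from this[of "letters w"] show "mm (p(i := bv w)) \<in> W" by simp
  qed
  have all: "mm (\<lambda>i. if i \<in> set ks then p i else 1) \<in> W" if "set ks \<subseteq> I" for p ks
    using that
  proof (induction ks)
    case (Cons i ks)
    let ?r = "\<lambda>j. if j \<in> set ks then p j else 1"
    have r: "mm ?r \<in> W" using Cons by auto
    show ?case
    proof (cases "i \<in> set ks")
      case True
      then have "(\<lambda>j. if j \<in> set (i # ks) then p j else 1) = ?r" by auto
      then show ?thesis using r by simp
    next
      case False
      then have eq: "(\<lambda>j. if j \<in> set (i # ks) then p j else 1) = ?r(i := p i)" "?r(i := 1) = ?r" by auto
      have "mm (?r(i := p i)) \<in> W"
      proof (rule step)
        show "i \<in> I" using Cons.prems by simp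
        show "mm (?r(i := 1)) \<in> W" using r by (simp only: eq(2))
      qed
      then show ?thesis by (simp only: eq(1))
    qed
  qed (use m1 in simp)
  have "q \<in> W"
  proof (rule CT_induct[OF assms lin_id sub_W])
    fix p
    have "mm p = mm (\<lambda>i. if i \<in> set [1..<Suc k] then p i else 1)"
      unfolding mm_def by (intro arg_cong[where f = bv] tt_eq) (use is_I(3) in \<open>auto simp: pm.subspace_0[OF subspace_J]\<close>)
    then show "mm p \<in> W" using all[OF is_I(2)] by simp
  qed
  then show ?thesis by (simp add: W_def)
qed

lemma is_quot_tensor_aux: "is_quot f \<mu> (tensor I M)"
proof -
  have T: "TT = (\<lambda>x. lin_ext ((\<lambda>x t. \<Sum>i\<in>I. bv (t(i := act (M i) x (t i)))) x))" by (simp add: TT_def fun_eq_iff)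
  have "presents (tensor I M) CT ST TT (\<lambda>p. (\<lambda>s. s + p) ` ST)"
    unfolding tensor_def CT_def T ST_def[symmetric] BT_def
    by (rule quot_presents[OF sub_ST]) (use TT.S_C TT.T_S in \<open>auto simp: CT_def BT_def TT_def\<close>)
  then have "presents (tensor I M) UNIV (J f \<mu>) (\<lambda>v p. gen v * p) (\<lambda>p. (\<lambda>s. s + op TT p m1) ` ST)"
  proof (rule TT.presents_comp)
    show "op TT p m1 \<in> ST \<longleftrightarrow> p \<in> J f \<mu>" for p
    proof
      assume "op TT p m1 \<in> ST"
      then have "Psi (op TT p m1) \<in> J f \<mu>" by (rule Psi_ST)
      then show "p \<in> J f \<mu>" using Jm.eqS_S[OF Psi_op] by blast
    next
      assume "p \<in> J f \<mu>"
      then show "op TT p m1 \<in> ST" by (rule TT.op_J[OF mm_CT, rotated]) (rule TT_m1)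
    qed
    show "\<exists>p\<in>UNIV. eqm ST q (op TT p m1)" if "q \<in> CT" for q using op_surj[OF that] by simp
  qed (simp_all add: TT.op_C mm_CT lin_add[OF TT.lin_op] lin_smul[OF TT.lin_op] TT.op_mult TT.op_gen)
  then show ?thesis unfolding is_quot_def by blast
qed

end

theorem is_quot_tensor:
  assumes "\<And>i. i \<in> I \<Longrightarrow> is_quot (fi i) (mus i) (M i)"
  shows "is_quot f \<mu> (tensor I M)"
proof -
  from assms obtain \<pi> where "\<And>i. i \<in> I \<Longrightarrow> presents (M i) UNIV (J (fi i) (mus i)) (\<lambda>v p. gen v * p) (\<pi> i)"
    unfolding is_quot_def by metis
  then show ?thesis by (rule is_quot_tensor_aux)
qed

end


section \<open>Properness of the left ideal\<close>

context decomp
begin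

text \<open>A functional on Laurent polynomials modulo \<open>A i\<close>, since
  \<open>mus i\<close> vanishes on multiples of \<open>A i ^ 2\<close>. The factor
  \<open>bv (- 1)\<close> compensates the \<open>bv 1\<close> in \<open>cocyc\<close>.\<close>

definition hs :: "nat \<Rightarrow> laurent \<Rightarrow> complex" where "hs i g = mus i (e_of (A i * (bv (- 1) * g)))"

abbreviation tp :: "nat \<Rightarrow> laurent \<Rightarrow> complex" where "tp i \<equiv> tau (lam i) (ns i - 1)"

text \<open>Both tensor factors vanish on multiples of \<open>A i\<close>; therefore
  \<open>rr i\<close> kills \<open>X2 (lg v) p\<close> for every \<open>v\<close> in
  \<open>Vir\<^sup>f\<close>.\<close>

definition rr :: "nat \<Rightarrow> laurent2 \<Rightarrow> complex" where "rr i = cext (\<lambda>(b, c). hs i (bv b) * tp i (bv c))"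

lemma linc_hs: assumes "i \<in> I" shows "linc (hs i)"
proof -
  have "e_of (A i * g) \<in> vir_sub (fi i)" for g by (simp add: sub_fi)
  then show ?thesis
    unfolding linc_def hs_def
    by (simp add: distrib_left smul_eq_mult lin_add[OF lin_e_of] char_add[OF fi0 mus_char] assms)
       (metis assms char_smul[OF fi0 mus_char] lin_smul[OF lin_e_of] lin_smul[OF lin_mult_left] smul_eq_mult)
qed

lemma hs_A: assumes "i \<in> I" shows "hs i (A i * g) = 0"
  unfolding hs_def using assms by (intro char_square[OF fi0 mus_char]) (simp_all add: LPfi power2_eq_square mult.left_commute)

lemma linc_rr: "linc (rr i)"
  by (simp add: rr_def linc_cext)

lemma rr_emb: assumes i: "i \<in> I" shows "rr i (emb1 g * emb2 h) = hs i g * tp i h"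
proof -
  have c: "linc (\<lambda>p. c * r p)" "linc (\<lambda>p. r p * c)" if "linc r" for c and r :: "laurent \<Rightarrow> complex"
    using that by (auto simp: linc_def algebra_simps)
  have "rr i (emb1 (bv b) * emb2 h) = hs i (bv b) * tp i h" for b
    by (rule linc_eqI[where f = "\<lambda>h. rr i (emb1 (bv b) * emb2 h)",
          OF linc_comp[OF linc_rr lin_comp[OF lin_mult_left lin2(2)]] c(1)[OF linc_tau]])
       (simp add: emb1_def emb2_def mult_single rr_def)
  then show ?thesis
    by (rule linc_eqI[where f = "\<lambda>g. rr i (emb1 g * emb2 h)",
          OF linc_comp[OF linc_rr lin_comp[OF lin_mult_right lin2(1)]] c(2)[OF linc_hs[OF i]]])
qed

lemma bv_emb: "bv (b, c) = emb1 (bv b) * emb2 (bv c)"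
  by (simp add: emb1_def emb2_def mult_single)

lemma rr_kill: assumes i: "i \<in> I" shows "rr i (emb1 (A i * g) * p) = 0" "rr i (emb2 (A i * g) * p) = 0"
proof -
  have z: "linc (\<lambda>_. 0)" by (simp add: linc_def)
  have "rr i (emb1 (A i * g) * bv (b, c)) = 0" for b c
    using rr_emb[OF i, of "A i * (g * bv b)" "bv c"] hs_A[OF i] by (simp add: bv_emb emb_mult mult.assoc)
  then show "rr i (emb1 (A i * g) * p) = 0"
    by - (rule linc_eqI[where f = "\<lambda>p. rr i (emb1 (A i * g) * p)", OF linc_comp[OF linc_rr lin_mult_left] z], auto)
  have t: "tp i (A i * h) = 0" for h
    using ns_1[OF i] by (intro tau_dvd[OF lam_0[OF i], of "ns i"]) (auto simp: A_def)
  have "rr i (emb2 (A i * g) * bv (b, c)) = 0" for b c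
    using rr_emb[OF i, of "bv b" "A i * (g * bv c)"] t[of "g * bv c"] by (simp add: bv_emb emb_mult mult_ac)
  then show "rr i (emb2 (A i * g) * p) = 0"
    by - (rule linc_eqI[where f = "\<lambda>p. rr i (emb2 (A i * g) * p)", OF linc_comp[OF linc_rr lin_mult_left] z], auto)
qed

lemma rr_X2: assumes i: "i \<in> I" and v: "v \<in> vir_sub f" shows "rr i (X2 (lg v) p) = 0"
proof -
  obtain g where "lg v = A i * g" using sub_f_fi[OF i v] by (auto simp: sub_fi)
  then show ?thesis by (simp add: X2_def linc_add[OF linc_rr] rr_kill[OF i])
qed

lemma bv_zero2: "bv (0, 0) = (1 :: laurent2)"
  by (simp only: single_one flip: zero_prod_def)

lemma dq_lpt: "dq (lpt l) = 1"
  by (simp add: lpt_eq lin_diff[OF lin_dq]) (simp add: dq_def bv_zero2)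

lemma tau_one: "tau l m 1 = (if m = 0 then 1 else 0)"
  by (cases m) (simp_all add: tau_def gbinomial_0 flip: single_one)

lemma tp_lpt: assumes "i \<in> I" "m < ns i" shows "tp i (lpt (lam i) ^ (ns i - Suc m)) = (if m = 0 then 1 else 0)"
  using assms tau_lpt_power[OF lam_0[OF assms(1)], of "ns i - 1" "ns i - Suc m" 1] by (simp add: tau_one)

text \<open>The divided difference of \<open>(t - \<lambda>)^(m + 1)\<close> is the sum of all
  products of powers in the two points of total degree \<open>m\<close>. After the extra factor, the
  Taylor coefficient of order \<open>ns i - 1\<close> at the second point selects the term without a
  power in the first.\<close>

lemma rr_dq:
  assumes i: "i \<in> I" and "m < ns i"
  shows "rr i (emb1 h * dq (lpt (lam i) ^ Suc m) * emb2 (lpt (lam i) ^ (ns i - Suc m))) = hs i h"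
  using assms(2)
proof (induction m)
  case 0
  then show ?case using rr_emb[OF i, of h "lpt (lam i) ^ (ns i - Suc 0)"] tp_lpt[OF i 0] by (simp add: dq_lpt)
next
  case (Suc m)
  let ?X = "lpt (lam i)"
  have "ns i - Suc m = Suc (ns i - Suc (Suc m))" using Suc.prems by simp
  then have X: "emb2 (?X ^ (ns i - Suc m)) = emb2 ?X * emb2 (?X ^ (ns i - Suc (Suc m)))" by (simp add: emb_mult)
  have "dq (?X ^ Suc (Suc m)) = emb1 (?X ^ Suc m) + dq (?X ^ Suc m) * emb2 ?X"
    by (subst power_Suc2, subst dq_mult) (simp add: dq_lpt)
  then have "rr i (emb1 h * dq (?X ^ Suc (Suc m)) * emb2 (?X ^ (ns i - Suc (Suc m)))) =
      rr i (emb1 (h * ?X ^ Suc m) * emb2 (?X ^ (ns i - Suc (Suc m)))) +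
      rr i (emb1 h * dq (?X ^ Suc m) * emb2 (?X ^ (ns i - Suc m)))"
    by (simp only: X emb_mult distrib_left distrib_right linc_add[OF linc_rr] mult.assoc)
  then show ?case using Suc tp_lpt[OF i Suc.prems] by (simp add: rr_emb[OF i] del: power_Suc)
qed

lemma emb_1: "emb2 1 = 1"
proof -
  have "emb2 (bv 0) = bv (0, 0)" by (simp add: emb2_def del: single_one)
  then show ?thesis by (simp only: bv_zero2 single_one)
qed

text \<open>Write \<open>lg v = A i * g\<close>. By the product rule for divided differences the
  cocycle is, modulo multiples of \<open>A i\<close> at the second point, \<open>t g\<close> at the
  first point times \<open>dq (A i)\<close>. On this \<open>rr_dq\<close> gives
  \<open>hs i (t g)\<close>, which is \<open>mus i v\<close>.\<close>

lemma rr_cocyc: assumes i: "i \<in> I" and v: "v \<in> vir_sub f" shows "rr i (cocyc (lg v)) = mus i v"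
proof -
  obtain g where g: "lg v = A i * g" using sub_f_fi[OF i v] by (auto simp: sub_fi)
  have "cocyc (lg v) = emb1 (bv 1 * g) * dq (A i) + emb2 (A i * 1) * dq (bv 1 * g)"
    using dq_mult[of "bv 1 * g" "A i"] by (simp add: cocyc_def g mult_ac)
  moreover have "rr i (emb1 (bv 1 * g) * dq (A i)) = hs i (bv 1 * g)"
    using rr_dq[OF i, of "ns i - 1" "bv 1 * g"] ns_1[OF i] by (simp add: A_def emb_1)
  moreover have "hs i (bv 1 * g) = mus i (e_of (lg v))"
    using bv_power_int[of "- 1"] by (simp add: hs_def g flip: mult.assoc)
  ultimately show ?thesis
    using char_lg[OF fi0 mus_char sub_f_fi[OF i v], of "e_of (lg v)"] i rr_kill(2)[OF i, of 1 "dq (bv 1 * g)"]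
    by (simp add: linc_add[OF linc_rr])
qed

lemma r2_facts:
  "linc (\<lambda>p. - (\<Sum>i\<in>I. rr i p))"
  "v \<in> vir_sub f \<Longrightarrow> - (\<Sum>i\<in>I. rr i (X2 (lg v) p)) = 0"
  "v \<in> vir_sub f \<Longrightarrow> - (\<Sum>i\<in>I. rr i (cocyc (lg v))) = - \<mu> v"
  by (simp_all add: linc_def linc_add[OF linc_rr] linc_smul[OF linc_rr] sum.distrib sum_distrib_left rr_X2 rr_cocyc mu_sum)

lemma one_J: "1 \<notin> J f \<mu>"
proof (rule one_notin_J[where ?r3.0 = "\<lambda>_. 0", OF r2_facts(1)])
  show "linc (\<lambda>_ :: laurent. 0)" by (simp add: linc_def)
qed (use r2_facts(2,3) in auto)

text \<open>The functional for the further point is the Taylor coefficient of order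
  \<open>ns i - 1\<close> at root \<open>i\<close>. It kills all multiples of \<open>f\<close>, but
  sees fields of multiplicity \<open>ns i - 1\<close> at that root.\<close>

lemma gen_J:
  assumes i: "i \<in> I" and "gen v - Poly_Mapping.single 0 c \<in> J f \<mu>"
  shows "tp i (lg v * D p) = 0"
proof (rule gen_notin_J[OF r2_facts(1) linc_tau _ _ _ assms(2)])
  fix v p assume "v \<in> vir_sub f"
  then obtain g where "lg v = A i * g" using sub_f_fi[OF i] by (auto simp: sub_fi)
  then show "tp i (lg v * p) = 0"
    using ns_1[OF i] by (intro tau_dvd[OF lam_0[OF i], of "ns i"]) (auto simp: A_def)
qed (use r2_facts(2,3) in auto)

end

lemma decomp_iff: "decomp k lam ns f \<mu> a mus \<longleftrightarrow> decomposition f \<mu> a k lam ns mus"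
  by (auto simp: decomp_def decomp_axioms_def roots_def decomposition_def)

lemma J_proper:
  assumes "coeff f 0 \<noteq> 0" "lie_char (vir_sub f) \<mu>" shows "1 \<notin> J f \<mu>"
  using decomposition_exists[OF assms] decomp.one_J decomp_iff by metis


section \<open>Simplicity\<close>

lemma (in point_vmod) UU_least:
  assumes "pm.subspace R" "S \<subseteq> R" "E \<subseteq> R" "\<And>v p. p \<in> R \<Longrightarrow> T v p \<in> R" shows "UU \<subseteq> R"
proof -
  have "wd ls e \<in> R" if "e \<in> E" for ls e using assms(3,4) that by (induction ls) (auto simp: d_def)
  then show ?thesis unfolding UU_def using assms(1,2) by (intro pm.span_minimal) auto
qed

lemma left_ideal_UNIV:
  assumes "pm.subspace W" "1 \<in> W" "\<And>v p. p \<in> W \<Longrightarrow> gen v * p \<in> W" shows "W = UNIV"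
proof -
  have "bv (Word ls) \<in> W" for ls
  proof (induction ls)
    case Nil
    then show ?case using assms(2) by (simp flip: zero_word_def)
  next
    case (Cons v ls)
    then show ?case using assms(3)[of "bv (Word ls)" v] by (simp add: mult_single plus_word_def)
  qed
  then have "bv w \<in> W" for w by (metis word.collapse)
  then show ?thesis using lin_mem_subspace[OF lin_id assms(1)] by auto
qed

section \<open>Large degree implies simplicity\<close>

locale large = decomp +
  fixes qs :: "nat \<Rightarrow> nat"
  assumes qs: "i \<in> I \<Longrightarrow> qs i = 2 * ns i - 1 \<or> (qs i = 2 * ns i - 2 \<and> ns i \<ge> 2)"
    and mus_q: "i \<in> I \<Longrightarrow> mus i (vf (lam i) (qs i)) \<noteq> 0"
    and mus_above: "i \<in> I \<Longrightarrow> b > qs i \<Longrightarrow> mus i (vf (lam i) b) = 0"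
begin

text \<open>\<open>EE i\<close> is generated from the class of \<open>1\<close> by the local actions at the first \<open>i\<close> roots.\<close>

primrec EE :: "nat \<Rightarrow> free_alg set" where
  "EE 0 = {p. \<exists>c. p \<simeq> smul c 1}"
| "EE (Suc i) = point_vmod.UU (J f \<mu>) (locT (Suc i)) (EE i) (lam (Suc i)) (ns (Suc i))"

text \<open>The induction hypothesis for passing through the roots: vectors built at the first
  \<open>i\<close> roots remain eigenvectors for the fields at the later roots, because local
  actions commute.\<close>

definition good :: "nat \<Rightarrow> bool" where
  "good i \<longleftrightarrow> pm.subspace (EE i) \<and> J f \<mu> \<subseteq> EE i \<and> 1 \<in> EE i \<and>
     (\<forall>j\<in>I. \<forall>e\<in>EE i. \<forall>v. (i < j \<longrightarrow> v \<in> vir_sub (fi j) \<longrightarrow> locT j v e \<simeq> smul (mus j v) e) \<and>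
        (j \<le> i \<longrightarrow> locT j v e \<in> EE i))"

lemma goodD:
  assumes "good i"
  shows "pm.subspace (EE i)" "J f \<mu> \<subseteq> EE i" "1 \<in> EE i"
    "j \<in> I \<Longrightarrow> e \<in> EE i \<Longrightarrow> i < j \<Longrightarrow> v \<in> vir_sub (fi j) \<Longrightarrow> locT j v e \<simeq> smul (mus j v) e"
    "j \<in> I \<Longrightarrow> e \<in> EE i \<Longrightarrow> j \<le> i \<Longrightarrow> locT j v e \<in> EE i"
  using assms unfolding good_def by blast+

lemma eqJ_mem: "p \<simeq> q \<Longrightarrow> J f \<mu> \<subseteq> W \<Longrightarrow> pm.subspace W \<Longrightarrow> p \<in> W \<longleftrightarrow> q \<in> W"
  by (rule Jm.eqS_mem)

lemma subspace_eig: "pm.subspace {p. locT j v p \<simeq> smul c p}"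
proof -
  have eq: "{p. locT j v p \<simeq> smul c p} = {p. locT j v p - smul c p \<in> J f \<mu>}" by (simp add: eqm_def)
  have l: "lin (\<lambda>p. locT j v p - smul c p)" by (intro lin_subtract lin_locT lin_scale lin_id)
  show ?thesis unfolding eq by (rule subspace_vimage[OF l subspace_J])
qed

lemma point:
  assumes "good i" and i: "Suc i \<in> I"
  shows "point_vmod UNIV (J f \<mu>) (locT (Suc i)) (EE i) (lam (Suc i)) (ns (Suc i)) (mus (Suc i)) (qs (Suc i))"
proof (intro point_vmod.intro vmod_locT[OF i] point_vmod_axioms.intro)
  show "lam (Suc i) \<noteq> 0" "ns (Suc i) \<ge> 1" using lam_0[OF i] ns_1[OF i] by auto
  show "locT (Suc i) v p \<in> J f \<mu>" if z: "lg v = 0" for v p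
  proof -
    obtain N where N: "dep p N" using dep_exists by blast
    have "gen (cut (Suc i) N v) * p \<in> J f \<mu>" by (rule gen_kill[OF N]) (simp add: z)
    then show ?thesis using Jm.eqS_S[OF locT_eq[OF i N]] by blast
  qed
  show "eqm (J f \<mu>) (locT (Suc i) v e) (smul (mus (Suc i) v) e)" if "e \<in> EE i" "lpt (lam (Suc i)) ^ ns (Suc i) dvd lg v" for e v
    using that by (intro goodD(4)[OF assms(1) i]) (auto simp: sub_fi A_def)
  show "mus (Suc i) v = 0" if "lpt (lam (Suc i)) ^ (2 * ns (Suc i)) dvd lg v" for v
    using that by (intro char_square[OF fi0[OF i] mus_char[OF i]]) (simp add: LPfi A_def power_mult mult.commute[of 2])
qed (use goodD[OF assms(1)] qs[OF i] mus_q[OF i] mus_above[OF i] in auto)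

lemma good_0: "good 0"
proof -
  have eq: "EE 0 = {p. \<exists>c. p - smul c 1 \<in> J f \<mu>}" by (simp add: eqm_def)
  have 1: "pm.subspace (EE 0)"
    unfolding eq pm.subspace_def
  proof (intro conjI ballI allI; clarsimp)
    show "\<exists>c. - smul c 1 \<in> J f \<mu>" using pm.subspace_0[OF subspace_J] by (intro exI[of _ 0]) simp
    show "\<exists>e. p + q - smul e 1 \<in> J f \<mu>" if "p - smul c 1 \<in> J f \<mu>" "q - smul d 1 \<in> J f \<mu>" for p q c d
      using pm.subspace_add[OF subspace_J that] by (intro exI[of _ "c + d"]) (simp add: pm.scale_left_distrib algebra_simps)
    show "\<exists>e. smul d p - smul e 1 \<in> J f \<mu>" if "p - smul c 1 \<in> J f \<mu>" for p c d
      using pm.subspace_scale[OF subspace_J that, of d] by (intro exI[of _ "d * c"]) (simp add: pm.scale_right_diff_distrib)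
  qed
  have 2: "J f \<mu> \<subseteq> EE 0" unfolding eq by (auto intro!: exI[of _ 0])
  have 3: "1 \<in> EE 0" unfolding eq using pm.subspace_0[OF subspace_J] by (auto intro!: exI[of _ 1])
  have 4: "locT j v e \<simeq> smul (mus j v) e" if j: "j \<in> I" and e: "e \<in> EE 0" and v: "v \<in> vir_sub (fi j)" for j v e
  proof -
    interpret L: vmod UNIV "J f \<mu>" "locT j" by (rule vmod_locT[OF j])
    obtain c where c: "smul c 1 \<simeq> e" using e L.eqS_sym by (auto simp: eqm_def)
    have "1 \<in> {p. locT j v p \<simeq> smul (mus j v) p}" using locT_1[OF j v] by simp
    then have "smul c 1 \<in> {p. locT j v p \<simeq> smul (mus j v) p}" by (rule pm.subspace_scale[OF subspace_eig])
    then have "locT j v (smul c 1) \<simeq> smul (mus j v) (smul c 1)" by blast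
    then show ?thesis
      using locT_cong[OF j c, of v] L.eqS_smul[OF c, of "mus j v"] L.eqS_trans L.eqS_sym by metis
  qed
  show ?thesis unfolding good_def using 1 2 3 4 by (auto simp: atLeastAtMost_iff simp del: EE.simps)
qed

lemma good_Suc:
  assumes good: "good i" and i: "Suc i \<in> I" shows "good (Suc i)"
proof -
  interpret P: point_vmod UNIV "J f \<mu>" "locT (Suc i)" "EE i" "lam (Suc i)" "ns (Suc i)" "mus (Suc i)" "qs (Suc i)"
    by (rule point[OF assms])
  note good = goodD[OF good]
  have E: "EE (Suc i) = P.UU" by simp
  note S_P = P.S_UU
  have eig: "locT j v e \<simeq> smul (mus j v) e"
    if j: "j \<in> I" "Suc i < j" and e: "e \<in> P.UU" and v: "v \<in> vir_sub (fi j)" for j e v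
  proof -
    have "P.UU \<subseteq> {p. locT j v p \<simeq> smul (mus j v) p}"
    proof (rule P.UU_least[OF subspace_eig])
      show "J f \<mu> \<subseteq> {p. locT j v p \<simeq> smul (mus j v) p}"
        using locT_J[OF j(1)] pm.subspace_scale[OF subspace_J] pm.subspace_diff[OF subspace_J] by (auto simp: eqm_def)
      show "EE i \<subseteq> {p. locT j v p \<simeq> smul (mus j v) p}" using good(4)[OF j(1)] j(2) v by auto
      fix w p assume "p \<in> {p. locT j v p \<simeq> smul (mus j v) p}"
      then have p: "locT j v p \<simeq> smul (mus j v) p" by blast
      have "locT j v (locT (Suc i) w p) \<simeq> locT (Suc i) w (locT j v p)" using locT_commute[OF j(1) i] j(2) by simp
      also have "locT (Suc i) w (locT j v p) \<simeq> locT (Suc i) w (smul (mus j v) p)" by (rule locT_cong[OF i p])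
      also have "locT (Suc i) w (smul (mus j v) p) = smul (mus j v) (locT (Suc i) w p)" by (rule lin_smul[OF lin_locT])
      finally show "locT (Suc i) w p \<in> {p. locT j v p \<simeq> smul (mus j v) p}" by blast
    qed
    then show ?thesis using e by blast
  qed
  have closed: "locT j v e \<in> P.UU" if j: "j \<in> I" "j \<le> i" and e: "e \<in> P.UU" for j e v
  proof -
    have "P.UU \<subseteq> {p \<in> P.UU. locT j v p \<in> P.UU}"
    proof (rule P.UU_least)
      show "pm.subspace {p \<in> P.UU. locT j v p \<in> P.UU}"
        unfolding pm.subspace_def
        using pm.subspace_0[OF P.sub_UU] pm.subspace_add[OF P.sub_UU] pm.subspace_scale[OF P.sub_UU]
        by (simp add: lin_0[OF lin_locT] lin_add[OF lin_locT] lin_smul[OF lin_locT])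
      show "J f \<mu> \<subseteq> {p \<in> P.UU. locT j v p \<in> P.UU}" using locT_J[OF j(1)] S_P by blast
      show "EE i \<subseteq> {p \<in> P.UU. locT j v p \<in> P.UU}" using good(5)[OF j(1)] j(2) P.E_UU by blast
      fix w p assume "p \<in> {p \<in> P.UU. locT j v p \<in> P.UU}"
      then have p: "p \<in> P.UU" "locT (Suc i) w (locT j v p) \<in> P.UU" by (auto intro: P.T_UU)
      have "locT j v (locT (Suc i) w p) \<simeq> locT (Suc i) w (locT j v p)" using locT_commute[OF j(1) i] j(2) by simp
      from eqJ_mem[OF this S_P P.sub_UU] show "locT (Suc i) w p \<in> {p \<in> P.UU. locT j v p \<in> P.UU}"
        using p P.T_UU by blast
    qed
    then show ?thesis using e by blast
  qed
  have "locT j v e \<in> P.UU" if "j \<in> I" "j \<le> Suc i" "e \<in> P.UU" for j e v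
    using closed[OF that(1)] P.T_UU[OF that(3)] that le_Suc_eq by metis
  then show ?thesis
    unfolding good_def E using P.sub_UU S_P eig good(3) P.E_UU by blast
qed

lemma good: "i \<le> k \<Longrightarrow> good i"
proof (induction i)
  case (Suc i)
  then show ?case using good_Suc[of i] by (simp add: atLeastAtMost_iff)
qed (rule good_0)

text \<open>After the last root the space is stable under all local actions, hence under their sum,
  which is the action of \<open>Vir\<close>; and it contains 1.\<close>

lemma EE_k: "EE k = UNIV"
proof (rule left_ideal_UNIV)
  note good = goodD[OF good[OF order_refl]]
  show "pm.subspace (EE k)" "1 \<in> EE k" by (rule good)+
  fix v p assume p: "p \<in> EE k"
  have "(\<Sum>i\<in>I. locT i v p) \<in> EE k"
    using good(5)[OF _ p] by (intro pm.subspace_sum[OF good(1)]) (simp add: atLeastAtMost_iff)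
  then show "gen v * p \<in> EE k" using eqJ_mem[OF locT_sum good(2,1)] by blast
qed

text \<open>The roots are stripped off in reverse order: \<open>lowering\<close> turns a vector of
  \<open>W\<close> in \<open>EE (Suc j)\<close> outside \<open>J f \<mu>\<close> into one in
  \<open>EE j\<close>. At the end a nonzero multiple of the cyclic vector is left.\<close>

theorem J_maximal:
  assumes W: "pm.subspace W" "J f \<mu> \<subseteq> W" "\<And>v p. p \<in> W \<Longrightarrow> gen v * p \<in> W" and "W \<noteq> J f \<mu>"
  shows "W = UNIV"
proof -
  \<comment> \<open>On each single vector a local action agrees modulo \<open>J f \<mu>\<close> with
    the action of an element of \<open>Vir\<close>, so it preserves \<open>W\<close>.\<close>
  have loc: "locT i v p \<in> W" if "i \<in> I" "p \<in> W" for i v p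
  proof -
    obtain N where N: "dep p N" using dep_exists by blast
    show ?thesis using eqJ_mem[OF locT_eq[OF that(1) N] W(2,1)] W(3)[OF that(2)] by blast
  qed
  obtain w where w: "w \<in> W" "w \<notin> J f \<mu>" using assms by blast
  have "\<exists>w\<in>W. w \<in> EE (k - i) \<and> w \<notin> J f \<mu>" if "i \<le> k" for i
    using that
  proof (induction i)
    case 0
    then show ?case using w EE_k by auto
  next
    case (Suc i)
    then obtain w where w: "w \<in> W" "w \<in> EE (k - i)" "w \<notin> J f \<mu>" by auto
    obtain j where j: "k - i = Suc j" "k - Suc i = j" using Suc.prems by (metis Suc_diff_Suc Suc_le_lessD)
    then have I: "Suc j \<in> I" by (auto simp: atLeastAtMost_iff One_nat_def)
    interpret P: point_vmod UNIV "J f \<mu>" "locT (Suc j)" "EE j" "lam (Suc j)" "ns (Suc j)" "mus (Suc j)" "qs (Suc j)"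
      by (rule point[OF good I]) (use j in simp)
    from P.lowering[OF W(1,2) loc[OF I] w(1) _ w(3)] w(2) show ?case unfolding j by auto
  qed
  from this[of k] obtain w c where w: "w \<in> W" "w \<simeq> smul c 1" "w \<notin> J f \<mu>" by auto
  then have "smul c 1 \<in> W" "smul c 1 \<notin> J f \<mu>" using eqJ_mem[OF w(2) W(2,1)] eqJ_mem[OF w(2) order_refl subspace_J] by blast+
  then have "c \<noteq> 0" using pm.subspace_0[OF subspace_J] by auto
  with \<open>smul c 1 \<in> W\<close> have "1 \<in> W" using pm.subspace_scale[OF W(1), of "smul c 1" "inverse c"] by (simp add: smul_inverse)
  then show ?thesis using left_ideal_UNIV W by blast
qed

end


lemma large_degree_maximal:
  assumes large: "large_degree f \<mu>"
    and W: "pm.subspace W" "J f \<mu> \<subseteq> W" "\<And>v p. p \<in> W \<Longrightarrow> gen v * p \<in> W" "W \<noteq> J f \<mu>"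
  shows "W = UNIV"
proof -
  obtain a k lam ns mus and ps :: "nat \<Rightarrow> complex poly" where dec: "decomposition f \<mu> a k lam ns mus"
    and ps: "\<And>i j. i \<in> {1..k} \<Longrightarrow> mus i (vir_gen (linpow (lam i) (ns i)) j) = poly (ps i) (of_int j) * lam i powi j"
    and ps_0: "\<And>i. i \<in> {1..k} \<Longrightarrow> ps i \<noteq> 0"
    and deg: "\<And>i. i \<in> {1..k} \<Longrightarrow> degree (ps i) < ns i \<and> int (degree (ps i)) \<ge> int (ns i) - 2"
    using large unfolding large_degree_def by blast
  interpret decomp k lam ns f \<mu> a mus using dec decomp_iff by blast
  have val: "mus i (vf (lam i) (ns i + r)) = lam i powi (- 1 + int r) * (fd ^^ r) (\<lambda>j. poly (ps i) (of_int j)) (- 1)"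
    if "i \<in> {1..k}" for i r
    unfolding vf_def using that by (intro char_fd lam_0 mus_char) (simp_all add: ps)
  \<comment> \<open>At index \<open>ns i + r\<close> the value of \<open>mus i\<close> is a nonzero
    multiple of a difference of order \<open>r\<close> of \<open>ps i\<close>. The last index with
    nonzero value is therefore \<open>ns i\<close> plus the degree.\<close>
  interpret large k lam ns f \<mu> a mus "\<lambda>i. ns i + degree (ps i)"
  proof (intro large.intro large_axioms.intro decomp_axioms)
    fix i assume i: "i \<in> {1..k}"
    show "ns i + degree (ps i) = 2 * ns i - 1 \<or> ns i + degree (ps i) = 2 * ns i - 2 \<and> ns i \<ge> 2"
      using deg[OF i] by linarith
    show "mus i (vf (lam i) (ns i + degree (ps i))) \<noteq> 0"
      unfolding val[OF i] using fd_degree[OF refl ps_0[OF i]] lam_0[OF i] by (simp add: power_int_eq_0_iff)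
    fix b assume b: "b > ns i + degree (ps i)"
    have "(fd ^^ (b - ns i)) (\<lambda>j. poly (ps i) (of_int j)) = (\<lambda>_. 0)"
      using b by (intro fd_poly_0[where p = "ps i"]) auto
    then show "mus i (vf (lam i) b) = 0" using val[OF i, of "b - ns i"] b by simp
  qed
  show ?thesis by (rule J_maximal[OF W])
qed

section \<open>Small degree gives a proper quotient\<close>

lemma lpt_dvd_tau: assumes "l \<noteq> 0" shows "lpt l dvd g - Poly_Mapping.single 0 (tau l 0 g)"
proof -
  have l: "lin (\<lambda>g. g - Poly_Mapping.single 0 (tau l 0 g))"
    using linc_tau[of l 0] by (auto simp: lin_def linc_def single_add smul_single algebra_simps pm.scale_right_diff_distrib)
  have s: "pm.subspace {g. lpt l dvd g}"
    by (auto simp: pm.subspace_def dvd_smul)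
  have "g - Poly_Mapping.single 0 (tau l 0 g) \<in> {g. lpt l dvd g}"
    by (rule lin_mem_subspace[OF l s]) (use lpt_dvd_bv[OF assms] in \<open>simp add: tau_def\<close>)
  then show ?thesis by simp
qed

text \<open>If \<open>\<mu>\<close> has no large degree at the root \<open>lam i\<close>, it extends to the subalgebra obtained by lowering the
  multiplicity of that root by one, so the induced module has a proper quotient.\<close>

lemma (in decomp) not_maximal:
  assumes i: "i \<in> I" and van: "\<And>v. lpt (lam i) ^ (ns i + (ns i - 2)) dvd lg v \<Longrightarrow> mus i v = 0"
  shows "\<exists>f' \<mu>'. J f \<mu> \<subseteq> J f' \<mu>' \<and> 1 \<notin> J f' \<mu>' \<and> J f' \<mu>' \<noteq> J f \<mu>"
proof -
  define n l where "n = ns i" and "l = lam i"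
  define G f' where "G = (\<Prod>j\<in>I - {i}. fi j)" and "f' = G * linpow l (n - 1)"
  \<comment> \<open>Subtracting the leading Taylor term raises the multiplicity at the root from
    \<open>n - 1\<close> to \<open>n\<close>. The extended character gives that term the value 0 at
    this root.\<close>
  define r where "r x = x - smul (tau l (n - 1) (lg x)) (e_of (lpt l ^ (n - 1)))" for x
  define \<mu>' where "\<mu>' x = (\<Sum>j\<in>I - {i}. mus j x) + mus i (r x)" for x
  have n: "n \<ge> 1" and l: "l \<noteq> 0" using ns_1[OF i] lam_0[OF i] by (auto simp: n_def l_def)
  have LPG: "LP G = (\<Prod>j\<in>I - {i}. A j)"
  proof -
    have "LP (\<Prod>j\<in>S. fi j) = (\<Prod>j\<in>S. A j)" if "finite S" for S
      using that by (induction S rule: finite_induct) (simp_all add: LP_1 LP_mult LPfi)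
    then show ?thesis by (simp add: G_def)
  qed
  have Ai: "A i = lpt l ^ (n - 1) * lpt l" using n by (simp add: A_def n_def l_def flip: power_Suc2)
  have LPf': "LP f' = LP G * lpt l ^ (n - 1)" by (simp add: f'_def LP_mult LP_power)
  have F: "F = LP f' * lpt l"
    unfolding F_def LPf' LPG using prod.remove[OF _ i, of A] by (simp add: Ai mult_ac)
  have A_f': "A j dvd LP f'" if "j \<in> I - {i}" for j
    unfolding LPf' LPG using that by (intro dvd_mult2 dvd_prodI) auto
  have l_f': "lpt l ^ (n - 1) dvd LP f'" by (simp add: LPf')
  have f'0: "coeff f' 0 \<noteq> 0"
    using l lam_0 by (simp add: f'_def G_def poly_prod flip: poly_0_coeff_0)
  have sub: "v \<in> vir_sub f'" if "v \<in> vir_sub f" for v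
    using that by (auto simp: vir_sub_iff[of _ f'] sub_f F intro: dvd_mult_left)
  have sub_fi': "v \<in> vir_sub (fi j)" if "j \<in> I - {i}" "v \<in> vir_sub f'" for j v
    using A_f'[OF that(1)] that(2) by (auto simp: vir_sub_iff[of _ f'] sub_fi intro: dvd_trans)
  have sub_l: "lpt l ^ (n - 1) dvd lg v" if "v \<in> vir_sub f'" for v
    using l_f' that by (auto simp: vir_sub_iff[of _ f'] intro: dvd_trans)
  have r_sub: "r x \<in> vir_sub (fi i)" if "lpt l ^ (n - 1) dvd lg x" for x
  proof -
    from that obtain g where g: "lg x = lpt l ^ (n - 1) * g" by (auto elim: dvdE)
    have "tau l (n - 1) (lg x) = tau l 0 g" unfolding g by (simp add: tau_lpt_power[OF l])
    then have "lg (r x) = lpt l ^ (n - 1) * (g - Poly_Mapping.single 0 (tau l 0 g))"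
      by (simp add: r_def lin_diff[OF lin_lg] lin_smul[OF lin_lg] g left_diff_distrib right_diff_distrib smul_eq_mult mult.commute)
    then show ?thesis using lpt_dvd_tau[OF l, of g] by (simp add: sub_fi Ai)
  qed
  have r_add: "r (x + y) = r x + r y" and r_smul: "r (smul c x) = smul c (r x)" for x y c
    by (simp_all add: r_def lin_add[OF lin_lg] lin_smul[OF lin_lg] linc_add[OF linc_tau] linc_smul[OF linc_tau]
        pm.scale_left_distrib pm.scale_right_diff_distrib)
  have r_van: "mus i (r x) = 0" if x: "lpt l ^ (2 * (n - 1)) dvd lg x" for x
  proof (cases "n = 1")
    case True
    \<comment> \<open>For \<open>n = 1\<close> the truncated exponent \<open>n + (n - 2)\<close> is
      1, so the assumption \<open>van\<close> says that the character at this root is zero.\<close>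
    then show ?thesis using r_sub[of x, unfolded sub_fi] by (intro van) (simp add: A_def flip: n_def)
  next
    case False
    then have e: "2 * (n - 1) = n + (n - 2)" "n - 1 < n" using n by auto
    then have "tau l (n - 1) (lg x) = 0" using x n False by (intro tau_dvd[OF l]) auto
    then have "r x = x" by (simp add: r_def)
    then show ?thesis using van[of x] x[unfolded e(1), unfolded n_def l_def] by simp
  qed
  have r_id: "r x = x" if "A i dvd lg x" for x
    using tau_dvd[OF l, of n "lg x" "n - 1"] that n by (simp add: r_def A_def n_def l_def)
  have char': "lie_char (vir_sub f') \<mu>'"
  proof (rule lie_charI)
    fix v c assume v: "v \<in> vir_sub f'"
    have "mus j (smul c v) = c * mus j v" if "j \<in> I - {i}" for j
      using that by (intro char_smul[OF fi0 mus_char] sub_fi' v) auto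
    then show "\<mu>' (smul c v) = c * \<mu>' v"
      using char_smul[OF fi0[OF i] mus_char[OF i] r_sub[OF sub_l[OF v]]]
      by (simp add: \<mu>'_def r_smul sum_distrib_left distrib_left)
    fix w assume w: "w \<in> vir_sub f'"
    have "mus j (v + w) = mus j v + mus j w" if "j \<in> I - {i}" for j
      using that by (intro char_add[OF fi0 mus_char] sub_fi' v w) auto
    then show "\<mu>' (v + w) = \<mu>' v + \<mu>' w"
      using char_add[OF fi0[OF i] mus_char[OF i] r_sub[OF sub_l[OF v]] r_sub[OF sub_l[OF w]]]
      by (simp add: \<mu>'_def r_add sum.distrib)
  next
    fix v assume v: "LP f' ^ 2 dvd lg v"
    have "mus j v = 0" if "j \<in> I - {i}" for j
      using that dvd_trans[OF dvd_power_same[OF A_f'[OF that]] v]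
      by (intro char_square[OF fi0 mus_char]) (auto simp: LPfi)
    moreover have "mus i (r v) = 0"
      using dvd_trans[OF dvd_power_same[OF l_f'] v] by (intro r_van) (simp add: power_mult mult.commute flip: power_mult)
    ultimately show "\<mu>' v = 0" by (simp add: \<mu>'_def)
  qed
  have eq: "\<mu>' v = \<mu> v" if v: "v \<in> vir_sub f" for v
  proof -
    have "r v = v" using sub_f_fi[OF i v] by (intro r_id) (simp add: sub_fi)
    then show ?thesis using sum.remove[OF _ i, of "\<lambda>j. mus j v"] by (simp add: \<mu>'_def mu_sum[OF v])
  qed
  have le: "J f \<mu> \<subseteq> J f' \<mu>'"
    unfolding J_def
  proof (rule pm.span_mono, rule Un_mono[OF order_refl], clarify)
    fix u x assume "x \<in> vir_sub f"
    then show "\<exists>u' x'. bv u * (gen x - Poly_Mapping.single 0 (\<mu> x)) =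
        bv u' * (gen x' - Poly_Mapping.single 0 (\<mu>' x')) \<and> x' \<in> vir_sub f'"
      using sub eq by metis
  qed
  have ne: "J f' \<mu>' \<noteq> J f \<mu>"
  proof
    assume eqJ: "J f' \<mu>' = J f \<mu>"
    \<comment> \<open>This field lies in the larger subalgebra, so equality of the left ideals would
      make it act by a scalar on the cyclic vector. Then \<open>gen_J\<close>, tested on
      \<open>bv 1\<close>, would force \<open>l * poly G l = 0\<close>, although \<open>G\<close>
      has no root at \<open>l\<close>.\<close>
    let ?v = "e_of (LP f')"
    have "gen ?v - Poly_Mapping.single 0 (\<mu>' ?v) \<in> J f \<mu>"
      using J_char[of ?v f' 1 \<mu>'] by (simp add: vir_sub_iff eqJ)
    then have "tau l (n - 1) (LP f' * D (bv 1)) = 0" using gen_J[OF i, of ?v _ "bv 1"] by (simp add: l_def n_def)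
    moreover have "LP f' * D (bv 1) = lpt l ^ (n - 1) * (bv 1 * LP G)" by (simp add: LPf' mult_ac)
    ultimately have "tau l (n - 1) (lpt l ^ (n - 1) * (bv 1 * LP G)) = 0" by (simp only:)
    then have "l * poly G l = 0" by (simp add: tau_lpt_power[OF l] tau_0_poly[OF l])
    then obtain j where j: "j \<in> I - {i}" "lam j = l" using l by (auto simp: G_def poly_prod)
    then show False using inj_onD[OF inj_lam, of j i] i by (auto simp: l_def)
  qed
  show ?thesis using le ne J_proper[OF f'0 char'] by blast
qed

text \<open>Simplicity is maximality of the left ideal. If the degree condition fails at a root, the
  character there already vanishes from order \<open>n + (n - 2)\<close> on, and
  \<open>not_maximal\<close> provides a strictly larger proper left ideal.\<close>

lemma is_quot_simple_iff:
  assumes f0: "coeff f 0 \<noteq> 0" and mu: "lie_char (vir_sub f) \<mu>" and "is_quot f \<mu> M"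
  shows "vir_simple M \<longleftrightarrow> large_degree f \<mu>"
proof -
  obtain \<pi> where pres: "presents M UNIV (J f \<mu>) (\<lambda>v p. gen v * p) \<pi>" using assms(3) by (auto simp: is_quot_def)
  have ne: "J f \<mu> \<noteq> UNIV" using J_proper[OF f0 mu] by blast
  have simple: "vir_simple M \<longleftrightarrow>
      (\<forall>W. pm.subspace W \<and> J f \<mu> \<subseteq> W \<and> (\<forall>v. \<forall>p\<in>W. gen v * p \<in> W) \<longrightarrow> W = J f \<mu> \<or> W = UNIV)"
    using vmod.simple_pres[OF vmod_J pres] ne by simp
  show ?thesis
  proof
    assume "large_degree f \<mu>"
    then show "vir_simple M" unfolding simple using large_degree_maximal by blast
  next
    assume "vir_simple M"
    then have max: "W = J f \<mu> \<or> W = UNIV" if "pm.subspace W" "J f \<mu> \<subseteq> W" "\<And>v p. p \<in> W \<Longrightarrow> gen v * p \<in> W" for W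
      using that unfolding simple by blast
    obtain a k lam ns mus where dec: "decomposition f \<mu> a k lam ns mus" by (rule decomposition_exists[OF f0 mu])
    interpret decomp k lam ns f \<mu> a mus using dec decomp_iff by blast
    have "\<exists>p. (\<forall>j. mus i (vir_gen (fi i) j) = poly p (of_int j) * lam i powi j) \<and> (p = 0 \<or> degree p < ns i)"
      if "i \<in> {1..k}" for i
      by (rule char_poly[OF lam_0[OF that] mus_char[OF that]])
    then obtain ps where ps: "\<And>i j. i \<in> {1..k} \<Longrightarrow> mus i (vir_gen (fi i) j) = poly (ps i) (of_int j) * lam i powi j"
      and deg: "\<And>i. i \<in> {1..k} \<Longrightarrow> ps i = 0 \<or> degree (ps i) < ns i" by metis
    have "ps i \<noteq> 0 \<and> degree (ps i) < ns i \<and> int (degree (ps i)) \<ge> int (ns i) - 2" if i: "i \<in> {1..k}" for i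
    proof (rule ccontr)
      assume "\<not> ?thesis"
      \<comment> \<open>Truncation of \<open>ns i - 2\<close> is intended: for
        \<open>ns i \<le> 2\<close> only the zero polynomial counts as small.\<close>
      then have small: "ps i = 0 \<or> degree (ps i) < ns i - 2" using deg[OF i] by linarith
      let ?m = "ns i + (ns i - 2)"
      have b: "mus i (e_of (bv j * lpt (lam i) ^ ?m)) = 0" for j
        unfolding char_fd[OF lam_0[OF i] mus_char[OF i] ps[OF i]] fd_poly_0[OF refl small] by simp
      have van: "mus i v = 0" if v: "lpt (lam i) ^ ?m dvd lg v" for v
      proof -
        obtain g where g: "lg v = g * lpt (lam i) ^ ?m" using v by (metis dvdE mult.commute)
        have mem: "e_of (h * lpt (lam i) ^ ?m) \<in> vir_sub (fi i)" for h
          by (simp add: sub_fi A_def power_add)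
        have "linc (\<lambda>h. mus i (e_of (h * lpt (lam i) ^ ?m)))"
          unfolding linc_def using char_add[OF fi0[OF i] mus_char[OF i] mem mem] char_smul[OF fi0[OF i] mus_char[OF i] mem]
          by (simp add: distrib_right lin_add[OF lin_e_of] lin_smul[OF lin_mult_right] lin_smul[OF lin_e_of])
        moreover have "linc (\<lambda>_ :: laurent. 0)" by (simp add: linc_def)
        ultimately have "mus i (e_of (g * lpt (lam i) ^ ?m)) = 0" by (rule linc_eqI) (rule b)
        moreover have "mus i v = mus i (e_of (lg v))"
          by (rule char_lg[OF fi0[OF i] mus_char[OF i]]) (use mem[of g] g in \<open>auto simp: sub_fi\<close>)
        ultimately show ?thesis by (simp add: g)
      qed
      from not_maximal[OF i van] obtain f' \<mu>' where f': "J f \<mu> \<subseteq> J f' \<mu>'" "1 \<notin> J f' \<mu>'" "J f' \<mu>' \<noteq> J f \<mu>" by blast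
      then show False using max[OF subspace_J f'(1)] J_left by blast
    qed
    then show "large_degree f \<mu>" unfolding large_degree_def using dec ps by blast
  qed
qed

theorem (in decomp) tensor_iso:
  "tensor I (\<lambda>i. induced (fi i) (mus i)) \<cong>\<^sub>V induced f \<mu>"
  by (rule is_quot_iso[OF is_quot_tensor is_quot_induced[OF mu_char]]) (rule is_quot_induced[OF mus_char])

theorem corollary6p6:
  shows
    "(\<forall>(k::nat) (lam :: nat \<Rightarrow> complex) (ns :: nat \<Rightarrow> nat) (mus :: nat \<Rightarrow> vir \<Rightarrow> complex).
        k \<ge> 1 \<and> inj_on lam {1..k} \<and> (\<forall>i\<in>{1..k}. lam i \<noteq> 0 \<and> ns i \<ge> 1) \<and>
        (\<forall>i\<in>{1..k}. lie_char (vir_sub (linpow (lam i) (ns i))) (mus i)) \<longrightarrow>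
        tensor {1..k} (\<lambda>i. induced (linpow (lam i) (ns i)) (mus i)) \<cong>\<^sub>V
          induced (\<Prod>i=1..k. linpow (lam i) (ns i)) (\<lambda>x. \<Sum>i=1..k. mus i x)) \<and>
     (\<forall>(f :: complex poly) (\<mu> :: vir \<Rightarrow> complex).
        coeff f 0 \<noteq> 0 \<and> lie_char (vir_sub f) \<mu> \<longrightarrow>
        (\<exists>a k lam ns mus. decomposition f \<mu> a k lam ns mus \<and>
           tensor {1..k} (\<lambda>i. induced (linpow (lam i) (ns i)) (mus i)) \<cong>\<^sub>V induced f \<mu>) \<and>
        (vir_simple (induced f \<mu>) \<longleftrightarrow> large_degree f \<mu>))"
proof (intro conjI allI impI)
  fix k :: nat and lam :: "nat \<Rightarrow> complex" and ns :: "nat \<Rightarrow> nat" and mus :: "nat \<Rightarrow> vir \<Rightarrow> complex"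
  assume "k \<ge> 1 \<and> inj_on lam {1..k} \<and> (\<forall>i\<in>{1..k}. lam i \<noteq> 0 \<and> ns i \<ge> 1) \<and>
        (\<forall>i\<in>{1..k}. lie_char (vir_sub (linpow (lam i) (ns i))) (mus i))"
  then have "decomposition (\<Prod>i=1..k. linpow (lam i) (ns i)) (\<lambda>x. \<Sum>i=1..k. mus i x) 1 k lam ns mus"
    by (simp add: decomposition_def)
  then show "tensor {1..k} (\<lambda>i. induced (linpow (lam i) (ns i)) (mus i)) \<cong>\<^sub>V
      induced (\<Prod>i=1..k. linpow (lam i) (ns i)) (\<lambda>x. \<Sum>i=1..k. mus i x)"
    by (intro decomp.tensor_iso) (simp only: decomp_iff)
next
  fix f :: "complex poly" and \<mu> :: "vir \<Rightarrow> complex"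
  assume "coeff f 0 \<noteq> 0 \<and> lie_char (vir_sub f) \<mu>"
  then have f: "coeff f 0 \<noteq> 0" "lie_char (vir_sub f) \<mu>" by auto
  show "\<exists>a k lam ns mus. decomposition f \<mu> a k lam ns mus \<and>
      tensor {1..k} (\<lambda>i. induced (linpow (lam i) (ns i)) (mus i)) \<cong>\<^sub>V induced f \<mu>"
  proof -
    obtain a k lam ns mus where dec: "decomposition f \<mu> a k lam ns mus" by (rule decomposition_exists[OF f])
    then have "tensor {1..k} (\<lambda>i. induced (linpow (lam i) (ns i)) (mus i)) \<cong>\<^sub>V induced f \<mu>"
      by (intro decomp.tensor_iso) (simp only: decomp_iff)
    with dec show ?thesis by blast
  qed
  show "vir_simple (induced f \<mu>) \<longleftrightarrow> large_degree f \<mu>"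
    by (rule is_quot_simple_iff[OF f is_quot_induced[OF f(2)]])
qed

end
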